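(* Let $(M,g)$ be a smooth closed Riemannian manifold of dimension $n\ge2$. For $\lambda>0$ let $e_\lambda$ denote a real-valued non-constant eigenfunction of eigenvalue $\lambda^2$, i.e. $\Delta e_\lambda=\lambda^2e_\lambda$. Then the distance between the nodal set and the concentrating set of $e_\lambda$ is comparable to $1/\lambda$ as $\lambda\to\infty$. Moreover, there exist at least two nodal domains of $e_\lambda$ whose inner radii are comparable to $1/\lambda$ as $\lambda\to\infty$.
   Context: $M$ is compact without boundary, and $\Delta$ is the positive Laplace–Beltrami operator on $M$. For a continuous function $f:M\to\mathbb{R}$: the nodal set of $f$ is $f^{-1}(0)$; a nodal domain of $f$ is a connected component of $M\setminus f^{-1}(0)$; the concentrating set of $f$ is the set of points where $f$ attains its maximum or its minimum. Distances are with respect to the Riemannian distance. For an open domain $\Omega\subset M$ and $x\in\Omega$, $d(x)$ is the minimum distance from $x$ to the boundary $\partial\Omega$, and the inner radius of $\Omega$ is $R(\Omega)=\max_{x\in\Omega}d(x)$. A quantity $A(\lambda)>0$ is comparable to $B(\lambda)>0$ as $\lambda\to\infty$ if there are constants $C_1,C_2>0$, independent of $\lambda$ and of the choice of eigenfunction $e_\lambda$ (they may depend on $(M,g)$), such that $C_1B(\lambda)\le A(\lambda)\le C_2B(\lambda)$ for all sufficiently large $\lambda$ (with $\lambda^2$ ranging over eigenvalues of $\Delta$). *)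

theory Defs
  imports "HOL-Analysis.Analysis"
begin

section \<open>Smooth maps between Euclidean spaces\<close>

text \<open>\<open>C_k_on k U f\<close> is meant for open \<open>U\<close> only: all iterated partial derivatives up to
  order \<open>k\<close> exist and are continuous on \<open>U\<close>.\<close>

primrec C_k_on ::
  "nat \<Rightarrow> 'a::euclidean_space set \<Rightarrow> ('a \<Rightarrow> 'b::real_normed_vector) \<Rightarrow> bool" where
  "C_k_on 0 U f \<longleftrightarrow> continuous_on U f"
| "C_k_on (Suc k) U f \<longleftrightarrow>
     (\<forall>x\<in>U. f differentiable (at x)) \<and>
     (\<forall>b\<in>Basis. C_k_on k U (\<lambda>x. frechet_derivative f (at x) b))"

definition smooth_on ::
  "'a::euclidean_space set \<Rightarrow> ('a \<Rightarrow> 'b::real_normed_vector) \<Rightarrow> bool" where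
  "smooth_on U f \<longleftrightarrow> (\<forall>k. C_k_on k U f)"

definition partial_deriv :: "'n::finite \<Rightarrow> (real ^ 'n \<Rightarrow> real) \<Rightarrow> real ^ 'n \<Rightarrow> real" where
  "partial_deriv i h x = frechet_derivative h (at x) (axis i 1)"


section \<open>Closed Riemannian manifolds\<close>

text \<open>A chart is a pair \<open>(U, \<phi>)\<close> of a domain and a coordinate map; only the values of \<open>\<phi>\<close>
  on \<open>U\<close> matter.  The dimension of the manifold is \<open>CARD('n)\<close>.\<close>

type_synonym ('a, 'n) chart = "'a set \<times> ('a \<Rightarrow> real ^ 'n)"

definition dom_of :: "('a, 'n::finite) chart \<Rightarrow> 'a set" where
  "dom_of c = fst c"

definition coord :: "('a, 'n::finite) chart \<Rightarrow> 'a \<Rightarrow> real ^ 'n" where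
  "coord c = snd c"

definition param :: "('a, 'n::finite) chart \<Rightarrow> real ^ 'n \<Rightarrow> 'a" where
  "param c = inv_into (dom_of c) (coord c)"

definition is_chart :: "'a topology \<Rightarrow> ('a, 'n::finite) chart \<Rightarrow> bool" where
  "is_chart X c \<longleftrightarrow> openin X (dom_of c) \<and> open (coord c ` dom_of c) \<and>
     homeomorphic_map (subtopology X (dom_of c)) (top_of_set (coord c ` dom_of c)) (coord c)"

definition smooth_atlas :: "'a topology \<Rightarrow> ('a, 'n::finite) chart set \<Rightarrow> bool" where
  "smooth_atlas X A \<longleftrightarrow>
     (\<forall>c\<in>A. is_chart X c) \<and> (\<Union>c\<in>A. dom_of c) = topspace X \<and>
     (\<forall>c\<in>A. \<forall>d\<in>A. smooth_on (coord c ` (dom_of c \<inter> dom_of d)) (coord d \<circ> param c))"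

text \<open>A Riemannian metric is given by its Gram matrices \<open>g c p = (g\<^sub>i\<^sub>j(p))\<close> in the coordinate frame
  of each chart \<open>c\<close>; the last clause is the transformation law of a covariant 2-tensor, with the
  Jacobian matrix of the change of coordinates from \<open>c\<close> to \<open>d\<close>.\<close>

type_synonym ('a, 'n) metric_tensor = "('a, 'n) chart \<Rightarrow> 'a \<Rightarrow> real ^ 'n ^ 'n"

definition riemannian_metric ::
  "('a, 'n::finite) chart set \<Rightarrow> ('a, 'n) metric_tensor \<Rightarrow> bool" where
  "riemannian_metric A g \<longleftrightarrow>
     (\<forall>c\<in>A. smooth_on (coord c ` dom_of c) (\<lambda>x. g c (param c x))) \<and>
     (\<forall>c\<in>A. \<forall>p\<in>dom_of c. transpose (g c p) = g c p \<and> (\<forall>v. v \<noteq> 0 \<longrightarrow> v \<bullet> (g c p *v v) > 0)) \<and>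
     (\<forall>c\<in>A. \<forall>d\<in>A. \<forall>p\<in>dom_of c \<inter> dom_of d.
        let J = matrix (frechet_derivative (coord d \<circ> param c) (at (coord c p)))
        in g c p = transpose J ** g d p ** J)"

text \<open>Closed: compact, and without boundary because the charts take values in open subsets of
  Euclidean space.  Connectedness is not required.\<close>

definition closed_riemannian_manifold ::
  "'a topology \<Rightarrow> ('a, 'n::finite) chart set \<Rightarrow> ('a, 'n) metric_tensor \<Rightarrow> bool" where
  "closed_riemannian_manifold X A g \<longleftrightarrow>
     Hausdorff_space X \<and> second_countable X \<and> compact_space X \<and>
     smooth_atlas X A \<and> riemannian_metric A g"


section \<open>Riemannian distance\<close>

definition C1_curve_on ::
  "('a, 'n::finite) chart set \<Rightarrow> real set \<Rightarrow> (real \<Rightarrow> 'a) \<Rightarrow> bool" where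
  "C1_curve_on A T \<gamma> \<longleftrightarrow>
     (\<forall>c\<in>A. \<exists>D. continuous_on {t\<in>T. \<gamma> t \<in> dom_of c} D \<and>
        (\<forall>t\<in>T. \<gamma> t \<in> dom_of c \<longrightarrow> ((coord c \<circ> \<gamma>) has_vector_derivative D t) (at t within T)))"

text \<open>\<open>S\<close> is the set of break points of a partition of \<open>[0,1]\<close>; the curve is \<open>C\<^sup>1\<close> up to the end
  points on each closed interval of the partition.\<close>

definition piecewise_C1_curve ::
  "'a topology \<Rightarrow> ('a, 'n::finite) chart set \<Rightarrow> (real \<Rightarrow> 'a) \<Rightarrow> bool" where
  "piecewise_C1_curve X A \<gamma> \<longleftrightarrow> pathin X \<gamma> \<and>
     (\<exists>S. finite S \<and> {0, 1} \<subseteq> S \<and> S \<subseteq> {0..1} \<and>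
        (\<forall>a\<in>S. \<forall>b\<in>S. a < b \<and> S \<inter> {a<..<b} = {} \<longrightarrow> C1_curve_on A {a..b} \<gamma>))"

text \<open>The speed does not depend on the chart chosen at \<open>\<gamma> t\<close>.  Its value at the finitely many break
  points is irrelevant for the length.\<close>

definition speed ::
  "('a, 'n::finite) chart set \<Rightarrow> ('a, 'n) metric_tensor \<Rightarrow> (real \<Rightarrow> 'a) \<Rightarrow> real \<Rightarrow> real" where
  "speed A g \<gamma> t =
     (let c = (SOME c. c \<in> A \<and> \<gamma> t \<in> dom_of c);
          v = vector_derivative (coord c \<circ> \<gamma>) (at t within {0..1})
      in sqrt (v \<bullet> (g c (\<gamma> t) *v v)))"

definition curve_length ::
  "('a, 'n::finite) chart set \<Rightarrow> ('a, 'n) metric_tensor \<Rightarrow> (real \<Rightarrow> 'a) \<Rightarrow> real" where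
  "curve_length A g \<gamma> = integral {0..1} (speed A g \<gamma>)"

text \<open>Distances are extended reals: points in different components are at distance \<open>\<infinity>\<close>, and so
  is anything from the empty set.\<close>

definition riem_dist ::
  "'a topology \<Rightarrow> ('a, 'n::finite) chart set \<Rightarrow> ('a, 'n) metric_tensor \<Rightarrow> 'a \<Rightarrow> 'a \<Rightarrow> ereal" where
  "riem_dist X A g x y =
     (INF \<gamma>\<in>{\<gamma>. piecewise_C1_curve X A \<gamma> \<and> \<gamma> 0 = x \<and> \<gamma> 1 = y}. ereal (curve_length A g \<gamma>))"

definition riem_set_dist ::
  "'a topology \<Rightarrow> ('a, 'n::finite) chart set \<Rightarrow> ('a, 'n) metric_tensor \<Rightarrow>
    'a set \<Rightarrow> 'a set \<Rightarrow> ereal" where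
  "riem_set_dist X A g S T = (INF x\<in>S. INF y\<in>T. riem_dist X A g x y)"

definition inner_radius ::
  "'a topology \<Rightarrow> ('a, 'n::finite) chart set \<Rightarrow> ('a, 'n) metric_tensor \<Rightarrow> 'a set \<Rightarrow> ereal" where
  "inner_radius X A g \<Omega> = (SUP x\<in>\<Omega>. INF y\<in>X frontier_of \<Omega>. riem_dist X A g x y)"


section \<open>The Laplace--Beltrami operator and its eigenfunctions\<close>

definition smooth_function :: "('a, 'n::finite) chart set \<Rightarrow> ('a \<Rightarrow> real) \<Rightarrow> bool" where
  "smooth_function A f \<longleftrightarrow> (\<forall>c\<in>A. smooth_on (coord c ` dom_of c) (f \<circ> param c))"

text \<open>Local expression of the positive Laplacian \<open>\<Delta> = - div grad\<close> in the chart \<open>c\<close>: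
  \<open>- (1 / \<surd>det g) \<Sum>\<^sub>i \<partial>\<^sub>i (\<surd>det g \<Sum>\<^sub>j g\<^sup>i\<^sup>j \<partial>\<^sub>j f)\<close>.\<close>

definition laplacian_in_chart ::
  "('a, 'n::finite) metric_tensor \<Rightarrow> ('a, 'n) chart \<Rightarrow> ('a \<Rightarrow> real) \<Rightarrow> 'a \<Rightarrow> real" where
  "laplacian_in_chart g c f p =
     (let G = (\<lambda>x. g c (param c x));
          F = (\<lambda>i x. sqrt (det (G x)) *
                 (\<Sum>j\<in>UNIV. matrix_inv (G x) $ i $ j * partial_deriv j (f \<circ> param c) x));
          x = coord c p
      in - (\<Sum>i\<in>UNIV. partial_deriv i (F i) x) / sqrt (det (G x)))"

text \<open>\<open>h = \<Delta> f\<close>.  The local expressions of \<open>\<Delta> f\<close> agree on overlaps of charts, so quantifying over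
  all charts around a point is the same as choosing one.\<close>

definition has_laplacian ::
  "('a, 'n::finite) chart set \<Rightarrow> ('a, 'n) metric_tensor \<Rightarrow> ('a \<Rightarrow> real) \<Rightarrow> ('a \<Rightarrow> real) \<Rightarrow> bool" where
  "has_laplacian A g f h \<longleftrightarrow> (\<forall>c\<in>A. \<forall>p\<in>dom_of c. laplacian_in_chart g c f p = h p)"

definition nonconstant_eigenfunction ::
  "'a topology \<Rightarrow> ('a, 'n::finite) chart set \<Rightarrow> ('a, 'n) metric_tensor \<Rightarrow>
    real \<Rightarrow> ('a \<Rightarrow> real) \<Rightarrow> bool" where
  "nonconstant_eigenfunction X A g \<mu> e \<longleftrightarrow>
     smooth_function A e \<and> \<not> (e constant_on topspace X) \<and>
     has_laplacian A g e (\<lambda>p. \<mu>\<^sup>2 * e p)"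


section \<open>Nodal and concentrating sets\<close>

definition nodal_set :: "'a topology \<Rightarrow> ('a \<Rightarrow> real) \<Rightarrow> 'a set" where
  "nodal_set X f = {x \<in> topspace X. f x = 0}"

definition nodal_domains :: "'a topology \<Rightarrow> ('a \<Rightarrow> real) \<Rightarrow> 'a set set" where
  "nodal_domains X f = connected_components_of (subtopology X (topspace X - nodal_set X f))"

definition concentrating_set :: "'a topology \<Rightarrow> ('a \<Rightarrow> real) \<Rightarrow> 'a set" where
  "concentrating_set X f =
     {x \<in> topspace X. (\<forall>y\<in>topspace X. f y \<le> f x) \<or> (\<forall>y\<in>topspace X. f x \<le> f y)}"


section \<open>Comparability as the frequency tends to infinity\<close>

text \<open>\<open>E \<mu> e\<close> says that \<open>e\<close> is an admissible function at frequency \<open>\<mu>\<close>; the constants are uniform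
  in \<open>\<mu>\<close> and \<open>e\<close>.\<close>

definition comparable_at_infinity ::
  "(real \<Rightarrow> 'e \<Rightarrow> bool) \<Rightarrow> (real \<Rightarrow> 'e \<Rightarrow> ereal) \<Rightarrow> (real \<Rightarrow> real) \<Rightarrow> bool" where
  "comparable_at_infinity E Q B \<longleftrightarrow>
     (\<exists>C1>0. \<exists>C2>0. \<forall>\<^sub>F \<mu> in at_top. \<forall>e. E \<mu> e \<longrightarrow>
        ereal (C1 * B \<mu>) \<le> Q \<mu> e \<and> Q \<mu> e \<le> ereal (C2 * B \<mu>))"

end

theory Submission
  imports Defs
begin

text \<open>
  Lower bound for the distance. Let \<open>q\<close> be a minimum point of \<open>e\<close>, \<open>m = - e q > 0\<close>, and \<open>u = e + 2 m\<close>,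
  so that \<open>u \<ge> m\<close> on all of \<open>M\<close>. Since \<open>u\<close> is positive globally, Bernstein's method applies without cut-off:
  evaluating the Bochner inequality for \<open>f = ln u\<close> at a maximum point of \<open>\<bar>\<nabla>f\<bar>\<^sup>2\<close> gives
  \<open>\<bar>\<nabla>f\<bar> \<le> C (1 + \<mu>)\<close>. Between \<open>q\<close> and a zero of \<open>e\<close> the function \<open>f\<close> increases by \<open>ln 2\<close>,
  so any curve joining them has length at least \<open>c / \<mu>\<close>; maximum points are handled by \<open>- e\<close>.
  No comparison of \<open>max e\<close> with \<open>- min e\<close> is needed.

  Upper bounds. Comparing a positive eigenfunction with \<open>(R\<^sup>2 - \<bar>y - x\<bar>\<^sup>2)\<^sup>2\<close> shows that every coordinate ball
  of radius \<open>C / \<mu>\<close> contains a zero. Compactness makes all constants uniform. The nodal domains of a maximum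
  and of a minimum point have frontier in the nodal set, so their inner radii inherit both bounds.
\<close>

section \<open>Smooth functions and partial derivatives\<close>

text \<open>Why the shift works: \<open>u = e + k\<close> solves the equation with right side
  \<open>- M * (u - k)\<close>, so \<open>ln u\<close> has the source term
  \<open>- M + M * k / u\<close>. Once \<open>k \<le> 2 * u\<close>, this is bounded by
  \<open>M\<close>, whatever the size of \<open>max e\<close>. \<open>admissible_shift\<close>
  records exactly this; it also allows every \<open>k > 0\<close> when \<open>e \<ge> 0\<close>,
  which is how the strong maximum principle is obtained. No curvature appears: everything is
  computed with the coefficients of the Laplacian in a chart and their derivatives, bounded on
  compact coordinate balls, and third derivatives of \<open>ln u\<close> are removed by
  differentiating the equation. The maximum point of the squared gradient is not known in advance,
  so the estimate is proved near every point with constants independent of \<open>e\<close>, and a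
  finite subcover supplies a single constant. The manifold may be disconnected, and an eigenfunction
  may vanish on a whole component. That \<open>e\<close> takes both signs is derived from clopen
  sets and the maximum principle instead of an integral identity. For the inner radius a zero must
  be reached along a connected set, which explains the form of \<open>zero_within\<close>.\<close>

lemma frechet_derivative_cong_open:
  assumes "open U" "x \<in> U" "\<And>y. y \<in> U \<Longrightarrow> f y = g y"
  shows "frechet_derivative f (at x) = frechet_derivative g (at x)"
proof -
  have "(f has_derivative F) (at x) \<longleftrightarrow> (g has_derivative F) (at x)" for F
    using assms has_derivative_transform_within_open[of f F x UNIV U g]
      has_derivative_transform_within_open[of g F x UNIV U f] by auto
  then show ?thesis
    unfolding frechet_derivative_def by simp
qed

section \<open>Closure of \<open>C_k_on\<close> and \<open>smooth_on\<close> under the operations of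
  calculus\<close>

lemma C_k_on_cong:
  assumes "open U" "\<And>x. x \<in> U \<Longrightarrow> f x = g x"
  shows "C_k_on k U f \<longleftrightarrow> C_k_on k U g"
  using assms(2)
proof (induction k arbitrary: f g)
  case 0
  then show ?case by (auto cong: continuous_on_cong)
next
  case (Suc k)
  have "f differentiable (at x) \<longleftrightarrow> g differentiable (at x)" if "x \<in> U" for x
    using Suc.prems that assms(1) has_derivative_transform_within_open[of f _ x UNIV U g]
      has_derivative_transform_within_open[of g _ x UNIV U f] unfolding differentiable_def by fastforce
  moreover have "C_k_on k U (\<lambda>x. frechet_derivative f (at x) b) \<longleftrightarrow>
      C_k_on k U (\<lambda>x. frechet_derivative g (at x) b)" for b
    by (intro Suc.IH fun_cong[OF frechet_derivative_cong_open[OF assms(1) _ Suc.prems]])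
  ultimately show ?case by simp
qed

lemma C_k_on_subset: "C_k_on k U f \<Longrightarrow> V \<subseteq> U \<Longrightarrow> C_k_on k V f"
  by (induction k arbitrary: f) (auto intro: continuous_on_subset)

lemma C_k_on_SucD: "C_k_on (Suc k) U f \<Longrightarrow> C_k_on k U f"
proof (induction k arbitrary: f)
  case 0
  then show ?case
    by (auto intro!: continuous_at_imp_continuous_on differentiable_imp_continuous_within)
next
  case (Suc k)
  from Suc.prems have "(\<forall>x\<in>U. f differentiable (at x)) \<and>
      (\<forall>b\<in>Basis. C_k_on (Suc k) U (\<lambda>x. frechet_derivative f (at x) b))"
    by (simp only: C_k_on.simps(2)[of "Suc k"])
  with Suc.IH show ?case by (simp only: C_k_on.simps(2)[of k]) blast
qed

lemma C_k_on_const: "C_k_on k U (\<lambda>x. c)"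
  by (induction k arbitrary: c) auto

lemma C_k_on_id: "C_k_on k U (\<lambda>x. x)"
  by (cases k) (auto intro: C_k_on_const)

lemma C_k_on_has_derivative:
  "C_k_on (Suc k) U f \<Longrightarrow> x \<in> U \<Longrightarrow> (f has_derivative frechet_derivative f (at x)) (at x)"
  by (simp add: frechet_derivative_works[symmetric])

text \<open>Uniqueness of the derivative lets any explicit family \<open>F\<close> stand in for
  \<open>frechet_derivative\<close>. The closure proofs below supply \<open>F\<close> from the usual
  differentiation rules and then argue by induction on \<open>k\<close>.\<close>

lemma C_k_on_SucI:
  assumes "open U" and d: "\<And>x. x \<in> U \<Longrightarrow> (f has_derivative F x) (at x)"
    and F: "\<And>b. b \<in> Basis \<Longrightarrow> C_k_on k U (\<lambda>x. F x b)"
  shows "C_k_on (Suc k) U f"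
proof -
  have "C_k_on k U (\<lambda>x. frechet_derivative f (at x) b)" if "b \<in> Basis" for b
    by (rule C_k_on_cong[OF assms(1), THEN iffD1, OF _ F[OF that]])
      (simp add: frechet_derivative_at[OF d, symmetric])
  then show ?thesis using d by (auto simp: differentiable_def)
qed

lemma C_k_on_bounded_linear:
  assumes "open U" "bounded_linear T" "C_k_on k U f"
  shows "C_k_on k U (\<lambda>x. T (f x))"
  using assms(3)
proof (induction k arbitrary: f)
  case 0
  then show ?case using assms(2) by (auto intro: bounded_linear.continuous_on)
next
  case (Suc k)
  show ?case
  proof (rule C_k_on_SucI[OF assms(1)])
    show "((\<lambda>x. T (f x)) has_derivative (\<lambda>b. T (frechet_derivative f (at x) b))) (at x)" if "x \<in> U" for x
      by (rule bounded_linear.has_derivative[OF assms(2) C_k_on_has_derivative[OF Suc.prems that]])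
  qed (use Suc in auto)
qed

lemma C_k_on_add:
  assumes "open U" "C_k_on k U f" "C_k_on k U g"
  shows "C_k_on k U (\<lambda>x. f x + g x)"
  using assms(2,3)
proof (induction k arbitrary: f g)
  case 0
  then show ?case by (simp add: continuous_on_add)
next
  case (Suc k)
  show ?case
  proof (rule C_k_on_SucI[OF assms(1)])
    show "((\<lambda>x. f x + g x) has_derivative
        (\<lambda>b. frechet_derivative f (at x) b + frechet_derivative g (at x) b)) (at x)" if "x \<in> U" for x
      by (rule has_derivative_add[OF Suc.prems[THEN C_k_on_has_derivative, OF that]])
  qed (use Suc in auto)
qed

lemma C_k_on_mult:
  fixes f g :: "'a::euclidean_space \<Rightarrow> real"
  assumes "open U" "C_k_on k U f" "C_k_on k U g"
  shows "C_k_on k U (\<lambda>x. f x * g x)"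
  using assms(2,3)
proof (induction k arbitrary: f g)
  case 0
  then show ?case by (simp add: continuous_on_mult)
next
  case (Suc k)
  show ?case
  proof (rule C_k_on_SucI[OF assms(1)])
    show "((\<lambda>x. f x * g x) has_derivative
        (\<lambda>b. f x * frechet_derivative g (at x) b + frechet_derivative f (at x) b * g x)) (at x)" if "x \<in> U" for x
      by (rule has_derivative_mult[OF Suc.prems[THEN C_k_on_has_derivative, OF that]])
  qed (use Suc.IH Suc.prems[THEN C_k_on_SucD] Suc.prems in \<open>auto intro!: C_k_on_add[OF assms(1)]\<close>)
qed

text \<open>The derivative of \<open>1 / f\<close> contains only \<open>f'\<close> and
  \<open>1 / f\<close> itself, both of order \<open>k\<close> by induction. The sign is written as a
  factor \<open>- 1\<close> so that the product rule with a constant applies.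
  \<open>C_k_on_sqrt\<close> follows the same pattern.\<close>

lemma C_k_on_inverse:
  fixes f :: "'a::euclidean_space \<Rightarrow> real"
  assumes "open U" "C_k_on k U f" "\<And>x. x \<in> U \<Longrightarrow> f x \<noteq> 0"
  shows "C_k_on k U (\<lambda>x. inverse (f x))"
  using assms(2)
proof (induction k)
  case 0
  then show ?case using assms(3) by (simp add: continuous_on_inverse)
next
  case (Suc k)
  show ?case
  proof (rule C_k_on_SucI[OF assms(1)])
    show "((\<lambda>x. inverse (f x)) has_derivative
        (\<lambda>b. - 1 * (inverse (f x) * frechet_derivative f (at x) b * inverse (f x)))) (at x)" if "x \<in> U" for x
      using Deriv.has_derivative_inverse[OF assms(3)[OF that] C_k_on_has_derivative[OF Suc.prems that]] by simp
  qed (use Suc.IH[OF C_k_on_SucD] Suc.prems in \<open>intro C_k_on_mult[OF assms(1)] C_k_on_const, auto\<close>)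
qed

lemma C_k_on_sqrt:
  fixes f :: "'a::euclidean_space \<Rightarrow> real"
  assumes "open U" "C_k_on k U f" "\<And>x. x \<in> U \<Longrightarrow> f x > 0"
  shows "C_k_on k U (\<lambda>x. sqrt (f x))"
  using assms(2)
proof (induction k)
  case 0
  then show ?case by (simp add: continuous_on_real_sqrt)
next
  case (Suc k)
  show ?case
  proof (rule C_k_on_SucI[OF assms(1)])
    show "((\<lambda>x. sqrt (f x)) has_derivative
        (\<lambda>b. frechet_derivative f (at x) b * inverse (2 * sqrt (f x)))) (at x)" if "x \<in> U" for x
      using has_derivative_real_sqrt[OF assms(3)[OF that] C_k_on_has_derivative[OF Suc.prems that]]
      by (simp add: field_simps)
    show "C_k_on k U (\<lambda>x. frechet_derivative f (at x) b * inverse (2 * sqrt (f x)))" if "b \<in> Basis" for b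
      using Suc.IH[OF C_k_on_SucD] Suc.prems that assms(3)
      by (intro C_k_on_mult[OF assms(1)] C_k_on_const C_k_on_inverse[OF assms(1)]) force+
  qed
qed

text \<open>No induction: the derivative \<open>f' / f\<close> no longer contains the logarithm, so
  the result for inverses suffices.\<close>

lemma C_k_on_ln:
  fixes f :: "'a::euclidean_space \<Rightarrow> real"
  assumes "open U" "C_k_on k U f" "\<And>x. x \<in> U \<Longrightarrow> f x > 0"
  shows "C_k_on k U (\<lambda>x. ln (f x))"
proof (cases k)
  case 0
  then show ?thesis using assms by (fastforce intro!: continuous_on_ln dest: less_imp_neq)
next
  case (Suc k)
  have f: "C_k_on (Suc k) U f" using assms(2) Suc by simp
  have "C_k_on (Suc k) U (\<lambda>x. ln (f x))"
  proof (rule C_k_on_SucI[OF assms(1)])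
    show "((\<lambda>x. ln (f x)) has_derivative (\<lambda>b. frechet_derivative f (at x) b * inverse (f x))) (at x)"
      if "x \<in> U" for x
      by (rule has_derivative_ln[OF assms(3)[OF that] C_k_on_has_derivative[OF f that]])
    show "C_k_on k U (\<lambda>x. frechet_derivative f (at x) b * inverse (f x))" if "b \<in> Basis" for b
      using f assms(3) that C_k_on_SucD[OF f]
      by (intro C_k_on_mult[OF assms(1)] C_k_on_inverse[OF assms(1)]) force+
  qed
  then show ?thesis using Suc by simp
qed

lemma smooth_on_cong:
  assumes "open U" "\<And>x. x \<in> U \<Longrightarrow> f x = g x"
  shows "smooth_on U f \<longleftrightarrow> smooth_on U g"
  unfolding smooth_on_def using C_k_on_cong[OF assms] by simp

lemma smooth_on_subset: "smooth_on U f \<Longrightarrow> V \<subseteq> U \<Longrightarrow> smooth_on V f"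
  by (auto simp: smooth_on_def intro: C_k_on_subset)

lemma smooth_on_const [intro]: "smooth_on U (\<lambda>x. c)"
  by (simp add: smooth_on_def C_k_on_const)

lemma smooth_on_id: "smooth_on U (\<lambda>x. x)"
  by (simp add: smooth_on_def C_k_on_id)

lemma smooth_on_bounded_linear:
  "open U \<Longrightarrow> bounded_linear T \<Longrightarrow> smooth_on U f \<Longrightarrow> smooth_on U (\<lambda>x. T (f x))"
  by (simp add: smooth_on_def C_k_on_bounded_linear)

lemma smooth_on_nth: "open U \<Longrightarrow> smooth_on U (\<lambda>x. x $ i)"
  by (rule smooth_on_bounded_linear[OF _ bounded_linear_vec_nth smooth_on_id])

lemma smooth_on_add:
  "open U \<Longrightarrow> smooth_on U f \<Longrightarrow> smooth_on U g \<Longrightarrow> smooth_on U (\<lambda>x. f x + g x)"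
  by (simp add: smooth_on_def C_k_on_add)

lemma smooth_on_mult:
  fixes f g :: "'a::euclidean_space \<Rightarrow> real"
  shows "open U \<Longrightarrow> smooth_on U f \<Longrightarrow> smooth_on U g \<Longrightarrow> smooth_on U (\<lambda>x. f x * g x)"
  by (simp add: smooth_on_def C_k_on_mult)

lemma smooth_on_uminus:
  "open U \<Longrightarrow> smooth_on U f \<Longrightarrow> smooth_on U (\<lambda>x. - f x)"
  by (rule smooth_on_bounded_linear[OF _ bounded_linear_minus[OF bounded_linear_ident]])

lemma smooth_on_diff:
  "open U \<Longrightarrow> smooth_on U f \<Longrightarrow> smooth_on U g \<Longrightarrow> smooth_on U (\<lambda>x. f x - g x)"
  using smooth_on_add[OF _ _ smooth_on_uminus, of U f g] by simp

lemma smooth_on_inverse: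
  fixes f :: "'a::euclidean_space \<Rightarrow> real"
  shows "open U \<Longrightarrow> smooth_on U f \<Longrightarrow> (\<And>x. x \<in> U \<Longrightarrow> f x \<noteq> 0) \<Longrightarrow> smooth_on U (\<lambda>x. inverse (f x))"
  by (simp add: smooth_on_def C_k_on_inverse)

lemma smooth_on_divide:
  fixes f g :: "'a::euclidean_space \<Rightarrow> real"
  assumes "open U" "smooth_on U f" "smooth_on U g" "\<And>x. x \<in> U \<Longrightarrow> g x \<noteq> 0"
  shows "smooth_on U (\<lambda>x. f x / g x)"
  unfolding divide_inverse using assms by (intro smooth_on_mult smooth_on_inverse)

lemma smooth_on_sqrt:
  fixes f :: "'a::euclidean_space \<Rightarrow> real"
  shows "open U \<Longrightarrow> smooth_on U f \<Longrightarrow> (\<And>x. x \<in> U \<Longrightarrow> f x > 0) \<Longrightarrow> smooth_on U (\<lambda>x. sqrt (f x))"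
  by (simp add: smooth_on_def C_k_on_sqrt)

lemma smooth_on_ln:
  fixes f :: "'a::euclidean_space \<Rightarrow> real"
  shows "open U \<Longrightarrow> smooth_on U f \<Longrightarrow> (\<And>x. x \<in> U \<Longrightarrow> f x > 0) \<Longrightarrow> smooth_on U (\<lambda>x. ln (f x))"
  by (simp add: smooth_on_def C_k_on_ln)

lemma smooth_on_sum:
  assumes "open U" "\<And>i. i \<in> I \<Longrightarrow> smooth_on U (f i)"
  shows "smooth_on U (\<lambda>x. \<Sum>i\<in>I. f i x)"
  using assms(2)
proof (induction I rule: infinite_finite_induct)
  case (insert i I)
  then show ?case by (simp add: smooth_on_add[OF assms(1)])
qed auto

lemma smooth_on_prod:
  fixes f :: "'i \<Rightarrow> 'a::euclidean_space \<Rightarrow> real"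
  assumes "open U" "\<And>i. i \<in> I \<Longrightarrow> smooth_on U (f i)"
  shows "smooth_on U (\<lambda>x. \<Prod>i\<in>I. f i x)"
  using assms(2)
proof (induction I rule: infinite_finite_induct)
  case (insert i I)
  then show ?case by (simp add: smooth_on_mult[OF assms(1)])
qed auto

lemma smooth_on_det:
  fixes G :: "'a::euclidean_space \<Rightarrow> real ^ 'n ^ 'n"
  assumes "open U" "\<And>i j. smooth_on U (\<lambda>x. G x $ i $ j)"
  shows "smooth_on U (\<lambda>x. det (G x))"
  unfolding det_def
  by (intro smooth_on_sum smooth_on_mult smooth_on_const smooth_on_prod assms)

lemma smooth_onD: "smooth_on U f \<Longrightarrow> C_k_on k U f"
  unfolding smooth_on_def by blast

lemma smooth_on_differentiable:
  "smooth_on U f \<Longrightarrow> x \<in> U \<Longrightarrow> f differentiable (at x)"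
  by (drule smooth_onD[of _ _ "Suc 0"]) simp

lemma smooth_on_continuous_on: "smooth_on U f \<Longrightarrow> continuous_on U f"
  by (drule smooth_onD[of _ _ 0]) simp

lemma smooth_on_frechet_derivative:
  assumes "smooth_on U f" "b \<in> Basis"
  shows "smooth_on U (\<lambda>x. frechet_derivative f (at x) b)"
  unfolding smooth_on_def
proof
  show "C_k_on k U (\<lambda>x. frechet_derivative f (at x) b)" for k
    using smooth_onD[OF assms(1), of "Suc k"] assms(2) by simp
qed

section \<open>Rules for partial derivatives\<close>

lemma smooth_on_partial_deriv: "smooth_on U f \<Longrightarrow> smooth_on U (partial_deriv i f)"
  unfolding partial_deriv_def by (intro smooth_on_frechet_derivative) auto

lemma partial_deriv_eq: "(f has_derivative F) (at x) \<Longrightarrow> partial_deriv i f x = F (axis i 1)"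
  unfolding partial_deriv_def using frechet_derivative_at by metis

lemma has_derivative_partial_deriv:
  fixes f :: "real ^ 'n::finite \<Rightarrow> real"
  assumes "f differentiable (at x)"
  shows "(f has_derivative (\<lambda>v. \<Sum>i\<in>UNIV. v $ i * partial_deriv i f x)) (at x)"
proof -
  let ?F = "frechet_derivative f (at x)"
  have d: "(f has_derivative ?F) (at x)"
    using assms frechet_derivative_works by blast
  then interpret linear ?F by (rule has_derivative_linear)
  have "?F v = (\<Sum>i\<in>UNIV. v $ i * partial_deriv i f x)" for v
  proof -
    have "?F v = ?F (\<Sum>i\<in>UNIV. (v $ i) *\<^sub>R axis i 1)"
      using basis_expansion[of v] by (simp add: scalar_mult_eq_scaleR)
    then show ?thesis by (simp add: sum scale partial_deriv_def)
  qed
  then show ?thesis using has_derivative_eq_rhs[OF d] by presburger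
qed

lemma partial_deriv_const [simp]: "partial_deriv i (\<lambda>x. c) x = 0"
  by (rule partial_deriv_eq) (rule has_derivative_const)

lemma partial_deriv_nth: "partial_deriv i (\<lambda>x. x $ j) x = (if i = j then 1 else 0)"
  using partial_deriv_eq[OF bounded_linear_imp_has_derivative[OF bounded_linear_vec_nth], of i j x]
  by (simp add: axis_def)

lemma partial_deriv_add:
  assumes "f differentiable (at x)" "g differentiable (at x)"
  shows "partial_deriv i (\<lambda>x. f x + g x) x = partial_deriv i f x + partial_deriv i g x"
  using partial_deriv_eq[OF has_derivative_add[OF assms[unfolded frechet_derivative_works]]]
  by (simp add: partial_deriv_def)

lemma partial_deriv_diff:
  assumes "f differentiable (at x)" "g differentiable (at x)"
  shows "partial_deriv i (\<lambda>x. f x - g x) x = partial_deriv i f x - partial_deriv i g x"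
  using partial_deriv_eq[OF has_derivative_diff[OF assms[unfolded frechet_derivative_works]]]
  by (simp add: partial_deriv_def)

lemma partial_deriv_uminus:
  assumes "f differentiable (at x)"
  shows "partial_deriv i (\<lambda>x. - f x) x = - partial_deriv i f x"
  using partial_deriv_eq[OF has_derivative_minus[OF assms[unfolded frechet_derivative_works]]]
  by (simp add: partial_deriv_def)

lemma partial_deriv_mult:
  assumes "f differentiable (at x)" "g differentiable (at x)"
  shows "partial_deriv i (\<lambda>x. f x * g x) x = f x * partial_deriv i g x + partial_deriv i f x * g x"
  using partial_deriv_eq[OF has_derivative_mult[OF assms[unfolded frechet_derivative_works]]]
  by (simp add: partial_deriv_def)

lemma partial_deriv_ln:
  assumes "f differentiable (at x)" "f x > 0"
  shows "partial_deriv i (\<lambda>x. ln (f x)) x = partial_deriv i f x / f x"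
  using partial_deriv_eq[OF has_derivative_ln[OF assms(2) assms(1)[unfolded frechet_derivative_works]]]
  by (simp add: partial_deriv_def divide_inverse)

lemma partial_deriv_inverse:
  assumes "f differentiable (at x)" "f x \<noteq> 0"
  shows "partial_deriv i (\<lambda>x. inverse (f x)) x = - partial_deriv i f x / (f x)\<^sup>2"
  using partial_deriv_eq[OF Deriv.has_derivative_inverse[OF assms(2) assms(1)[unfolded frechet_derivative_works]]]
  by (simp add: partial_deriv_def field_simps power2_eq_square)

lemma partial_deriv_sum:
  assumes "\<And>j. j \<in> J \<Longrightarrow> f j differentiable (at x)"
  shows "partial_deriv i (\<lambda>x. \<Sum>j\<in>J. f j x) x = (\<Sum>j\<in>J. partial_deriv i (f j) x)"
  using partial_deriv_eq[OF has_derivative_sum[of J f "\<lambda>j. frechet_derivative (f j) (at x)"]] assms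
  by (simp add: partial_deriv_def frechet_derivative_works[symmetric])

lemma partial_deriv_cong:
  assumes "open U" "x \<in> U" "\<And>y. y \<in> U \<Longrightarrow> f y = g y"
  shows "partial_deriv i f x = partial_deriv i g x"
  unfolding partial_deriv_def using frechet_derivative_cong_open[OF assms] by simp

lemma partial_deriv_uminus_on:
  assumes "open U" "smooth_on U f" "x \<in> U"
  shows "partial_deriv i (\<lambda>y. - f y) x = - partial_deriv i f x"
    "partial_deriv j (partial_deriv i (\<lambda>y. - f y)) x = - partial_deriv j (partial_deriv i f) x"
proof -
  have D: "partial_deriv i (\<lambda>y. - f y) y = - partial_deriv i f y" if "y \<in> U" for y
    by (rule partial_deriv_uminus[OF smooth_on_differentiable[OF assms(2) that]])
  show "partial_deriv i (\<lambda>y. - f y) x = - partial_deriv i f x" by (rule D[OF assms(3)])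
  show "partial_deriv j (partial_deriv i (\<lambda>y. - f y)) x = - partial_deriv j (partial_deriv i f) x"
    using partial_deriv_cong[OF assms(1,3) D]
      partial_deriv_uminus[OF smooth_on_differentiable[OF smooth_on_partial_deriv[OF assms(2)] assms(3)]] by simp
qed

section \<open>Restriction to lines: mixed derivatives and conditions at a minimum\<close>

lemma has_real_derivative_along_line:
  fixes f :: "real ^ 'n::finite \<Rightarrow> real"
  assumes "f differentiable (at (x + t *\<^sub>R v))"
  shows "((\<lambda>t. f (x + t *\<^sub>R v)) has_real_derivative
    (\<Sum>i\<in>UNIV. v $ i * partial_deriv i f (x + t *\<^sub>R v))) (at t)"
proof -
  have "((\<lambda>t. x + t *\<^sub>R v) has_derivative (\<lambda>s. s *\<^sub>R v)) (at t)"
    by (auto intro!: derivative_eq_intros)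
  from diff_chain_at[OF this has_derivative_partial_deriv[OF assms]]
  have "((\<lambda>t. f (x + t *\<^sub>R v)) has_derivative
      (\<lambda>s. \<Sum>i\<in>UNIV. (s *\<^sub>R v) $ i * partial_deriv i f (x + t *\<^sub>R v))) (at t)"
    by (simp add: o_def)
  then show ?thesis
    unfolding has_field_derivative_def
    by (rule has_derivative_eq_rhs) (auto simp: sum_distrib_left sum_distrib_right mult_ac fun_eq_iff)
qed

lemma partial_deriv_along_axis:
  fixes f :: "real ^ 'n::finite \<Rightarrow> real"
  assumes "f differentiable (at (x + t *\<^sub>R axis i 1))"
  shows "((\<lambda>t. f (x + t *\<^sub>R axis i 1)) has_real_derivative
    partial_deriv i f (x + t *\<^sub>R axis i 1)) (at t)"
proof -
  have "(\<Sum>j\<in>UNIV. axis i 1 $ j * partial_deriv j f (x + t *\<^sub>R axis i 1)) =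
      partial_deriv i f (x + t *\<^sub>R axis i 1)"
    by (simp add: axis_def if_distrib[of "\<lambda>c. c * _"] sum.delta cong: if_cong)
  then show ?thesis using has_real_derivative_along_line[OF assms] by simp
qed

text \<open>The mean value theorem is applied twice: in direction \<open>i\<close> to the difference
  of \<open>f\<close> on two parallel segments, and then in direction \<open>j\<close> to
  \<open>partial_deriv i f\<close>.\<close>

lemma second_difference_mean_value:
  fixes f :: "real ^ 'n::finite \<Rightarrow> real"
  assumes f: "smooth_on (ball x r) f" and s: "0 < s" "2 * s < r"
  obtains z where "dist x z \<le> 2 * s"
    "f (x + s *\<^sub>R axis i 1 + s *\<^sub>R axis j 1) - f (x + s *\<^sub>R axis i 1) - f (x + s *\<^sub>R axis j 1) + f x
      = s\<^sup>2 * partial_deriv j (partial_deriv i f) z"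
proof -
  let ?e = "\<lambda>i::'n. axis i (1::real)"
  have d: "dist x (x + a *\<^sub>R ?e i + b *\<^sub>R ?e j) \<le> 2 * s" if "0 \<le> a" "a \<le> s" "0 \<le> b" "b \<le> s" for a b
  proof -
    have "dist x (x + a *\<^sub>R ?e i + b *\<^sub>R ?e j) = norm (a *\<^sub>R ?e i + b *\<^sub>R ?e j)"
      by (simp add: dist_norm norm_minus_commute flip: norm_minus_cancel[of "a *\<^sub>R _ + _"])
    also have "\<dots> \<le> a + b"
      using norm_triangle_ineq[of "a *\<^sub>R ?e i" "b *\<^sub>R ?e j"] that by simp
    finally show ?thesis using that by simp
  qed
  have inb: "x + a *\<^sub>R ?e i + b *\<^sub>R ?e j \<in> ball x r" if "0 \<le> a" "a \<le> s" "0 \<le> b" "b \<le> s" for a b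
    using d[OF that] s by simp
  have df: "h differentiable (at (x + a *\<^sub>R ?e i + b *\<^sub>R ?e j))"
    if "smooth_on (ball x r) h" "0 \<le> a" "a \<le> s" "0 \<le> b" "b \<le> s" for a b and h :: "real ^ 'n \<Rightarrow> real"
    using smooth_on_differentiable[OF that(1) inb] that by blast
  define \<phi> where "\<phi> t = f (x + t *\<^sub>R ?e i + s *\<^sub>R ?e j) - f (x + t *\<^sub>R ?e i)" for t
  have "(\<phi> has_real_derivative (partial_deriv i f (x + t *\<^sub>R ?e i + s *\<^sub>R ?e j)
      - partial_deriv i f (x + t *\<^sub>R ?e i))) (at t)"
    if "0 \<le> t" "t \<le> s" for t
    unfolding \<phi>_def
    using partial_deriv_along_axis[of f "x + s *\<^sub>R ?e j" t i] partial_deriv_along_axis[of f x t i]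
      df[OF f, of t s] df[OF f, of t 0] that s
    by (intro DERIV_diff) (auto simp: algebra_simps)
  from MVT2[OF s(1) this] obtain t where t: "0 < t" "t < s"
    "\<phi> s - \<phi> 0 = s * (partial_deriv i f (x + t *\<^sub>R ?e i + s *\<^sub>R ?e j) - partial_deriv i f (x + t *\<^sub>R ?e i))"
    by auto
  have "((\<lambda>u. partial_deriv i f (x + t *\<^sub>R ?e i + u *\<^sub>R ?e j)) has_real_derivative
      partial_deriv j (partial_deriv i f) (x + t *\<^sub>R ?e i + u *\<^sub>R ?e j)) (at u)"
    if "0 \<le> u" "u \<le> s" for u
    using df[OF smooth_on_partial_deriv[OF f, of i], of t u] that t
    by (intro partial_deriv_along_axis) auto
  from MVT2[OF s(1) this] obtain u where u: "0 < u" "u < s"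
    "partial_deriv i f (x + t *\<^sub>R ?e i + s *\<^sub>R ?e j) - partial_deriv i f (x + t *\<^sub>R ?e i)
      = s * partial_deriv j (partial_deriv i f) (x + t *\<^sub>R ?e i + u *\<^sub>R ?e j)"
    by auto
  show thesis
  proof (rule that)
    show "dist x (x + t *\<^sub>R ?e i + u *\<^sub>R ?e j) \<le> 2 * s" using t u by (intro d) auto
    show "f (x + s *\<^sub>R ?e i + s *\<^sub>R ?e j) - f (x + s *\<^sub>R ?e i) - f (x + s *\<^sub>R ?e j) + f x
        = s\<^sup>2 * partial_deriv j (partial_deriv i f) (x + t *\<^sub>R ?e i + u *\<^sub>R ?e j)"
      using t(3) unfolding u(3) \<phi>_def by (simp add: power2_eq_square algebra_simps)
  qed
qed

text \<open>Schwarz's theorem. The second difference is symmetric in \<open>i\<close> and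
  \<open>j\<close>, so the two mixed derivatives take a common value at points arbitrarily close to
  \<open>x\<close>; continuity does the rest.\<close>

lemma partial_deriv_commute:
  fixes f :: "real ^ 'n::finite \<Rightarrow> real"
  assumes "open U" "smooth_on U f" "x \<in> U"
  shows "partial_deriv i (partial_deriv j f) x = partial_deriv j (partial_deriv i f) x"
proof -
  let ?G = "partial_deriv i (partial_deriv j f)" and ?H = "partial_deriv j (partial_deriv i f)"
  have "\<bar>?G x - ?H x\<bar> \<le> \<epsilon>" if "\<epsilon> > 0" for \<epsilon>
  proof -
    obtain r where r: "r > 0" "ball x r \<subseteq> U"
      using assms openE by blast
    have "isCont ?G x" "isCont ?H x"
      using assms by (auto intro!: differentiable_imp_continuous_within smooth_on_differentiable[of U]
        smooth_on_partial_deriv)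
    then obtain d1 d2 where d: "d1 > 0" "\<And>y. dist y x < d1 \<Longrightarrow> dist (?G y) (?G x) < \<epsilon> / 2"
        "d2 > 0" "\<And>y. dist y x < d2 \<Longrightarrow> dist (?H y) (?H x) < \<epsilon> / 2"
      unfolding continuous_at_eps_delta using \<open>\<epsilon> > 0\<close> by (metis half_gt_zero)
    \<comment> \<open>A third, so that \<open>2 * s\<close>, the distance allowed by the mean value
      lemma, stays strictly below all three radii.\<close>
    define s where "s = min r (min d1 d2) / 3"
    have s: "0 < s" "2 * s < r" "2 * s < d1" "2 * s < d2"
      using r d by (auto simp: s_def)
    have fb: "smooth_on (ball x r) f"
      using assms(2) r(2) by (rule smooth_on_subset)
    obtain y where y: "dist x y \<le> 2 * s" "f (x + s *\<^sub>R axis i 1 + s *\<^sub>R axis j 1) -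
        f (x + s *\<^sub>R axis i 1) - f (x + s *\<^sub>R axis j 1) + f x = s\<^sup>2 * ?H y"
      using second_difference_mean_value[OF fb s(1,2)] .
    obtain z where z: "dist x z \<le> 2 * s" "f (x + s *\<^sub>R axis j 1 + s *\<^sub>R axis i 1) -
        f (x + s *\<^sub>R axis j 1) - f (x + s *\<^sub>R axis i 1) + f x = s\<^sup>2 * ?G z"
      using second_difference_mean_value[OF fb s(1,2)] .
    have "s\<^sup>2 * ?H y = s\<^sup>2 * ?G z"
      using y(2) z(2) by (simp add: algebra_simps)
    then have "?H y = ?G z" using s by simp
    then show ?thesis
      using d(2)[of z] d(4)[of y] y(1) z(1) s unfolding dist_commute[of _ x] dist_real_def by argo
  qed
  then have "\<bar>?G x - ?H x\<bar> \<le> 0" by (meson field_le_epsilon add_0 le_less_trans not_le dense)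
  then show ?thesis by simp
qed

lemma partial_deriv_local_min:
  fixes f :: "real ^ 'n::finite \<Rightarrow> real"
  assumes "open U" "smooth_on U f" "x \<in> U" "\<And>y. y \<in> U \<Longrightarrow> f x \<le> f y"
  shows "partial_deriv i f x = 0"
proof -
  have "(f has_derivative frechet_derivative f (at x)) (at x)"
    using smooth_on_differentiable[OF assms(2,3)] frechet_derivative_works by blast
  then have "frechet_derivative f (at x) = (\<lambda>v. 0)"
    using differential_zero_maxmin[OF assms(3,1)] assms(4) by blast
  then show ?thesis by (simp add: partial_deriv_def)
qed

text \<open>If the form were negative at \<open>v\<close>, the derivative \<phi>' along the line in
  direction \<open>v\<close>, which vanishes at 0, would be negative just to the right of 0, and
  \<open>f\<close> would drop below its minimum.\<close>

lemma second_derivative_local_min: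
  fixes f :: "real ^ 'n::finite \<Rightarrow> real"
  assumes "open U" "smooth_on U f" "x \<in> U" "\<And>y. y \<in> U \<Longrightarrow> f x \<le> f y"
  shows "(\<Sum>i\<in>UNIV. \<Sum>j\<in>UNIV. partial_deriv j (partial_deriv i f) x * v i * v j) \<ge> 0"
proof (rule ccontr)
  define w where "w = (\<chi> i. v i)"
  define \<phi>' where "\<phi>' t = (\<Sum>i\<in>UNIV. w $ i * partial_deriv i f (x + t *\<^sub>R w))" for t
  assume "\<not> ?thesis"
  then have neg: "(\<Sum>i\<in>UNIV. w $ i * (\<Sum>j\<in>UNIV. w $ j * partial_deriv j (partial_deriv i f) x)) < 0"
    by (simp add: w_def sum_distrib_left mult_ac)
  have "((\<lambda>t. partial_deriv i f (x + t *\<^sub>R w)) has_real_derivative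
      (\<Sum>j\<in>UNIV. w $ j * partial_deriv j (partial_deriv i f) x)) (at 0)" for i
    using has_real_derivative_along_line[of "partial_deriv i f" x 0 w]
      smooth_on_differentiable[OF smooth_on_partial_deriv[OF assms(2)] assms(3)] by simp
  then have "(\<phi>' has_real_derivative
      (\<Sum>i\<in>UNIV. w $ i * (\<Sum>j\<in>UNIV. w $ j * partial_deriv j (partial_deriv i f) x))) (at 0)"
    unfolding \<phi>'_def by (intro DERIV_sum DERIV_cmult) auto
  from DERIV_neg_dec_right[OF this neg] obtain d where d: "d > 0"
    "\<And>h. 0 < h \<Longrightarrow> h < d \<Longrightarrow> \<phi>' h < \<phi>' 0" by auto
  have \<phi>0: "\<phi>' 0 = 0"
    using partial_deriv_local_min[OF assms] by (simp add: \<phi>'_def)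
  have "open {t. x + t *\<^sub>R w \<in> U}"
    using open_vimage[OF assms(1), of "\<lambda>t. x + t *\<^sub>R w"]
    by (simp add: vimage_def continuous_intros)
  then obtain r where r: "r > 0" "ball 0 r \<subseteq> {t. x + t *\<^sub>R w \<in> U}"
    using assms(3) openE[of _ 0] by (metis (mono_tags, lifting) add.right_neutral mem_Collect_eq scaleR_zero_left)
  define h where "h = min r d / 2"
  have h: "0 < h" "h < r" "h < d" using r d by (auto simp: h_def)
  have inU: "x + t *\<^sub>R w \<in> U" if "0 \<le> t" "t \<le> h" for t
    using r h that by (auto simp: subset_iff)
  have "((\<lambda>t. f (x + t *\<^sub>R w)) has_real_derivative \<phi>' t) (at t)" if "0 \<le> t" "t \<le> h" for t
    unfolding \<phi>'_def using inU[OF that] smooth_on_differentiable[OF assms(2)]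
    by (intro has_real_derivative_along_line) auto
  from MVT2[OF h(1) this] obtain t where t: "0 < t" "t < h" "f (x + h *\<^sub>R w) - f x = h * \<phi>' t"
    by auto
  have "h * \<phi>' t < 0" using d(2)[of t] t h \<phi>0 by (simp add: mult_pos_neg)
  then show False using t(3) assms(4)[OF inU[of h]] h by simp
qed

section \<open>Trace inequalities and the Bernstein argument\<close>

abbreviation quad_form :: "('n::finite \<Rightarrow> 'n \<Rightarrow> real) \<Rightarrow> ('n \<Rightarrow> real) \<Rightarrow> real" where
  "quad_form a v \<equiv> \<Sum>i\<in>UNIV. \<Sum>j\<in>UNIV. a i j * v i * v j"

abbreviation second_order ::
  "('n::finite \<Rightarrow> 'n \<Rightarrow> real ^ 'n \<Rightarrow> real) \<Rightarrow> (real ^ 'n \<Rightarrow> real) \<Rightarrow> real ^ 'n \<Rightarrow> real" where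
  "second_order a u y \<equiv> \<Sum>k\<in>UNIV. \<Sum>l\<in>UNIV. a k l y * partial_deriv l (partial_deriv k u) y"

abbreviation first_order ::
  "('n::finite \<Rightarrow> real ^ 'n \<Rightarrow> real) \<Rightarrow> (real ^ 'n \<Rightarrow> real) \<Rightarrow> real ^ 'n \<Rightarrow> real" where
  "first_order b u y \<equiv> \<Sum>l\<in>UNIV. b l y * partial_deriv l u y"

text \<open>The form at \<open>v + t e_k\<close>, expanded as a polynomial in \<open>t\<close>. Its
  nonnegativity for all \<open>t\<close> gives everything needed about semidefinite matrices without
  eigenvalues.\<close>

lemma quadratic_form_perturb:
  fixes A :: "'n::finite \<Rightarrow> 'n \<Rightarrow> real"
  assumes "\<And>i j. A i j = A j i"
  shows "(\<Sum>i\<in>UNIV. \<Sum>j\<in>UNIV. A i j * (v i + (if i = k then t else 0)) * (v j + (if j = k then t else 0)))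
    = quad_form A v + 2 * t * (\<Sum>j\<in>UNIV. A k j * v j) + t\<^sup>2 * A k k"
proof -
  have "(\<Sum>i\<in>UNIV. \<Sum>j\<in>UNIV. A i j * (v i + (if i = k then t else 0)) * (v j + (if j = k then t else 0)))
    = quad_form A v + (\<Sum>i\<in>UNIV. \<Sum>j\<in>UNIV. if i = k then t * A i j * v j else 0)
      + (\<Sum>i\<in>UNIV. \<Sum>j\<in>UNIV. if j = k then t * A i j * v i else 0)
      + (\<Sum>i\<in>UNIV. \<Sum>j\<in>UNIV. if j = k then if i = k then t\<^sup>2 * A i j else 0 else 0)"
    unfolding sum.distrib[symmetric]
    by (intro sum.cong refl) (simp add: algebra_simps power2_eq_square)
  also have "(\<Sum>i\<in>UNIV. \<Sum>j\<in>UNIV. if i = k then t * A i j * v j else 0) = t * (\<Sum>j\<in>UNIV. A k j * v j)"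
    by (subst sum.swap) (simp add: sum.delta sum_distrib_left mult_ac)
  also have "(\<Sum>i\<in>UNIV. \<Sum>j\<in>UNIV. if j = k then t * A i j * v i else 0) = t * (\<Sum>j\<in>UNIV. A k j * v j)"
    using assms[of k] by (simp add: sum.delta sum_distrib_left mult_ac)
  also have "(\<Sum>i\<in>UNIV. \<Sum>j\<in>UNIV. if j = k then if i = k then t\<^sup>2 * A i j else 0 else 0) = t\<^sup>2 * A k k"
    by (simp add: sum.delta)
  finally show ?thesis by simp
qed

text \<open>Induction on the number of nonzero diagonal entries of \<open>A\<close>. Subtracting the
  rank-one matrix of row \<open>k\<close> divided by the pivot \<open>A k k\<close> leaves a
  semidefinite Schur complement with fewer such entries, and the rank-one part contributes the value
  of the form of \<open>H\<close> at that row. It serves as the second-order maximum principle: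
  \<open>A\<close> is the inverse metric, \<open>H\<close> the Hessian at a minimum.\<close>

lemma trace_product_psd_nonneg:
  fixes A H :: "'n::finite \<Rightarrow> 'n \<Rightarrow> real"
  assumes "\<And>i j. A i j = A j i"
    and "\<And>v. quad_form A v \<ge> 0"
    and H: "\<And>v. quad_form H v \<ge> 0"
  shows "(\<Sum>i\<in>UNIV. \<Sum>j\<in>UNIV. A i j * H i j) \<ge> 0"
  using assms(1,2)
proof (induction "card {i. A i i \<noteq> 0}" arbitrary: A rule: less_induct)
  case less
  note sym = less.prems(1) and psd = less.prems(2)
  let ?Q = "\<lambda>v. \<Sum>i\<in>UNIV. \<Sum>j\<in>UNIV. A i j * v i * v j"
  have Qe: "0 \<le> ?Q v + 2 * t * (\<Sum>j\<in>UNIV. A k j * v j) + t\<^sup>2 * A k k" for v k t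
    using psd[of "\<lambda>i. v i + (if i = k then t else 0)"] quadratic_form_perturb[of A, OF sym] by simp
  have diag: "A i i \<ge> 0" for i
    using Qe[of "\<lambda>_. 0" 1 i] by simp
  have row0: "A k j = 0" if "A k k = 0" for k j
  proof (rule ccontr)
    assume nz: "A k j \<noteq> 0"
    have 1: "(\<Sum>i\<in>UNIV. A k i * (if i = j then 1 else 0)) = A k j"
      by (simp add: if_distrib[of "(*) _"] sum.delta cong: if_cong)
    define c where "c = ?Q (\<lambda>i. if i = j then 1 else 0)"
    have "0 \<le> c + 2 * t * A k j" for t
      using Qe[of "\<lambda>i. if i = j then 1 else 0" t k] that 1 by (simp add: c_def)
    \<comment> \<open>With \<open>A k k = 0\<close> the expression is affine in \<open>t\<close>;
      this choice gives it the value \<open>- 1\<close>.\<close>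
    from this[of "- (c + 1) / (2 * A k j)"] nz show False by (simp add: field_simps)
  qed
  show ?case
  proof (cases "\<exists>k. A k k \<noteq> 0")
    case False
    then show ?thesis using row0 by simp
  next
    case True
    then obtain k where "A k k \<noteq> 0" by blast
    with diag[of k] have k: "A k k > 0" by simp
    define B where "B i j = A i j - A k i * A k j / A k k" for i j
    have "B i i = 0" if "A i i = 0" for i
      using row0[OF that, of k] that sym[of i k] by (simp add: B_def)
    moreover have "B k k = 0" using k by (simp add: B_def)
    ultimately have "{i. B i i \<noteq> 0} \<subset> {i. A i i \<noteq> 0}"
      using \<open>A k k \<noteq> 0\<close> by blast
    then have lt: "card {i. B i i \<noteq> 0} < card {i. A i i \<noteq> 0}"
      by (simp add: psubset_card_mono)
    have split: "(\<Sum>i\<in>UNIV. \<Sum>j\<in>UNIV. A i j * X i j) =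
        (\<Sum>i\<in>UNIV. \<Sum>j\<in>UNIV. B i j * X i j) + (\<Sum>i\<in>UNIV. \<Sum>j\<in>UNIV. X i j * A k i * A k j) / A k k" for X
      unfolding B_def sum_divide_distrib sum.distrib[symmetric]
      by (intro sum.cong refl) (simp add: algebra_simps)
    have "0 \<le> quad_form B v" for v
    proof -
      let ?s = "\<Sum>j\<in>UNIV. A k j * v j"
      \<comment> \<open>The value \<open>t = - ?s / A k k\<close> minimises the form of
        \<open>A\<close> along \<open>v + t e_k\<close>; the minimum is the form of the Schur
        complement \<open>B\<close> at \<open>v\<close>.\<close>
      have e: "2 * (- ?s / A k k) * ?s + (- ?s / A k k)\<^sup>2 * A k k = - (?s\<^sup>2 / A k k)"
        using k by (simp add: field_simps power2_eq_square)
      have "(\<Sum>i\<in>UNIV. \<Sum>j\<in>UNIV. v i * v j * A k i * A k j) = ?s\<^sup>2"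
        by (simp add: power2_eq_square sum_product mult_ac)
      with split[of "\<lambda>i j. v i * v j"] have "?Q v = quad_form B v + ?s\<^sup>2 / A k k"
        by (simp add: mult_ac)
      with Qe[of v "- ?s / A k k" k] e show ?thesis by linarith
    qed
    then have "0 \<le> (\<Sum>i\<in>UNIV. \<Sum>j\<in>UNIV. B i j * H i j)"
    proof (intro less.hyps[of B] lt)
      show "B i j = B j i" for i j by (simp add: B_def sym[of i j] mult.commute)
    qed
    then show ?thesis
      using H[of "A k"] k split[of H] by simp
  qed
qed

lemma sum_swap_pairs:
  "(\<Sum>k\<in>K. \<Sum>l\<in>L. \<Sum>i\<in>I. \<Sum>j\<in>J. g k l i j) = (\<Sum>i\<in>I. \<Sum>j\<in>J. \<Sum>k\<in>K. \<Sum>l\<in>L. g k l i j)"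
proof -
  have "(\<Sum>k\<in>K. \<Sum>l\<in>L. \<Sum>i\<in>I. \<Sum>j\<in>J. g k l i j) = (\<Sum>k\<in>K. \<Sum>i\<in>I. \<Sum>j\<in>J. \<Sum>l\<in>L. g k l i j)"
    by (intro sum.cong refl) (subst sum.swap, intro sum.cong refl, rule sum.swap)
  also have "\<dots> = (\<Sum>i\<in>I. \<Sum>j\<in>J. \<Sum>k\<in>K. \<Sum>l\<in>L. g k l i j)"
    by (subst sum.swap, intro sum.cong refl) (rule sum.swap)
  finally show ?thesis .
qed

text \<open>The coordinate counterpart of the Hessian term in Bochner's formula. Ellipticity is used
  once for each factor \<open>a\<close>: first it makes \<open>B\<close>, that is
  \<open>H^T a H - \<alpha> H^T H\<close>, semidefinite, so that its trace against \<open>a\<close>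
  is nonnegative; then it is applied to each row of \<open>H\<close>.\<close>

lemma trace_quadratic_lower_bound:
  fixes a H :: "'n::finite \<Rightarrow> 'n \<Rightarrow> real"
  assumes sym: "\<And>i j. a i j = a j i" and "\<alpha> \<ge> 0"
    and ell: "\<And>v. \<alpha> * (\<Sum>i\<in>UNIV. (v i)\<^sup>2) \<le> quad_form a v"
  shows "\<alpha>\<^sup>2 * (\<Sum>i\<in>UNIV. \<Sum>k\<in>UNIV. (H i k)\<^sup>2)
    \<le> (\<Sum>k\<in>UNIV. \<Sum>l\<in>UNIV. a k l * (\<Sum>i\<in>UNIV. \<Sum>j\<in>UNIV. a i j * H i k * H j l))"
proof -
  define B where "B k l = (\<Sum>i\<in>UNIV. \<Sum>j\<in>UNIV. a i j * H i k * H j l) - \<alpha> * (\<Sum>i\<in>UNIV. H i k * H i l)" for k l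
  have psd: "0 \<le> quad_form a v" for v
    using ell[of v] \<open>\<alpha> \<ge> 0\<close> by (meson mult_nonneg_nonneg order_trans sum_nonneg zero_le_power2)
  have "0 \<le> (\<Sum>k\<in>UNIV. \<Sum>l\<in>UNIV. B k l * v k * v l)" for v
  proof -
    define w where "w i = (\<Sum>k\<in>UNIV. H i k * v k)" for i
    have 1: "(\<Sum>k\<in>UNIV. \<Sum>l\<in>UNIV. H i k * H j l * v k * v l) = w i * w j" for i j
      by (simp add: w_def sum_product mult_ac)
    have "(\<Sum>k\<in>UNIV. \<Sum>l\<in>UNIV. (\<Sum>i\<in>UNIV. \<Sum>j\<in>UNIV. a i j * H i k * H j l) * v k * v l)
        = (\<Sum>k\<in>UNIV. \<Sum>l\<in>UNIV. \<Sum>i\<in>UNIV. \<Sum>j\<in>UNIV. a i j * (H i k * H j l * v k * v l))"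
      by (simp add: sum_distrib_right sum_distrib_left mult_ac)
    also have "\<dots> = (\<Sum>i\<in>UNIV. \<Sum>j\<in>UNIV. \<Sum>k\<in>UNIV. \<Sum>l\<in>UNIV. a i j * (H i k * H j l * v k * v l))"
      by (rule sum_swap_pairs)
    also have "\<dots> = quad_form a w"
      by (simp only: mult.assoc 1[symmetric] sum_distrib_left)
    finally have e1: "(\<Sum>k\<in>UNIV. \<Sum>l\<in>UNIV. (\<Sum>i\<in>UNIV. \<Sum>j\<in>UNIV. a i j * H i k * H j l) * v k * v l)
        = quad_form a w" .
    have "(\<Sum>k\<in>UNIV. \<Sum>l\<in>UNIV. (\<alpha> * (\<Sum>i\<in>UNIV. H i k * H i l)) * v k * v l)
        = (\<Sum>k\<in>UNIV. \<Sum>l\<in>UNIV. \<Sum>i\<in>UNIV. \<alpha> * (H i k * H i l * v k * v l))"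
      by (simp add: sum_distrib_right sum_distrib_left mult_ac)
    also have "\<dots> = (\<Sum>i\<in>UNIV. \<Sum>k\<in>UNIV. \<Sum>l\<in>UNIV. \<alpha> * (H i k * H i l * v k * v l))"
      by (subst (2) sum.swap, subst sum.swap, rule refl)
    also have "\<dots> = \<alpha> * (\<Sum>i\<in>UNIV. (w i)\<^sup>2)"
      by (simp add: sum_distrib_left[symmetric] 1 power2_eq_square)
    finally have e2: "(\<Sum>k\<in>UNIV. \<Sum>l\<in>UNIV. (\<alpha> * (\<Sum>i\<in>UNIV. H i k * H i l)) * v k * v l)
        = \<alpha> * (\<Sum>i\<in>UNIV. (w i)\<^sup>2)" .
    show ?thesis
      using ell[of w] e1 e2 by (simp add: B_def left_diff_distrib sum_subtractf)
  qed
  from trace_product_psd_nonneg[OF sym psd this]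
  have 1: "\<alpha> * (\<Sum>k\<in>UNIV. \<Sum>l\<in>UNIV. a k l * (\<Sum>i\<in>UNIV. H i k * H i l))
      \<le> (\<Sum>k\<in>UNIV. \<Sum>l\<in>UNIV. a k l * (\<Sum>i\<in>UNIV. \<Sum>j\<in>UNIV. a i j * H i k * H j l))"
    by (simp add: B_def right_diff_distrib sum_subtractf sum_distrib_left mult_ac)
  have 2: "(\<Sum>k\<in>UNIV. \<Sum>l\<in>UNIV. a k l * (\<Sum>i\<in>UNIV. H i k * H i l))
      = (\<Sum>i\<in>UNIV. \<Sum>k\<in>UNIV. \<Sum>l\<in>UNIV. a k l * H i k * H i l)"
    unfolding sum_distrib_left by (subst (2) sum.swap, subst sum.swap) (simp add: mult_ac)
  have 3: "\<alpha> * (\<Sum>i\<in>UNIV. \<Sum>k\<in>UNIV. (H i k)\<^sup>2) \<le> (\<Sum>i\<in>UNIV. \<Sum>k\<in>UNIV. \<Sum>l\<in>UNIV. a k l * H i k * H i l)"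
    unfolding sum_distrib_left by (intro sum_mono order_trans[OF _ ell]) (simp add: sum_distrib_left)
  have "\<alpha>\<^sup>2 * s \<le> r" if "\<alpha> * t \<le> r" "t = t'" "\<alpha> * s \<le> t'" for s t t' r
    using mult_left_mono[OF that(3) \<open>\<alpha> \<ge> 0\<close>] that by (simp add: power2_eq_square mult.assoc)
  from this[OF 1 2 3] show ?thesis .
qed

text \<open>Here \<open>P\<close> and \<open>Q\<close> are the sizes of the gradient and of the
  Hessian of \<open>ln u\<close>. The first hypothesis gives
  \<open>Q\<^sup>2 \<le> s * P\<^sup>2\<close> with \<open>s\<close> linear in \<open>1 + M\<close>;
  inserted into the second, \<open>Q\<close> is absorbed and \<open>s\<close> enters only linearly.
  The bound is therefore linear in \<open>1 + M\<close>, which makes the gradient of order \<mu>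
  when \<open>M = \<mu>\<^sup>2\<close>.\<close>

lemma bernstein_quadratic_inequalities:
  fixes \<alpha> K M P Q :: real
  assumes pos: "\<alpha> > 0" "K > 0" "M \<ge> 0" "P \<ge> 0" "Q \<ge> 0"
    and Q: "\<alpha>\<^sup>2 * Q\<^sup>2 \<le> K * P * (P + Q) + K * M * P\<^sup>2"
    and P: "\<alpha> * P\<^sup>2 \<le> M + K * (P + Q)"
  shows "P\<^sup>2 \<le> 2 / \<alpha> * (1 + K\<^sup>2 / \<alpha> + K\<^sup>2 / \<alpha> * (2 / \<alpha>\<^sup>2 * (K + K\<^sup>2 / (2 * \<alpha>\<^sup>2)))) * (1 + M)"
proof -
  define c where "c = 2 / \<alpha>\<^sup>2 * (K + K\<^sup>2 / (2 * \<alpha>\<^sup>2))"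
  define s where "s = c * (1 + M)"
  have c: "c > 0" using pos by (simp add: c_def add_pos_pos)
  then have s: "s > 0" using pos by (simp add: s_def)
  have young: "K * x * y \<le> \<epsilon> * x\<^sup>2 + K\<^sup>2 * y\<^sup>2 / (4 * \<epsilon>)" if "\<epsilon> > 0" for x y \<epsilon> :: real
  proof -
    have "0 \<le> (2 * \<epsilon> * x - K * y)\<^sup>2 / (4 * \<epsilon>)" using that by simp
    then show ?thesis using that by (simp add: field_simps power2_eq_square)
  qed
  have "K * Q * P \<le> \<alpha>\<^sup>2 / 2 * Q\<^sup>2 + K\<^sup>2 * P\<^sup>2 / (4 * (\<alpha>\<^sup>2 / 2))"
    using pos by (intro young) auto
  with Q have "\<alpha>\<^sup>2 / 2 * Q\<^sup>2 \<le> (K + K\<^sup>2 / (2 * \<alpha>\<^sup>2)) * P\<^sup>2 + K * M * P\<^sup>2"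
    by (simp add: algebra_simps power2_eq_square)
  also have "\<dots> \<le> (K + K\<^sup>2 / (2 * \<alpha>\<^sup>2)) * (1 + M) * P\<^sup>2"
  proof -
    have "0 \<le> K\<^sup>2 / (2 * \<alpha>\<^sup>2) * M * P\<^sup>2" using pos by simp
    moreover have "(K + K\<^sup>2 / (2 * \<alpha>\<^sup>2)) * (1 + M) * P\<^sup>2
        = (K + K\<^sup>2 / (2 * \<alpha>\<^sup>2)) * P\<^sup>2 + K * M * P\<^sup>2 + K\<^sup>2 / (2 * \<alpha>\<^sup>2) * M * P\<^sup>2"
      by (simp only: distrib_left distrib_right mult_1_right mult_1_left)
    ultimately show ?thesis by linarith
  qed
  also have "\<dots> = \<alpha>\<^sup>2 / 2 * (s * P\<^sup>2)" using pos by (simp add: s_def c_def)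
  finally have QP: "Q\<^sup>2 \<le> s * P\<^sup>2"
    using pos by (simp add: mult_le_cancel_left_pos)
  \<comment> \<open>The weight in Young's inequality turns \<open>s * P\<^sup>2\<close> into
    \<open>\<alpha> / 4 * P\<^sup>2\<close>. The term \<open>K * P\<close> costs another quarter, so
    half of \<open>\<alpha> * P\<^sup>2\<close> remains.\<close>
  have "K * Q * 1 \<le> \<alpha> / (4 * s) * Q\<^sup>2 + K\<^sup>2 * 1\<^sup>2 / (4 * (\<alpha> / (4 * s)))"
    using pos s by (intro young) auto
  also have "\<alpha> / (4 * s) * Q\<^sup>2 \<le> \<alpha> / (4 * s) * (s * P\<^sup>2)"
    using QP pos s by (intro mult_left_mono) auto
  finally have 1: "K * Q \<le> \<alpha> / 4 * P\<^sup>2 + K\<^sup>2 / \<alpha> * s"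
    using s pos by (simp add: field_simps)
  have "K * P * 1 \<le> \<alpha> / 4 * P\<^sup>2 + K\<^sup>2 * 1\<^sup>2 / (4 * (\<alpha> / 4))"
    using pos by (intro young) auto
  then have 2: "K * P \<le> \<alpha> / 4 * P\<^sup>2 + K\<^sup>2 / \<alpha>" by simp
  from P 1 2 have "\<alpha> / 2 * P\<^sup>2 \<le> M + K\<^sup>2 / \<alpha> + K\<^sup>2 / \<alpha> * s"
    by (simp add: algebra_simps)
  also have "\<dots> \<le> (1 + K\<^sup>2 / \<alpha> + K\<^sup>2 / \<alpha> * c) * (1 + M)"
  proof -
    have "0 \<le> K\<^sup>2 / \<alpha> * M" using pos by simp
    moreover have "(1 + a + a * c) * (1 + M) = M + a + a * (c * (1 + M)) + 1 + a * M" for a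
      by algebra
    note this[of "K\<^sup>2 / \<alpha>", folded s_def]
    ultimately show ?thesis by linarith
  qed
  finally have "\<alpha> / 2 * P\<^sup>2 \<le> (1 + K\<^sup>2 / \<alpha> + K\<^sup>2 / \<alpha> * c) * (1 + M)" .
  then have "2 / \<alpha> * (\<alpha> / 2 * P\<^sup>2) \<le> 2 / \<alpha> * ((1 + K\<^sup>2 / \<alpha> + K\<^sup>2 / \<alpha> * c) * (1 + M))"
    using pos by (intro mult_left_mono) auto
  moreover have "2 / \<alpha> * (\<alpha> / 2 * P\<^sup>2) = P\<^sup>2" using pos by simp
  ultimately show ?thesis
    by (simp only: c_def mult.assoc)
qed

section \<open>The Bernstein estimate at a maximum point\<close>

lemma abs_sum_le_card:
  fixes f :: "'n::finite \<Rightarrow> real"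
  assumes "\<And>i. \<bar>f i\<bar> \<le> B"
  shows "\<bar>\<Sum>i\<in>UNIV. f i\<bar> \<le> of_nat CARD('n) * B"
  using sum_norm_bound[of UNIV f B] assms by simp

lemma abs_double_sum_le_card:
  fixes f :: "'n::finite \<Rightarrow> 'n \<Rightarrow> real"
  assumes "\<And>i j. \<bar>f i j\<bar> \<le> B"
  shows "\<bar>\<Sum>i\<in>UNIV. \<Sum>j\<in>UNIV. f i j\<bar> \<le> (of_nat CARD('n))\<^sup>2 * B"
proof -
  have "\<bar>\<Sum>j\<in>UNIV. f i j\<bar> \<le> of_nat CARD('n) * B" for i
    using assms by (rule abs_sum_le_card)
  then have "\<bar>\<Sum>i\<in>UNIV. \<Sum>j\<in>UNIV. f i j\<bar> \<le> of_nat CARD('n) * (of_nat CARD('n) * B)"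
    by (rule abs_sum_le_card)
  then show ?thesis by (simp add: power2_eq_square mult.assoc)
qed

lemma abs_mult_le: "\<bar>x\<bar> \<le> a \<Longrightarrow> \<bar>y\<bar> \<le> b \<Longrightarrow> \<bar>x * y\<bar> \<le> a * (b::real)"
  by (simp add: abs_mult mult_mono)

text \<open>\<open>K\<close> dominates all sums of coefficients that occur in
  \<open>bernstein_pointwise\<close> in dimension \<open>n\<close>, and the second line is the
  factor produced by \<open>bernstein_quadratic_inequalities\<close> for this
  \<open>K\<close>.\<close>

definition bernstein_const :: "nat \<Rightarrow> real \<Rightarrow> real \<Rightarrow> real" where
  "bernstein_const n \<alpha> N = (let K = 10 * real n ^ 4 * N\<^sup>2 in
     2 / \<alpha> * (1 + K\<^sup>2 / \<alpha> + K\<^sup>2 / \<alpha> * (2 / \<alpha>\<^sup>2 * (K + K\<^sup>2 / (2 * \<alpha>\<^sup>2)))))"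

text \<open>
  Pointwise form of the estimate for a solution \<open>f\<close> of \<open>a\<^sup>k\<^sup>l f\<^sub>k\<^sub>l + b\<^sup>l f\<^sub>l + a\<^sup>i\<^sup>j f\<^sub>i f\<^sub>j = q\<close> at a maximum point of \<open>F = a\<^sup>i\<^sup>j f\<^sub>i f\<^sub>j\<close>:
  \<open>p\<close>, \<open>H\<close>, \<open>T\<close> stand for the first, second and third derivatives of \<open>f\<close>, the suffixes \<open>1\<close> and \<open>2\<close> for derivatives of the
  coefficients (the differentiating indices come first). The assumption \<open>max\<close> is \<open>a\<^sup>k\<^sup>l F\<^sub>k\<^sub>l \<le> 0\<close>, and \<open>eq1\<close> is the differentiated equation with
  \<open>F\<^sub>i = 0\<close> and \<open>q\<^sub>i = - r f\<^sub>i\<close>.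
\<close>

lemma bernstein_pointwise:
  fixes a :: "'n::finite \<Rightarrow> 'n \<Rightarrow> real" and a1 :: "'n \<Rightarrow> 'n \<Rightarrow> 'n \<Rightarrow> real"
  assumes N: "N \<ge> 1" and \<alpha>: "\<alpha> > 0" and M: "M \<ge> 0" and r: "0 \<le> r" "r \<le> 2 * M" and q: "\<bar>q\<bar> \<le> M"
    and a: "\<And>i j. \<bar>a i j\<bar> \<le> N" and a1: "\<And>k i j. \<bar>a1 k i j\<bar> \<le> N" and a2: "\<And>l k i j. \<bar>a2 l k i j\<bar> \<le> N"
    and b: "\<And>i. \<bar>b i\<bar> \<le> N" and b1: "\<And>i l. \<bar>b1 i l\<bar> \<le> N"
    and sym: "\<And>i j. a i j = a j i"
    and ell: "\<And>v. \<alpha> * (\<Sum>i\<in>UNIV. (v i)\<^sup>2) \<le> quad_form a v"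
    and max: "(\<Sum>k\<in>UNIV. \<Sum>l\<in>UNIV. a k l * (\<Sum>i\<in>UNIV. \<Sum>j\<in>UNIV.
        a2 l k i j * p i * p j + a1 k i j * (H i l * p j + p i * H j l)
        + 2 * (a1 l i j * H i k * p j + a i j * (T i k l * p j + H i k * H j l)))) \<le> 0"
    and eq: "(\<Sum>k\<in>UNIV. \<Sum>l\<in>UNIV. a k l * H k l) =
        - (\<Sum>l\<in>UNIV. b l * p l) - quad_form a p + q"
    and eq1: "\<And>i. (\<Sum>k\<in>UNIV. \<Sum>l\<in>UNIV. a k l * T i k l) =
        - (\<Sum>k\<in>UNIV. \<Sum>l\<in>UNIV. a1 i k l * H k l) - (\<Sum>l\<in>UNIV. b1 i l * p l + b l * H l i) - r * p i"
  shows "(\<Sum>i\<in>UNIV. (p i)\<^sup>2) \<le> bernstein_const CARD('n) \<alpha> N * (1 + M)"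
proof -
  define n where "n = real CARD('n)"
  define K where "K = 10 * n ^ 4 * N\<^sup>2"
  define P where "P = sqrt (\<Sum>i\<in>UNIV. (p i)\<^sup>2)"
  define Q where "Q = sqrt (\<Sum>i\<in>UNIV. \<Sum>k\<in>UNIV. (H i k)\<^sup>2)"
  have n: "n \<ge> 1" by (simp add: n_def Suc_leI)
  have P2: "P\<^sup>2 = (\<Sum>i\<in>UNIV. (p i)\<^sup>2)" and Q2: "Q\<^sup>2 = (\<Sum>i\<in>UNIV. \<Sum>k\<in>UNIV. (H i k)\<^sup>2)"
    by (simp_all add: P_def Q_def sum_nonneg)
  have P0: "P \<ge> 0" and Q0: "Q \<ge> 0" by (simp_all add: P_def Q_def sum_nonneg)
  have p: "\<bar>p i\<bar> \<le> P" for i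
    unfolding P_def by (intro real_le_rsqrt) (auto intro: member_le_sum)
  have H: "\<bar>H i k\<bar> \<le> Q" for i k
  proof -
    have "(H i k)\<^sup>2 \<le> (\<Sum>k\<in>UNIV. (H i k)\<^sup>2)" by (rule member_le_sum) auto
    also have "\<dots> \<le> (\<Sum>i\<in>UNIV. \<Sum>k\<in>UNIV. (H i k)\<^sup>2)"
      by (rule member_le_sum) (auto intro: sum_nonneg)
    finally show ?thesis unfolding Q_def by (intro real_le_rsqrt) auto
  qed
  define F where "F = quad_form a p"
  define Z where "Z = (\<Sum>k\<in>UNIV. \<Sum>l\<in>UNIV. a k l * (\<Sum>i\<in>UNIV. \<Sum>j\<in>UNIV. a i j * H i k * H j l))"
  define A2 where "A2 = (\<Sum>k\<in>UNIV. \<Sum>l\<in>UNIV. \<Sum>i\<in>UNIV. \<Sum>j\<in>UNIV. a k l * (a2 l k i j * p i * p j))"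
  define A1 where "A1 = (\<Sum>k\<in>UNIV. \<Sum>l\<in>UNIV. \<Sum>i\<in>UNIV. \<Sum>j\<in>UNIV.
    a k l * (a1 k i j * (H i l * p j + p i * H j l) + 2 * (a1 l i j * H i k * p j)))"
  define E where "E i = (\<Sum>k\<in>UNIV. \<Sum>l\<in>UNIV. a1 i k l * H k l) + (\<Sum>l\<in>UNIV. b1 i l * p l + b l * H l i)" for i
  define W where "W = (\<Sum>i\<in>UNIV. \<Sum>j\<in>UNIV. a i j * p j * E i)"
  have Z: "\<alpha>\<^sup>2 * Q\<^sup>2 \<le> Z"
    unfolding Z_def Q2 using sym _ ell by (rule trace_quadratic_lower_bound) (use \<alpha> in simp)
  have F0: "\<alpha> * P\<^sup>2 \<le> F" using ell[of p] by (simp add: P2 F_def)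
  have "\<bar>F\<bar> \<le> n\<^sup>2 * (N * P * P)"
    unfolding F_def n_def using a p by (intro abs_double_sum_le_card abs_mult_le)
  then have Fle: "F \<le> n\<^sup>2 * (N * P * P)" by simp
  have A2: "\<bar>A2\<bar> \<le> n\<^sup>2 * (n\<^sup>2 * (N * (N * P * P)))"
    unfolding A2_def n_def using a a2 p by (intro abs_double_sum_le_card abs_mult_le)
  have A1: "\<bar>A1\<bar> \<le> n\<^sup>2 * (n\<^sup>2 * (N * (N * (Q * P + P * Q) + 2 * (N * Q * P))))"
    unfolding A1_def n_def using a a1 p H
    by (intro abs_double_sum_le_card abs_mult_le order_trans[OF abs_triangle_ineq] add_mono) auto
  have E: "\<bar>E i\<bar> \<le> n\<^sup>2 * (N * Q) + n * (N * P + N * Q)" for i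
    unfolding E_def n_def using a1 b b1 p H
    by (intro abs_double_sum_le_card abs_sum_le_card abs_mult_le order_trans[OF abs_triangle_ineq] add_mono)
  have W: "\<bar>W\<bar> \<le> n\<^sup>2 * (N * P * (n\<^sup>2 * (N * Q) + n * (N * P + N * Q)))"
    unfolding W_def by (subst (1) n_def, intro abs_double_sum_le_card abs_mult_le a p E)
  \<comment> \<open>Third derivatives occur only contracted with \<open>a\<close>, so
    \<open>eq1\<close> trades them for derivatives of order at most two: \<open>W\<close> collects
    the terms with derivatives of the coefficients or with \<open>b\<close>, and
    \<open>r * F\<close> comes from the source.\<close>
  have "(\<Sum>k\<in>UNIV. \<Sum>l\<in>UNIV. \<Sum>i\<in>UNIV. \<Sum>j\<in>UNIV. a k l * (a i j * T i k l * p j))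
      = (\<Sum>i\<in>UNIV. \<Sum>j\<in>UNIV. a i j * p j * (\<Sum>k\<in>UNIV. \<Sum>l\<in>UNIV. a k l * T i k l))"
    by (subst sum_swap_pairs) (simp add: sum_distrib_left mult_ac)
  also have "\<dots> = - W - r * F"
  proof -
    have "r * F = (\<Sum>i\<in>UNIV. \<Sum>j\<in>UNIV. a i j * p j * (r * p i))"
      unfolding F_def sum_distrib_left by (intro sum.cong refl) (simp add: mult_ac)
    moreover have "(\<Sum>k\<in>UNIV. \<Sum>l\<in>UNIV. a k l * T i k l) = - E i - r * p i" for i
      by (simp add: eq1 E_def)
    ultimately show ?thesis
      by (simp only: W_def sum_negf[symmetric] sum_subtractf[symmetric] right_diff_distrib mult_minus_right)
  qed
  finally have T: "(\<Sum>k\<in>UNIV. \<Sum>l\<in>UNIV. \<Sum>i\<in>UNIV. \<Sum>j\<in>UNIV. a k l * (a i j * T i k l * p j)) = - W - r * F" .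
  have "0 \<ge> (\<Sum>k\<in>UNIV. \<Sum>l\<in>UNIV. \<Sum>i\<in>UNIV. \<Sum>j\<in>UNIV. a k l * (a2 l k i j * p i * p j)
      + a k l * (a1 k i j * (H i l * p j + p i * H j l) + 2 * (a1 l i j * H i k * p j))
      + 2 * (a k l * (a i j * T i k l * p j)) + 2 * (a k l * (a i j * H i k * H j l)))"
    using max unfolding sum_distrib_left by (simp add: algebra_simps)
  also have "(\<Sum>k\<in>UNIV. \<Sum>l\<in>UNIV. \<Sum>i\<in>UNIV. \<Sum>j\<in>UNIV. a k l * (a2 l k i j * p i * p j)
      + a k l * (a1 k i j * (H i l * p j + p i * H j l) + 2 * (a1 l i j * H i k * p j))
      + 2 * (a k l * (a i j * T i k l * p j)) + 2 * (a k l * (a i j * H i k * H j l)))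
      = A2 + A1 + 2 * (- W - r * F) + 2 * Z"
    unfolding A2_def A1_def Z_def T[symmetric] sum_distrib_left by (simp only: sum.distrib)
  finally have "2 * Z \<le> - A2 - A1 + 2 * W + 2 * (r * F)" by simp
  moreover have "r * F \<le> 2 * M * (n\<^sup>2 * (N * P * P))"
    using r Fle M \<alpha> F0 by (intro mult_mono) (auto intro: order_trans[OF _ F0])
  ultimately have "2 * (\<alpha>\<^sup>2 * Q\<^sup>2) \<le> n\<^sup>2 * (n\<^sup>2 * (N * (N * P * P)))
      + n\<^sup>2 * (n\<^sup>2 * (N * (N * (Q * P + P * Q) + 2 * (N * Q * P))))
      + 2 * (n\<^sup>2 * (N * P * (n\<^sup>2 * (N * Q) + n * (N * P + N * Q)))) + 2 * (2 * M * (n\<^sup>2 * (N * P * P)))"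
    using Z A2 A1 W by linarith
  also have "\<dots> = n ^ 4 * N\<^sup>2 * (P\<^sup>2 + 6 * (P * Q)) + n ^ 3 * N\<^sup>2 * (2 * P\<^sup>2 + 2 * (P * Q)) + n\<^sup>2 * N * (4 * M * P\<^sup>2)"
    by algebra
  also have "\<dots> \<le> n ^ 4 * N\<^sup>2 * (P\<^sup>2 + 6 * (P * Q)) + n ^ 4 * N\<^sup>2 * (2 * P\<^sup>2 + 2 * (P * Q)) + n ^ 4 * N\<^sup>2 * (4 * M * P\<^sup>2)"
    using n N P0 Q0 M
    by (intro add_mono mult_right_mono mult_mono order_refl power_increasing)
      (auto simp: power2_eq_square)
  \<comment> \<open>The coefficients 3, 8 and 4 of the three monomials, all now multiplied by
    \<open>n ^ 4 * N\<^sup>2\<close>, are rounded up to 20; this is the factor 10 in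
    \<open>K\<close>.\<close>
  also have "\<dots> \<le> 2 * (K * P * (P + Q) + K * M * P\<^sup>2)"
  proof -
    have "0 \<le> n ^ 4 * N\<^sup>2 * (17 * P\<^sup>2 + 12 * (P * Q) + 16 * (M * P\<^sup>2))"
      using n N P0 Q0 M by (intro mult_nonneg_nonneg add_nonneg_nonneg) auto
    then show ?thesis by (simp add: K_def algebra_simps power2_eq_square)
  qed
  finally have 1: "\<alpha>\<^sup>2 * Q\<^sup>2 \<le> K * P * (P + Q) + K * M * P\<^sup>2" by simp
  have "\<bar>\<Sum>l\<in>UNIV. b l * p l\<bar> \<le> n * (N * P)"
    unfolding n_def using b p by (intro abs_sum_le_card abs_mult_le)
  moreover have "\<bar>\<Sum>k\<in>UNIV. \<Sum>l\<in>UNIV. a k l * H k l\<bar> \<le> n\<^sup>2 * (N * Q)"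
    unfolding n_def using a H by (intro abs_double_sum_le_card abs_mult_le)
  ultimately have "\<alpha> * P\<^sup>2 \<le> M + n * N * P + n\<^sup>2 * N * Q"
    using F0 eq q unfolding F_def[symmetric] by (simp add: mult.assoc)
  also have "\<dots> \<le> M + K * P + K * Q"
  proof -
    have "n * N \<le> n ^ 4 * N\<^sup>2" "n\<^sup>2 * N \<le> n ^ 4 * N\<^sup>2" "n ^ 4 * N\<^sup>2 \<le> K"
      using n N by (auto simp: K_def intro!: mult_mono power_increasing self_le_power)
    then have "n * N \<le> K" "n\<^sup>2 * N \<le> K" by auto
    then show ?thesis using P0 Q0 by (intro add_mono mult_right_mono) auto
  qed
  finally have 2: "\<alpha> * P\<^sup>2 \<le> M + K * (P + Q)" by (simp add: distrib_left)
  have "K > 0" using n N by (simp add: K_def)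
  from bernstein_quadratic_inequalities[OF \<alpha> this M P0 Q0 1 2]
  show ?thesis by (simp only: P2 bernstein_const_def Let_def K_def n_def)
qed

text \<open>The logarithm \<open>f\<close> of \<open>u\<close> satisfies the equation of
  \<open>bernstein_pointwise\<close> with source \<open>q = - M + M * k / u\<close>, and
  \<open>q\<close> has gradient \<open>- r\<close> times that of \<open>f\<close>, with
  \<open>r = M * k / u\<close>. The hypothesis \<open>k \<le> 2 * u\<close> puts \<open>r\<close>
  between 0 and \<open>2 * M\<close>, hence \<open>\<bar>q\<bar> \<le> M\<close>.\<close>

lemma gradient_estimate_at_max:
  fixes a :: "'n::finite \<Rightarrow> 'n \<Rightarrow> real ^ 'n \<Rightarrow> real" and b :: "'n \<Rightarrow> real ^ 'n \<Rightarrow> real"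
    and u :: "real ^ 'n \<Rightarrow> real"
  assumes U: "open U" and sa: "\<And>i j. smooth_on U (a i j)" and sb: "\<And>i. smooth_on U (b i)"
    and su: "smooth_on U u" and x: "x \<in> U"
    and sym: "\<And>i j y. y \<in> U \<Longrightarrow> a i j y = a j i y"
    and \<alpha>: "\<alpha> > 0" and ell: "\<And>v. \<alpha> * (\<Sum>i\<in>UNIV. (v i)\<^sup>2) \<le> quad_form (\<lambda>i j. a i j x) v"
    and N: "N \<ge> 1" and aN: "\<And>i j. \<bar>a i j x\<bar> \<le> N" and a1N: "\<And>k i j. \<bar>partial_deriv k (a i j) x\<bar> \<le> N"
    and a2N: "\<And>l k i j. \<bar>partial_deriv l (partial_deriv k (a i j)) x\<bar> \<le> N"
    and bN: "\<And>i. \<bar>b i x\<bar> \<le> N" and b1N: "\<And>k i. \<bar>partial_deriv k (b i) x\<bar> \<le> N"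
    and M: "M \<ge> 0" and k0: "k > 0" and ku: "\<And>y. y \<in> U \<Longrightarrow> k \<le> 2 * u y"
    and eqn: "\<And>y. y \<in> U \<Longrightarrow> second_order a u y
       + first_order b u y = - M * (u y - k)"
    and max: "\<And>y. y \<in> U \<Longrightarrow>
       (\<Sum>i\<in>UNIV. \<Sum>j\<in>UNIV. a i j y * (partial_deriv i u y / u y) * (partial_deriv j u y / u y))
       \<le> (\<Sum>i\<in>UNIV. \<Sum>j\<in>UNIV. a i j x * (partial_deriv i u x / u x) * (partial_deriv j u x / u x))"
  shows "(\<Sum>i\<in>UNIV. (partial_deriv i u x / u x)\<^sup>2) \<le> bernstein_const CARD('n) \<alpha> N * (1 + M)"
proof -
  have u0: "u y > 0" if "y \<in> U" for y using ku[OF that] k0 by linarith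
  define f where "f = (\<lambda>y. ln (u y))"
  define p where "p i = partial_deriv i f" for i
  define H where "H i k = partial_deriv k (p i)" for i k
  define T where "T i k l = partial_deriv l (H i k)" for i k l
  define a1 where "a1 k i j = partial_deriv k (a i j)" for k i j
  define q where "q y = - M + M * k * inverse (u y)" for y
  define F where "F y = (\<Sum>i\<in>UNIV. \<Sum>j\<in>UNIV. a i j y * p i y * p j y)" for y
  define G where "G k y = (\<Sum>i\<in>UNIV. \<Sum>j\<in>UNIV. a1 k i j y * (p i y * p j y) + 2 * (a i j y * (H i k y * p j y)))" for k y
  have sf: "smooth_on U f" unfolding f_def by (rule smooth_on_ln[OF U su u0])
  have sp: "smooth_on U (p i)" for i unfolding p_def by (rule smooth_on_partial_deriv[OF sf])
  have sH: "smooth_on U (H i k)" for i k unfolding H_def by (rule smooth_on_partial_deriv[OF sp])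
  have sa1: "smooth_on U (a1 k i j)" for k i j unfolding a1_def by (rule smooth_on_partial_deriv[OF sa])
  have su1: "smooth_on U (partial_deriv i u)" for i by (rule smooth_on_partial_deriv[OF su])
  have sF: "smooth_on U F"
    unfolding F_def by (intro smooth_on_sum smooth_on_mult sa sp U)
  note sd = smooth_on_differentiable
  note dsmooth = sd[OF sa] sd[OF sb] sd[OF su] sd[OF sp] sd[OF sH] sd[OF sa1] sd[OF su1]
  note calc = partial_deriv_sum partial_deriv_mult partial_deriv_add partial_deriv_diff partial_deriv_uminus
    differentiable_mult differentiable_add differentiable_diff differentiable_sum differentiable_minus dsmooth
  have p_u: "p i y = partial_deriv i u y * inverse (u y)" if "y \<in> U" for i y
    unfolding p_def f_def using partial_deriv_ln[OF sd[OF su that] u0[OF that]] by (simp add: divide_inverse)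
  have dinv: "(\<lambda>y. inverse (u y)) differentiable (at y)" if "y \<in> U" for y
    using smooth_on_inverse[OF U su] u0 that sd by (metis less_irrefl)
  have pdinv: "partial_deriv i (\<lambda>y. inverse (u y)) y = - p i y * inverse (u y)" if "y \<in> U" for i y
    using partial_deriv_inverse[OF sd[OF su that]] u0[OF that] p_u[OF that]
    by (simp add: divide_inverse power2_eq_square)
  have H_u: "H i k y = partial_deriv k (partial_deriv i u) y * inverse (u y) - p i y * p k y" if "y \<in> U" for i k y
  proof -
    have "H i k y = partial_deriv k (\<lambda>y. partial_deriv i u y * inverse (u y)) y"
      unfolding H_def by (rule partial_deriv_cong[OF U that p_u])
    also have "\<dots> = partial_deriv i u y * (- p k y * inverse (u y)) + partial_deriv k (partial_deriv i u) y * inverse (u y)"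
      using that by (simp add: partial_deriv_mult dsmooth dinv pdinv)
    finally show ?thesis using p_u[OF that, of i] by simp
  qed
  have Hsym: "H i k y = H k i y" if "y \<in> U" for i k y
    unfolding H_def p_def by (rule partial_deriv_commute[OF U sf that])
  \<comment> \<open>Differentiating the equation puts the new index outermost, while differentiating
    \<open>F\<close> twice puts it innermost; two exchanges of derivatives reconcile the two
    forms.\<close>
  have Tsym: "partial_deriv i (H k l) x = T i k l x" for i k l
  proof -
    have "partial_deriv i (H k l) x = partial_deriv l (partial_deriv i (p k)) x"
      unfolding H_def by (rule partial_deriv_commute[OF U sp x])
    also have "\<dots> = T i k l x"
      unfolding T_def H_def[symmetric] by (rule partial_deriv_cong[OF U x Hsym])
    finally show ?thesis .
  qed
  have q: "partial_deriv i q y = - (M * k * inverse (u y)) * p i y" if "y \<in> U" for i y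
    unfolding q_def using that by (simp add: calc dinv pdinv mult_ac)
  have eqf: "(\<Sum>k\<in>UNIV. \<Sum>l\<in>UNIV. a k l y * H k l y) = - (\<Sum>l\<in>UNIV. b l y * p l y) - F y + q y"
    if "y \<in> U" for y
  proof -
    have "(\<Sum>k\<in>UNIV. \<Sum>l\<in>UNIV. a k l y * H k l y)
        = inverse (u y) * second_order a u y - F y"
      unfolding F_def sum_distrib_left sum_subtractf[symmetric]
      by (intro sum.cong refl) (simp add: H_u[OF that] algebra_simps)
    also have "second_order a u y =
        - M * (u y - k) - first_order b u y"
      using eqn[OF that] by linarith
    also have "inverse (u y) * (- M * (u y - k) - first_order b u y) =
        q y - (\<Sum>l\<in>UNIV. b l y * p l y)"
      using u0[OF that] p_u[OF that]
      by (simp add: q_def right_diff_distrib sum_distrib_left mult_ac)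
    finally show ?thesis by simp
  qed
  have DF: "partial_deriv k F y = G k y" if "y \<in> U" for k y
  proof -
    have "partial_deriv k F y = (\<Sum>i\<in>UNIV. \<Sum>j\<in>UNIV. a1 k i j y * (p i y * p j y) + a i j y * (H i k y * p j y))
        + (\<Sum>i\<in>UNIV. \<Sum>j\<in>UNIV. a i j y * (H j k y * p i y))"
      unfolding F_def sum.distrib[symmetric] using that
      by (simp add: calc a1_def[symmetric] H_def[symmetric] algebra_simps)
    also have "(\<Sum>i\<in>UNIV. \<Sum>j\<in>UNIV. a i j y * (H j k y * p i y)) = (\<Sum>i\<in>UNIV. \<Sum>j\<in>UNIV. a i j y * (H i k y * p j y))"
      by (subst sum.swap) (intro sum.cong refl, simp add: sym[OF that])
    finally show ?thesis
      unfolding G_def sum.distrib[symmetric] by (simp add: algebra_simps)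
  qed
  have DDF: "partial_deriv l (partial_deriv k F) x = (\<Sum>i\<in>UNIV. \<Sum>j\<in>UNIV.
        partial_deriv l (a1 k i j) x * p i x * p j x + a1 k i j x * (H i l x * p j x + p i x * H j l x)
        + 2 * (a1 l i j x * H i k x * p j x + a i j x * (T i k l x * p j x + H i k x * H j l x)))" for k l
  proof -
    have "partial_deriv l (partial_deriv k F) x = partial_deriv l (G k) x"
      by (rule partial_deriv_cong[OF U x DF])
    also have "\<dots> = (\<Sum>i\<in>UNIV. \<Sum>j\<in>UNIV.
        partial_deriv l (a1 k i j) x * p i x * p j x + a1 k i j x * (H i l x * p j x + p i x * H j l x)
        + 2 * (a1 l i j x * H i k x * p j x + a i j x * (T i k l x * p j x + H i k x * H j l x)))"
      unfolding G_def using x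
      by (simp add: calc a1_def[symmetric] H_def[symmetric] T_def[symmetric] algebra_simps)
    finally show ?thesis .
  qed
  have Fmax: "- F x \<le> - F y" if "y \<in> U" for y
    using max[OF that] by (simp add: F_def p_u[OF that] p_u[OF x] divide_inverse)
  \<comment> \<open>Passing to \<open>- F\<close> makes the criteria for a minimum available at the
    maximum point of \<open>F\<close>.\<close>
  have sFm: "smooth_on U (\<lambda>y. - F y)" by (rule smooth_on_uminus[OF U sF])
  have F0: "partial_deriv i F x = 0" for i
    using partial_deriv_local_min[OF U sFm x Fmax, of i] partial_deriv_uminus_on(1)[OF U sF x] by simp
  from second_derivative_local_min[OF U sFm x Fmax]
  have psdF: "0 \<le> (\<Sum>k\<in>UNIV. \<Sum>l\<in>UNIV. - partial_deriv l (partial_deriv k F) x * v k * v l)" for v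
    by (simp add: partial_deriv_uminus_on(2)[OF U sF x])
  have psda: "0 \<le> quad_form (\<lambda>i j. a i j x) v" for v
    using ell[of v] \<alpha> by (meson less_imp_le mult_nonneg_nonneg order_trans sum_nonneg zero_le_power2)
  have "0 \<le> (\<Sum>k\<in>UNIV. \<Sum>l\<in>UNIV. a k l x * - partial_deriv l (partial_deriv k F) x)"
    by (rule trace_product_psd_nonneg[OF sym[OF x] psda psdF])
  then have tr: "second_order a F x \<le> 0"
    by (simp add: sum_negf)
  have eq1: "(\<Sum>k\<in>UNIV. \<Sum>l\<in>UNIV. a k l x * T i k l x) =
        - (\<Sum>k\<in>UNIV. \<Sum>l\<in>UNIV. a1 i k l x * H k l x) - (\<Sum>l\<in>UNIV. partial_deriv i (b l) x * p l x + b l x * H l i x)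
        - (M * k * inverse (u x)) * p i x" for i
  proof -
    have "partial_deriv i (\<lambda>y. \<Sum>k\<in>UNIV. \<Sum>l\<in>UNIV. a k l y * H k l y) x =
        partial_deriv i (\<lambda>y. - (\<Sum>l\<in>UNIV. b l y * p l y) - F y + q y) x"
      by (rule partial_deriv_cong[OF U x eqf])
    moreover have "q differentiable (at x)"
      unfolding q_def using x by (simp add: calc dinv)
    ultimately show ?thesis
      using x by (simp add: calc sd[OF sF] F0 q Tsym a1_def[symmetric] H_def[symmetric] sum.distrib mult_ac)
  qed
  have r: "0 \<le> M * k * inverse (u x)" "M * k * inverse (u x) \<le> 2 * M"
    using M k0 u0[OF x] ku[OF x] mult_left_mono[OF ku[OF x] M] by (auto simp: field_simps)
  have qM: "\<bar>q x\<bar> \<le> M" using r by (simp add: q_def)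
  from bernstein_pointwise[of N \<alpha> M _ "q x" "\<lambda>i j. a i j x" "\<lambda>k i j. a1 k i j x"
      "\<lambda>l k i j. partial_deriv l (a1 k i j) x" "\<lambda>i. b i x" "\<lambda>i l. partial_deriv i (b l) x"
      "\<lambda>i. p i x" "\<lambda>i l. H i l x" "\<lambda>i k l. T i k l x", OF N \<alpha> M r qM aN _ _ bN b1N sym[OF x] ell _ eqf[OF x, unfolded F_def] eq1]
  have "(\<Sum>i\<in>UNIV. (p i x)\<^sup>2) \<le> bernstein_const CARD('n) \<alpha> N * (1 + M)"
    using a1N a2N tr by (simp add: a1_def DDF[unfolded a1_def])
  then show ?thesis by (simp add: p_u[OF x] divide_inverse)
qed

section \<open>Coefficients of the Laplacian in a chart\<close>

definition spd :: "real ^ 'n::finite ^ 'n \<Rightarrow> bool" where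
  "spd B \<longleftrightarrow> transpose B = B \<and> (\<forall>v. v \<noteq> 0 \<longrightarrow> v \<bullet> (B *v v) > 0)"

lemma det_nonzero_if_form_pos:
  fixes B :: "real ^ 'n::finite ^ 'n"
  assumes "\<And>v. v \<noteq> 0 \<Longrightarrow> v \<bullet> (B *v v) > 0"
  shows "det B \<noteq> 0"
proof -
  have "B *v v = 0 \<longrightarrow> v = 0" for v
    using assms[of v] by (metis inner_zero_right less_irrefl)
  then have "invertible B"
    using invertible_left_inverse matrix_left_invertible_ker by blast
  then show ?thesis by (simp add: invertible_det_nz)
qed

text \<open>The matrices \<open>H t\<close> on the segment from the identity to \<open>B\<close>
  remain positive definite, so the determinant cannot vanish on the way from 1 to
  \<open>det B\<close>.\<close>

lemma det_spd_pos:
  fixes B :: "real ^ 'n::finite ^ 'n"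
  assumes "spd B"
  shows "det B > 0"
proof (rule ccontr)
  assume neg: "\<not> det B > 0"
  define H where "H t = (\<chi> i j. (1 - t) * (if i = j then 1 else 0) + t * B $ i $ j)" for t :: real
  have H: "H t *v v = (1 - t) *\<^sub>R v + t *\<^sub>R (B *v v)" for t v
    by (simp add: H_def vec_eq_iff matrix_vector_mult_def sum_distrib_left distrib_right sum.distrib
        if_distrib[of "\<lambda>c. c * _"] if_distrib[of "(*) _"] sum.delta' mult.assoc cong: if_cong)
  have "continuous_on {0..1} (\<lambda>t. det (H t))"
    unfolding det_def H_def by (auto intro!: continuous_intros)
  moreover have "det (H 0) = 1" "det (H 1) = det B"
  proof -
    have "H 0 = mat 1" "H 1 = B" by (simp_all add: H_def vec_eq_iff mat_def)
    then show "det (H 0) = 1" "det (H 1) = det B" by simp_all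
  qed
  ultimately obtain t where t: "0 \<le> t" "t \<le> 1" "det (H t) = 0"
    using IVT2'[of "\<lambda>t. det (H t)" 1 0 0] neg by auto
  have "v \<bullet> (H t *v v) > 0" if "v \<noteq> 0" for v
  proof -
    have "v \<bullet> (B *v v) > 0" "v \<bullet> v > 0" using assms that by (auto simp: spd_def)
    moreover have "t > 0 \<or> 1 - t > 0" by linarith
    ultimately show ?thesis
      using t unfolding H inner_add_right inner_scaleR_right
      by (smt (verit) mult_nonneg_nonneg mult_pos_pos)
  qed
  then show False using det_nonzero_if_form_pos t(3) by blast
qed

lemma matrix_inv_mult:
  assumes "invertible B"
  shows "B ** matrix_inv B = mat 1" "matrix_inv B ** B = mat 1"
  using assms someI_ex[of "\<lambda>A'. B ** A' = mat 1 \<and> A' ** B = mat 1"]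
  unfolding invertible_def matrix_inv_def by blast+

lemma spd_invertible: "spd B \<Longrightarrow> invertible B"
  using det_spd_pos[of B] by (simp add: invertible_det_nz)

lemma spd_matrix_inv:
  assumes "spd B"
  shows "spd (matrix_inv B)"
proof -
  note inv = matrix_inv_mult[OF spd_invertible[OF assms]]
  have tB: "transpose B = B" using assms by (simp add: spd_def)
  have "transpose (matrix_inv B) ** B = mat 1"
    using arg_cong[OF inv(1), of transpose] by (simp add: matrix_transpose_mul tB)
  then have "transpose (matrix_inv B) ** (B ** matrix_inv B) = matrix_inv B"
    by (simp add: matrix_mul_assoc)
  then have "transpose (matrix_inv B) = matrix_inv B" by (simp add: inv)
  moreover have "v \<bullet> (matrix_inv B *v v) > 0" if "v \<noteq> 0" for v
  proof -
    let ?w = "matrix_inv B *v v"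
    have v: "B *v ?w = v" by (simp add: matrix_vector_mul_assoc inv)
    then have "?w \<noteq> 0" using that by auto
    then have "?w \<bullet> (B *v ?w) > 0" using assms by (simp add: spd_def)
    then show ?thesis by (simp add: v inner_commute)
  qed
  ultimately show ?thesis by (simp add: spd_def)
qed

text \<open>Cramer's rule turns the entries of the inverse into quotients of determinants, from
  which smoothness of the inverse metric is read off.\<close>

lemma matrix_inv_cramer:
  fixes B :: "real ^ 'n::finite ^ 'n"
  assumes "invertible B"
  shows "matrix_inv B $ i $ j = det (\<chi> k l. if l = i then axis j 1 $ k else B $ k $ l) / det B"
proof -
  have "B *v (matrix_inv B *v axis j 1) = axis j 1"
    by (simp add: matrix_vector_mul_assoc matrix_inv_mult[OF assms])
  then have "matrix_inv B *v axis j 1 =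
      (\<chi> i. det (\<chi> k l. if l = i then axis j 1 $ k else B $ k $ l) / det B)"
    using cramer[of B] assms invertible_det_nz by blast
  then have "(matrix_inv B *v axis j 1) $ i =
      det (\<chi> k l. if l = i then axis j 1 $ k else B $ k $ l) / det B"
    by simp
  then show ?thesis
    by (simp add: matrix_vector_mult_basis column_def)
qed

lemma inner_matrix_vector_sum:
  "v \<bullet> (B *v v) = (\<Sum>i\<in>UNIV. \<Sum>j\<in>UNIV. B $ i $ j * v $ i * v $ j)" for v :: "real ^ 'n::finite"
  by (simp add: inner_vec_def matrix_vector_mult_def sum_distrib_left mult_ac)

lemma spd_sym: "spd B \<Longrightarrow> B $ i $ j = B $ j $ i"
  unfolding spd_def by (metis transpose_def vec_lambda_beta)

definition dual_metric :: "(real ^ 'n::finite \<Rightarrow> real ^ 'n ^ 'n) \<Rightarrow> 'n \<Rightarrow> 'n \<Rightarrow> real ^ 'n \<Rightarrow> real" where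
  "dual_metric G i j x = matrix_inv (G x) $ i $ j"

text \<open>First-order coefficients of \<open>div grad\<close> written in non-divergence form.\<close>

definition drift :: "(real ^ 'n::finite \<Rightarrow> real ^ 'n ^ 'n) \<Rightarrow> 'n \<Rightarrow> real ^ 'n \<Rightarrow> real" where
  "drift G j x = (\<Sum>i\<in>UNIV. partial_deriv i (\<lambda>y. sqrt (det (G y)) * dual_metric G i j y) x) / sqrt (det (G x))"

text \<open>Gathers all that is required of the operator at one point: ellipticity and coefficient
  bounds for the Bernstein and barrier arguments, and in the last clause a bound on the metric
  itself, for lengths of coordinate segments.\<close>

definition coeff_bound :: "(real ^ 'n::finite \<Rightarrow> real ^ 'n ^ 'n) \<Rightarrow> real \<Rightarrow> real \<Rightarrow> real ^ 'n \<Rightarrow> bool" where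
  "coeff_bound G \<alpha> N y \<longleftrightarrow>
    (\<forall>v. \<alpha> * (\<Sum>i\<in>UNIV. (v i)\<^sup>2) \<le> quad_form (\<lambda>i j. dual_metric G i j y) v) \<and>
    (\<forall>i j. \<bar>dual_metric G i j y\<bar> \<le> N) \<and> (\<forall>k i j. \<bar>partial_deriv k (dual_metric G i j) y\<bar> \<le> N) \<and>
    (\<forall>l k i j. \<bar>partial_deriv l (partial_deriv k (dual_metric G i j)) y\<bar> \<le> N) \<and>
    (\<forall>i. \<bar>drift G i y\<bar> \<le> N) \<and> (\<forall>k i. \<bar>partial_deriv k (drift G i) y\<bar> \<le> N) \<and>
    (\<forall>i j. \<bar>G y $ i $ j\<bar> \<le> N)"

lemma coeff_boundD:
  assumes "coeff_bound G \<alpha> N y"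
  shows "\<alpha> * (\<Sum>i\<in>UNIV. (v i)\<^sup>2) \<le> quad_form (\<lambda>i j. dual_metric G i j y) v"
    and "\<bar>dual_metric G i j y\<bar> \<le> N" and "\<bar>partial_deriv k (dual_metric G i j) y\<bar> \<le> N"
    and "\<bar>partial_deriv l (partial_deriv k (dual_metric G i j)) y\<bar> \<le> N"
    and "\<bar>drift G i y\<bar> \<le> N" and "\<bar>partial_deriv k (drift G i) y\<bar> \<le> N" and "\<bar>G y $ i $ j\<bar> \<le> N"
  using assms by (simp_all add: coeff_bound_def)

text \<open>Replacing \<open>N\<close> by its square makes the factor a perfect square, whose root
  is the Lipschitz constant \<open>B\<close> of \<open>segment_curve\<close>.\<close>

lemma coeff_bound_form:
  fixes G :: "real ^ 'n::finite \<Rightarrow> real ^ 'n ^ 'n"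
  assumes "coeff_bound G \<alpha> N y" "N \<ge> 1"
  shows "v \<bullet> (G y *v v) \<le> (real CARD('n) * N)\<^sup>2 * (norm v)\<^sup>2"
proof -
  have "\<bar>v \<bullet> (G y *v v)\<bar> \<le> (real CARD('n))\<^sup>2 * (N * norm v * norm v)"
    unfolding inner_matrix_vector_sum
    using coeff_boundD(7)[OF assms(1)] component_le_norm_cart by (intro abs_double_sum_le_card abs_mult_le)
  also have "\<dots> \<le> (real CARD('n))\<^sup>2 * (N\<^sup>2 * norm v * norm v)"
    using assms(2) by (intro mult_left_mono mult_right_mono self_le_power) auto
  finally show ?thesis by (simp add: power_mult_distrib power2_eq_square mult_ac)
qed

section \<open>The metric and the Laplacian on an open coordinate domain\<close>

locale local_metric =
  fixes U :: "(real ^ 'n::finite) set" and G :: "real ^ 'n \<Rightarrow> real ^ 'n ^ 'n"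
  assumes open_U: "open U" and smooth_G: "smooth_on U G" and spd_G: "x \<in> U \<Longrightarrow> spd (G x)"
begin

lemma smooth_entry: "smooth_on U (\<lambda>x. G x $ i $ j)"
  using smooth_on_bounded_linear[OF open_U bounded_linear_vec_nth smooth_on_bounded_linear[OF open_U bounded_linear_vec_nth smooth_G]] .

lemma smooth_det: "smooth_on U (\<lambda>x. det (G x))"
  by (intro smooth_on_det open_U smooth_entry)

lemma smooth_sqrt_det: "smooth_on U (\<lambda>x. sqrt (det (G x)))"
  by (intro smooth_on_sqrt open_U smooth_det det_spd_pos spd_G)

lemma smooth_dual_metric: "smooth_on U (dual_metric G i j)"
proof -
  have "smooth_on U (\<lambda>x. det (\<chi> k l. if l = i then axis j 1 $ k else G x $ k $ l) / det (G x))"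
  proof (intro smooth_on_divide smooth_on_det open_U smooth_det)
    show "smooth_on U (\<lambda>x. (\<chi> k l. if l = i then axis j 1 $ k else G x $ k $ l) $ m $ n)" for m n
      using smooth_entry by (cases "n = i") auto
    show "det (G x) \<noteq> 0" if "x \<in> U" for x
      using det_spd_pos[OF spd_G[OF that]] by simp
  qed (rule smooth_entry)
  then show ?thesis
    using smooth_on_cong[OF open_U] matrix_inv_cramer[OF spd_invertible[OF spd_G]]
    by (metis (no_types, lifting) dual_metric_def)
qed

lemma smooth_drift: "smooth_on U (drift G j)"
  unfolding drift_def
  using det_spd_pos[OF spd_G]
  by (intro smooth_on_divide smooth_on_sum smooth_on_partial_deriv smooth_on_mult open_U
      smooth_sqrt_det smooth_dual_metric) force

lemma dual_metric_sym: "x \<in> U \<Longrightarrow> dual_metric G i j x = dual_metric G j i x"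
  unfolding dual_metric_def by (intro spd_sym spd_matrix_inv spd_G)

text \<open>Product rule: derivatives falling on \<open>sqrt det\<close> times the inverse metric
  form \<open>drift\<close>; symmetry of the inverse metric puts the indices of the remaining term
  in the order of \<open>second_order\<close>.\<close>

lemma divergence_form_expand:
  assumes h: "smooth_on U h" and x: "x \<in> U"
  shows "(\<Sum>i\<in>UNIV. partial_deriv i (\<lambda>y. sqrt (det (G y)) * (\<Sum>j\<in>UNIV. dual_metric G i j y * partial_deriv j h y)) x)
      / sqrt (det (G x))
    = second_order (dual_metric G) h x
      + first_order (drift G) h x"
proof -
  let ?s = "\<lambda>y. sqrt (det (G y))"
  have s: "?s x \<noteq> 0" using det_spd_pos[OF spd_G[OF x]] by simp
  note d = smooth_on_differentiable[OF smooth_sqrt_det x] smooth_on_differentiable[OF smooth_dual_metric x]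
    smooth_on_differentiable[OF smooth_on_partial_deriv[OF h] x]
  have "partial_deriv i (\<lambda>y. ?s y * (\<Sum>j\<in>UNIV. dual_metric G i j y * partial_deriv j h y)) x =
      (\<Sum>j\<in>UNIV. ?s x * (dual_metric G i j x * partial_deriv i (partial_deriv j h) x)
        + partial_deriv i (\<lambda>y. ?s y * dual_metric G i j y) x * partial_deriv j h x)" for i
  proof -
    have "partial_deriv i (\<lambda>y. ?s y * (\<Sum>j\<in>UNIV. dual_metric G i j y * partial_deriv j h y)) x =
      partial_deriv i (\<lambda>y. \<Sum>j\<in>UNIV. (?s y * dual_metric G i j y) * partial_deriv j h y) x"
      by (simp add: sum_distrib_left mult.assoc)
    also have "\<dots> = (\<Sum>j\<in>UNIV. ?s x * (dual_metric G i j x * partial_deriv i (partial_deriv j h) x)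
        + partial_deriv i (\<lambda>y. ?s y * dual_metric G i j y) x * partial_deriv j h x)"
      using d by (subst partial_deriv_sum) (auto simp: partial_deriv_mult algebra_simps intro!: sum.cong)
    finally show ?thesis .
  qed
  then have "(\<Sum>i\<in>UNIV. partial_deriv i (\<lambda>y. ?s y * (\<Sum>j\<in>UNIV. dual_metric G i j y * partial_deriv j h y)) x) =
      ?s x * (\<Sum>i\<in>UNIV. \<Sum>j\<in>UNIV. dual_metric G i j x * partial_deriv i (partial_deriv j h) x)
      + (\<Sum>i\<in>UNIV. \<Sum>j\<in>UNIV. partial_deriv i (\<lambda>y. ?s y * dual_metric G i j y) x * partial_deriv j h x)"
    by (simp add: sum.distrib sum_distrib_left)
  also have "(\<Sum>i\<in>UNIV. \<Sum>j\<in>UNIV. partial_deriv i (\<lambda>y. ?s y * dual_metric G i j y) x * partial_deriv j h x)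
      = ?s x * first_order (drift G) h x"
    using s by (subst sum.swap) (simp add: drift_def sum_distrib_right[symmetric] sum_distrib_left)
  also have "(\<Sum>i\<in>UNIV. \<Sum>j\<in>UNIV. dual_metric G i j x * partial_deriv i (partial_deriv j h) x) =
      second_order (dual_metric G) h x"
    by (subst sum.swap) (simp add: dual_metric_sym[OF x, of _ "_ :: 'n"])
  finally show ?thesis using s by (simp add: distrib_left[symmetric])
qed

end

text \<open>Phrased with \<open>eventually\<close> so that finitely many bounds merge into a single
  \<open>N\<close> without explicit maxima.\<close>

lemma eventually_bounded_on_compact:
  fixes f :: "'a::topological_space \<Rightarrow> real"
  assumes "compact K" "continuous_on K f"
  shows "eventually (\<lambda>N. \<forall>y\<in>K. \<bar>f y\<bar> \<le> N) at_top"
proof -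
  obtain B where B: "\<And>y. y \<in> K \<Longrightarrow> \<bar>f y\<bar> \<le> B"
    using compact_imp_bounded[OF compact_continuous_image[OF assms(2,1)]] by (auto simp: bounded_iff)
  from eventually_ge_at_top[of B] show ?thesis
    by eventually_elim (use B order_trans in blast)
qed

context local_metric begin

text \<open>The constant is the minimum of the inverse metric over \<open>K\<close> times the unit
  sphere, positive because it is attained; homogeneity extends the inequality to all
  vectors.\<close>

lemma compact_ellipticity:
  assumes K: "compact K" "K \<subseteq> U"
  obtains \<alpha> where "\<alpha> > 0" "\<And>y v. y \<in> K \<Longrightarrow>
    \<alpha> * (\<Sum>i\<in>UNIV. (v i)\<^sup>2) \<le> quad_form (\<lambda>i j. dual_metric G i j y) v"
proof (cases "K = {}")
  case True
  then show thesis by (intro that[of 1]) auto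
next
  case False
  define S where "S = sphere (0 :: real ^ 'n) 1"
  define Q where "Q = (\<lambda>z :: (real ^ 'n) \<times> (real ^ 'n).
    \<Sum>i\<in>UNIV. \<Sum>j\<in>UNIV. dual_metric G i j (fst z) * snd z $ i * snd z $ j)"
  have Qeq: "Q (y, v) = v \<bullet> (matrix_inv (G y) *v v)" for y v
    by (simp add: Q_def inner_matrix_vector_sum dual_metric_def)
  have "continuous_on (K \<times> S) (\<lambda>z. dual_metric G i j (fst z))" for i j
    using smooth_on_continuous_on[OF smooth_dual_metric] K(2)
    by (intro continuous_on_compose2[of U "dual_metric G i j" _ fst]) (auto intro: continuous_intros)
  then have "continuous_on (K \<times> S) Q"
    unfolding Q_def by (intro continuous_intros)
  moreover have "compact (K \<times> S)" using K by (simp add: S_def compact_Times)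
  moreover have "K \<times> S \<noteq> {}"
    using False vector_choose_size[of 1] by (auto simp: S_def)
  ultimately obtain z where z: "z \<in> K \<times> S" "\<And>w. w \<in> K \<times> S \<Longrightarrow> Q z \<le> Q w"
    using continuous_attains_inf[of "K \<times> S" Q] by blast
  obtain y0 v0 where [simp]: "z = (y0, v0)" by (cases z)
  have "spd (matrix_inv (G y0))" using z(1) K(2) by (auto intro: spd_matrix_inv spd_G)
  moreover have "v0 \<noteq> 0" using z(1) by (auto simp: S_def)
  ultimately have pos: "Q z > 0" by (simp add: Qeq spd_def)
  show thesis
  proof (rule that[OF pos])
    fix y and v :: "'n \<Rightarrow> real" assume y: "y \<in> K"
    define w where "w = (\<chi> i. v i)"
    have w2: "(\<Sum>i\<in>UNIV. (v i)\<^sup>2) = (norm w)\<^sup>2"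
      by (simp add: w_def norm_vec_def L2_set_def sum_nonneg)
    have Qw: "quad_form (\<lambda>i j. dual_metric G i j y) v = Q (y, w)"
      by (simp add: Q_def w_def)
    show "Q z * (\<Sum>i\<in>UNIV. (v i)\<^sup>2) \<le> quad_form (\<lambda>i j. dual_metric G i j y) v"
    proof (cases "w = 0")
      case True
      then show ?thesis unfolding w2 Qw by (simp add: Q_def)
    next
      case False
      let ?u = "w /\<^sub>R norm w"
      have "Q z \<le> Q (y, ?u)" using y False by (intro z(2)) (auto simp: S_def)
      also have "Q (y, ?u) = Q (y, w) / (norm w)\<^sup>2"
        by (simp add: Qeq matrix_vector_mult_scaleR power2_eq_square divide_inverse)
      finally show ?thesis unfolding w2 Qw using False by (simp add: field_simps)
    qed
  qed
qed

lemma compact_coeff_bound: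
  assumes K: "compact K" "K \<subseteq> U"
  shows "\<exists>\<alpha>>0. \<exists>N\<ge>1. \<forall>y\<in>K. coeff_bound G \<alpha> N y"
proof -
  obtain \<alpha> where \<alpha>: "\<alpha> > 0" "\<And>y v. y \<in> K \<Longrightarrow>
    \<alpha> * (\<Sum>i\<in>UNIV. (v i)\<^sup>2) \<le> quad_form (\<lambda>i j. dual_metric G i j y) v"
    using compact_ellipticity[OF K] by blast
  note b = eventually_bounded_on_compact[OF K(1) continuous_on_subset[OF smooth_on_continuous_on K(2)]]
  note s = smooth_dual_metric smooth_drift smooth_entry smooth_on_partial_deriv
  have "eventually (\<lambda>N. N \<ge> 1 \<and> (\<forall>i j. \<forall>y\<in>K. \<bar>dual_metric G i j y\<bar> \<le> N) \<and>
      (\<forall>k i j. \<forall>y\<in>K. \<bar>partial_deriv k (dual_metric G i j) y\<bar> \<le> N) \<and>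
      (\<forall>l k i j. \<forall>y\<in>K. \<bar>partial_deriv l (partial_deriv k (dual_metric G i j)) y\<bar> \<le> N) \<and>
      (\<forall>i. \<forall>y\<in>K. \<bar>drift G i y\<bar> \<le> N) \<and> (\<forall>k i. \<forall>y\<in>K. \<bar>partial_deriv k (drift G i) y\<bar> \<le> N) \<and>
      (\<forall>i j. \<forall>y\<in>K. \<bar>G y $ i $ j\<bar> \<le> N)) at_top"
    by (intro eventually_conj eventually_all_finite b s eventually_ge_at_top)
  then have "eventually (\<lambda>N. N \<ge> 1 \<and> (\<forall>y\<in>K. coeff_bound G \<alpha> N y)) at_top"
    by (rule eventually_mono) (simp add: coeff_bound_def \<alpha>(2))
  from eventually_happens'[OF trivial_limit_at_top_linorder this] \<alpha>(1) show ?thesis by blast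
qed

end

section \<open>Zeros in small balls\<close>

lemma smooth_on_ball_bump:
  "smooth_on U (\<lambda>y :: real ^ 'n::finite. c - (\<Sum>i\<in>UNIV. (y $ i - x $ i) * (y $ i - x $ i)))" if "open U"
  by (intro smooth_on_diff smooth_on_sum smooth_on_mult smooth_on_nth smooth_on_const that)

context
  fixes a :: "'n::finite \<Rightarrow> 'n \<Rightarrow> real ^ 'n \<Rightarrow> real" and b :: "'n \<Rightarrow> real ^ 'n \<Rightarrow> real"
    and U x R \<alpha> N M
  assumes U: "open U" and R: "0 < R" "R \<le> 1" and sub: "cball x R \<subseteq> U"
    and sym: "\<And>i j y. y \<in> cball x R \<Longrightarrow> a i j y = a j i y"
    and \<alpha>: "\<alpha> > 0" and ell: "\<And>v y. y \<in> cball x R \<Longrightarrow>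
      \<alpha> * (\<Sum>i\<in>UNIV. (v i)\<^sup>2) \<le> quad_form (\<lambda>i j. a i j y) v"
    and aN: "\<And>i j y. y \<in> cball x R \<Longrightarrow> \<bar>a i j y\<bar> \<le> N" and bN: "\<And>i y. y \<in> cball x R \<Longrightarrow> \<bar>b i y\<bar> \<le> N"
    and M: "M > 0" "(8 * real CARD('n) * N + 8 * \<alpha>)\<^sup>2 < 32 * \<alpha> * R\<^sup>2 * M"
begin

text \<open>Barta's argument: a positive solution \<open>u\<close> is compared with the subsolution \<open>\<psi>\<^sup>2\<close>,
  \<open>\<psi> = R\<^sup>2 - \<bar>y - x\<bar>\<^sup>2\<close>, at a maximum point of \<open>\<psi>\<^sup>2 / u\<close>.\<close>

lemma no_positive_solution_on_ball:
  assumes su: "smooth_on U u"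
    and eqn: "\<And>y. y \<in> cball x R \<Longrightarrow> second_order a u y
       + first_order b u y = - M * u y"
    and pos: "\<And>y. y \<in> cball x R \<Longrightarrow> u y > 0"
  shows False
proof -
  define n where "n = real CARD('n)"
  define \<psi> where "\<psi> y = R\<^sup>2 - (\<Sum>i\<in>UNIV. (y $ i - x $ i) * (y $ i - x $ i))" for y
  \<comment> \<open>The square matters near the sphere: there the second derivatives of \<phi> leave
    a positive term of size \<open>8 * \<alpha> * R\<^sup>2\<close>, while every adverse term
    carries a factor \<psi>.\<close>
  define \<phi> where "\<phi> y = \<psi> y * \<psi> y" for y
  have sq: "(\<Sum>i\<in>UNIV. (y $ i - x $ i) * (y $ i - x $ i)) = (dist x y)\<^sup>2" for y
    by (simp add: dist_norm norm_vec_def L2_set_def sum_nonneg power2_eq_square[symmetric] power2_commute)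
  have \<psi>: "\<psi> y = R\<^sup>2 - (dist x y)\<^sup>2" for y by (simp add: \<psi>_def sq)
  have s\<psi>: "smooth_on UNIV \<psi>" unfolding \<psi>_def by (rule smooth_on_ball_bump) simp
  have s\<phi>: "smooth_on UNIV \<phi>" unfolding \<phi>_def by (intro smooth_on_mult s\<psi>) simp
  note nth = smooth_on_differentiable[OF smooth_on_nth[OF open_UNIV] UNIV_I]
  note d\<psi> = smooth_on_differentiable[OF s\<psi> UNIV_I]
  have D\<psi>: "partial_deriv i \<psi> y = - 2 * (y $ i - x $ i)" for i y
  proof -
    note d = differentiable_mult differentiable_diff differentiable_const nth
    have "partial_deriv i \<psi> y = - partial_deriv i (\<lambda>y. \<Sum>i\<in>UNIV. (y $ i - x $ i) * (y $ i - x $ i)) y"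
      unfolding \<psi>_def by (subst partial_deriv_diff) (auto intro!: d differentiable_sum)
    also have "\<dots> = - (\<Sum>j\<in>UNIV. partial_deriv i (\<lambda>y. (y $ j - x $ j) * (y $ j - x $ j)) y)"
      by (subst partial_deriv_sum) (auto intro!: d)
    also have "\<dots> = - (\<Sum>j\<in>UNIV. if i = j then 2 * (y $ j - x $ j) else 0)"
      by (intro arg_cong[of _ _ uminus] sum.cong refl)
        (simp add: partial_deriv_mult partial_deriv_diff partial_deriv_nth d)
    finally show ?thesis by simp
  qed
  have DD\<psi>: "partial_deriv j (partial_deriv i \<psi>) y = (if i = j then - 2 else 0)" for i j y
  proof -
    have 1: "partial_deriv i \<psi> = (\<lambda>y. - 2 * (y $ i - x $ i))" by (rule ext) (rule D\<psi>)
    have "((\<lambda>y. - 2 * (y $ i - x $ i)) has_derivative (\<lambda>v. - 2 * v $ i)) (at y)"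
      by (auto intro!: derivative_eq_intros bounded_linear.has_derivative[OF bounded_linear_vec_nth])
    from partial_deriv_eq[OF this] show ?thesis
      unfolding 1 by (simp add: axis_def)
  qed
  have D\<phi>: "partial_deriv i \<phi> y = 2 * (\<psi> y * partial_deriv i \<psi> y)" for i y
    unfolding \<phi>_def using d\<psi> by (simp add: partial_deriv_mult)
  have DD\<phi>: "partial_deriv j (partial_deriv i \<phi>) y =
      2 * (\<psi> y * partial_deriv j (partial_deriv i \<psi>) y + partial_deriv j \<psi> y * partial_deriv i \<psi> y)" for i j y
  proof -
    have "partial_deriv i \<phi> = (\<lambda>y. 2 * (\<psi> y * partial_deriv i \<psi> y))" by (rule ext) (rule D\<phi>)
    then show ?thesis using d\<psi> smooth_on_differentiable[OF smooth_on_partial_deriv[OF s\<psi>] UNIV_I]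
      by (simp add: partial_deriv_mult)
  qed
  have "continuous_on (cball x R) (\<lambda>y. \<phi> y / u y)"
    using smooth_on_continuous_on[OF s\<phi>] smooth_on_continuous_on[OF su] sub pos
    by (intro continuous_on_divide) (force intro: continuous_on_subset)+
  then obtain y where y: "y \<in> cball x R" "\<And>z. z \<in> cball x R \<Longrightarrow> \<phi> z / u z \<le> \<phi> y / u y"
    using continuous_attains_sup[of "cball x R" "\<lambda>y. \<phi> y / u y"] R by auto
  \<comment> \<open>The quotient is positive at the centre and zero on the sphere, so its maximum
    point \<open>y\<close> is interior.\<close>
  define s where "s = \<phi> y / u y"
  have "0 < \<phi> x / u x" using R pos[of x] by (simp add: \<phi>_def \<psi>)
  also have "\<dots> \<le> s" unfolding s_def using R by (intro y(2)) auto
  finally have s: "s > 0" .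
  then have "\<phi> y \<noteq> 0" by (auto simp: s_def)
  then have "dist x y \<noteq> R" by (auto simp: \<phi>_def \<psi>)
  with y(1) have yb: "y \<in> ball x R" by auto
  then have \<psi>y: "\<psi> y > 0" by (simp add: \<psi> power_strict_mono)
  \<comment> \<open>With \<open>s\<close> the maximal quotient, \<open>w\<close> is nonnegative and
    touches 0 at \<open>y\<close>: the contact point of the comparison.\<close>
  define w where "w z = s * u z - \<phi> z" for z
  have sb: "smooth_on (ball x R) u" using su sub by (meson smooth_on_subset ball_subset_cball order_trans)
  have s\<phi>b: "smooth_on (ball x R) \<phi>" using s\<phi> by (rule smooth_on_subset) simp
  have sw: "smooth_on (ball x R) w"
    unfolding w_def by (intro smooth_on_diff smooth_on_mult smooth_on_const sb s\<phi>b) auto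
  have w0: "w y = 0" using pos[OF y(1)] by (simp add: w_def s_def)
  have wmin: "w y \<le> w z" if "z \<in> ball x R" for z
    using y(2)[of z] pos[of z] that unfolding w0 unfolding w_def s_def[symmetric] by (simp add: field_simps)
  have Dw: "partial_deriv i w z = s * partial_deriv i u z - partial_deriv i \<phi> z" if "z \<in> ball x R" for i z
    unfolding w_def using smooth_on_differentiable[OF sb that] smooth_on_differentiable[OF s\<phi>b that]
    by (simp add: partial_deriv_diff partial_deriv_mult)
  have DDw: "partial_deriv j (partial_deriv i w) y =
      s * partial_deriv j (partial_deriv i u) y - partial_deriv j (partial_deriv i \<phi>) y" for i j
  proof -
    have "partial_deriv j (partial_deriv i w) y =
        partial_deriv j (\<lambda>z. s * partial_deriv i u z - partial_deriv i \<phi> z) y"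
      by (rule partial_deriv_cong[OF open_ball yb Dw])
    then show ?thesis
      using smooth_on_differentiable[OF smooth_on_partial_deriv[OF sb] yb]
        smooth_on_differentiable[OF smooth_on_partial_deriv[OF s\<phi>b] yb]
      by (simp add: partial_deriv_diff partial_deriv_mult)
  qed
  have psda: "0 \<le> quad_form (\<lambda>i j. a i j y) v" for v
    using ell[OF y(1), of v] \<alpha> by (meson less_imp_le mult_nonneg_nonneg order_trans sum_nonneg zero_le_power2)
  have "0 \<le> second_order a w y"
    by (rule trace_product_psd_nonneg[OF sym[OF y(1)] psda second_derivative_local_min[OF open_ball sw yb wmin]])
  moreover have "partial_deriv l w y = 0" for l
    by (rule partial_deriv_local_min[OF open_ball sw yb wmin])
  then have "s * partial_deriv l u y = partial_deriv l \<phi> y" for l using Dw[OF yb] by simp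
  moreover have "second_order a w y =
      s * second_order a u y
      - second_order a \<phi> y"
    unfolding DDw by (simp add: right_diff_distrib sum_subtractf sum_distrib_left mult_ac)
  moreover have "s * second_order a u y =
      - M * \<phi> y - (\<Sum>l\<in>UNIV. b l y * (s * partial_deriv l u y))"
  proof -
    have "s * second_order a u y =
      s * (- M * u y - first_order b u y)"
      using eqn[OF y(1)] by (intro arg_cong[of _ _ "(*) s"]) linarith
    also have "\<dots> = - M * (s * u y) - (\<Sum>l\<in>UNIV. b l y * (s * partial_deriv l u y))"
      by (simp add: right_diff_distrib sum_distrib_left mult_ac)
    finally show ?thesis using w0 by (simp add: w_def)
  qed
  ultimately have L: "M * \<phi> y \<le> - second_order a \<phi> y
      - first_order b \<phi> y" by simp
  have "second_order a \<phi> y =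
      2 * \<psi> y * (\<Sum>k\<in>UNIV. \<Sum>l\<in>UNIV. a k l y * (if k = l then - 2 else 0))
      + 8 * (\<Sum>k\<in>UNIV. \<Sum>l\<in>UNIV. a k l y * (y $ k - x $ k) * (y $ l - x $ l))"
    unfolding DD\<phi> DD\<psi> D\<psi> sum_distrib_left sum.distrib[symmetric]
    by (intro sum.cong refl) (simp add: algebra_simps)
  also have "(\<Sum>k\<in>UNIV. \<Sum>l\<in>UNIV. a k l y * (if k = l then - 2 else 0)) = - 2 * (\<Sum>k\<in>UNIV. a k k y)"
    by (simp add: if_distrib[of "(*) _"] sum.delta sum_distrib_left mult_ac cong: if_cong)
  finally have A: "second_order a \<phi> y =
      2 * \<psi> y * (- 2 * (\<Sum>k\<in>UNIV. a k k y))
      + 8 * (\<Sum>k\<in>UNIV. \<Sum>l\<in>UNIV. a k l y * (y $ k - x $ k) * (y $ l - x $ l))" .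
  have B: "first_order b \<phi> y = - 4 * \<psi> y * (\<Sum>l\<in>UNIV. b l y * (y $ l - x $ l))"
    unfolding D\<phi> D\<psi> sum_distrib_left by (intro sum.cong refl) (simp add: algebra_simps)
  have "\<bar>\<Sum>k\<in>UNIV. a k k y\<bar> \<le> n * N"
    unfolding n_def using aN[OF y(1)] by (intro abs_sum_le_card)
  then have 1: "\<psi> y * (\<Sum>k\<in>UNIV. a k k y) \<le> \<psi> y * (n * N)"
    using \<psi>y by (intro mult_left_mono) auto
  have "\<bar>y $ l - x $ l\<bar> \<le> 1" for l
    using component_le_norm_cart[of "y - x" l] y(1) R by (simp add: dist_norm norm_minus_commute)
  then have "\<bar>\<Sum>l\<in>UNIV. b l y * (y $ l - x $ l)\<bar> \<le> n * (N * 1)"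
    unfolding n_def using bN[OF y(1)] by (intro abs_sum_le_card abs_mult_le)
  then have 2: "\<psi> y * (\<Sum>l\<in>UNIV. b l y * (y $ l - x $ l)) \<le> \<psi> y * (n * N)"
    using \<psi>y by (intro mult_left_mono) auto
  have "\<alpha> * (R\<^sup>2 - \<psi> y) \<le> (\<Sum>k\<in>UNIV. \<Sum>l\<in>UNIV. a k l y * (y $ k - x $ k) * (y $ l - x $ l))"
    using ell[OF y(1), of "\<lambda>i. y $ i - x $ i"] by (simp add: \<psi>_def power2_eq_square)
  then have "M * (\<psi> y * \<psi> y) \<le> 8 * (\<psi> y * (n * N)) - 8 * (\<alpha> * (R\<^sup>2 - \<psi> y))"
    using L 1 2 unfolding A B \<phi>_def by simp
  then have q: "M * (\<psi> y * \<psi> y) - (8 * n * N + 8 * \<alpha>) * \<psi> y + 8 * \<alpha> * R\<^sup>2 \<le> 0"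
    by (simp add: algebra_simps)
  \<comment> \<open>\<open>q\<close> says that a quadratic polynomial in \<psi> is nonpositive at
    \<open>\<psi> y\<close>, whereas the second assumption on \<open>M\<close> is precisely that its
    discriminant is negative.\<close>
  define c where "c = 8 * n * N + 8 * \<alpha>"
  have "0 \<le> (2 * M * \<psi> y - c)\<^sup>2" by simp
  also have "\<dots> = 4 * M * (M * (\<psi> y * \<psi> y) - c * \<psi> y + 8 * \<alpha> * R\<^sup>2) + (c\<^sup>2 - 32 * \<alpha> * R\<^sup>2 * M)"
    by algebra
  also have "\<dots> < 0"
  proof -
    have "4 * M * (M * (\<psi> y * \<psi> y) - c * \<psi> y + 8 * \<alpha> * R\<^sup>2) \<le> 0"
      using q M(1) by (simp add: c_def mult_nonneg_nonpos)
    moreover have "c\<^sup>2 - 32 * \<alpha> * R\<^sup>2 * M < 0" using M(2) by (simp add: c_def n_def)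
    ultimately show ?thesis by linarith
  qed
  finally show False by simp
qed

text \<open>Without a zero, connectedness of the ball fixes the sign of \<open>u\<close>; Barta's
  argument excludes positive solutions, and applied to \<open>- u\<close> also negative
  ones.\<close>

lemma solution_has_zero_in_ball:
  assumes su: "smooth_on U u"
    and eqn: "\<And>y. y \<in> cball x R \<Longrightarrow> second_order a u y
       + first_order b u y = - M * u y"
  obtains y where "y \<in> cball x R" "u y = 0"
proof (rule ccontr)
  assume "\<not> thesis"
  with that have nz: "u y \<noteq> 0" if "y \<in> cball x R" for y using \<open>y \<in> cball x R\<close> by blast
  have cont: "continuous_on (cball x R) u"
    using smooth_on_continuous_on[OF su] sub continuous_on_subset by blast
  have conn: "connected (u ` cball x R)"
    by (intro connected_continuous_image cont convex_connected) simp
  have dich: "(\<forall>y\<in>cball x R. u y > 0) \<or> (\<forall>y\<in>cball x R. u y < 0)"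
  proof (rule ccontr)
    assume "\<not> ?thesis"
    then obtain y z where "y \<in> cball x R" "z \<in> cball x R" "u y \<le> 0" "u z \<ge> 0" by force
    then have "0 \<in> u ` cball x R" using connectedD_interval[OF conn] by blast
    then show False using nz by auto
  qed
  then show False
  proof
    assume "\<forall>y\<in>cball x R. u y > 0"
    then show False
      using no_positive_solution_on_ball[OF su eqn] by blast
  next
    assume neg: "\<forall>y\<in>cball x R. u y < 0"
    have eqn': "second_order a (\<lambda>y. - u y) y
       + first_order b (\<lambda>y. - u y) y = - M * (- u y)" if "y \<in> cball x R" for y
    proof -
      have "y \<in> U" using that sub by blast
      then show ?thesis using eqn[OF that] by (simp add: partial_deriv_uminus_on[OF U su] sum_negf)
    qed
    show False
      by (rule no_positive_solution_on_ball[OF smooth_on_uminus[OF U su] eqn'])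
        (use neg in auto)
  qed
qed

end

section \<open>Charts and the global gradient estimate\<close>

text \<open>Expand the nonnegative form of \<open>B\<close> at \<open>z - v\<close>, where
  \<open>z\<close> is the inverse of \<open>B\<close> applied to \<open>w\<close>. Equality at
  \<open>v = z\<close> is \<open>spd_dual_attained\<close>.\<close>

lemma spd_dual_bound:
  assumes "spd B"
  shows "2 * (w \<bullet> v) - v \<bullet> (B *v v) \<le> w \<bullet> (matrix_inv B *v w)"
proof -
  define z where "z = matrix_inv B *v w"
  have Bz: "B *v z = w"
    by (simp add: z_def matrix_vector_mul_assoc matrix_inv_mult[OF spd_invertible[OF assms]])
  have sym: "v \<bullet> (B *v z) = z \<bullet> (B *v v)"
    using assms by (metis dot_lmul_matrix inner_commute spd_def transpose_matrix_vector)
  have "0 \<le> (z - v) \<bullet> (B *v (z - v))"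
    using assms by (cases "z - v = 0") (auto simp: spd_def less_imp_le)
  also have "\<dots> = z \<bullet> w - 2 * (w \<bullet> v) + v \<bullet> (B *v v)"
    using sym by (simp add: matrix_vector_mult_diff_distrib inner_diff_left inner_diff_right Bz inner_commute)
  finally show ?thesis by (simp add: z_def[symmetric] inner_commute)
qed

lemma spd_dual_attained:
  assumes "spd B"
  shows "2 * (w \<bullet> (matrix_inv B *v w)) - (matrix_inv B *v w) \<bullet> (B *v (matrix_inv B *v w)) = w \<bullet> (matrix_inv B *v w)"
  by (simp add: matrix_vector_mul_assoc matrix_inv_mult[OF spd_invertible[OF assms]] inner_commute)

lemma spd_form_nonneg: "spd B \<Longrightarrow> 0 \<le> v \<bullet> (B *v v)"
  by (cases "v = 0") (auto simp: spd_def less_imp_le)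

text \<open>The previous dual bound at the best multiple of \<open>v\<close>, with factor
  \<open>w \<bullet> v / b\<close>.\<close>

lemma spd_cauchy_schwarz:
  assumes "spd B"
  shows "\<bar>w \<bullet> v\<bar> \<le> sqrt (w \<bullet> (matrix_inv B *v w)) * sqrt (v \<bullet> (B *v v))"
proof (cases "v = 0")
  case False
  define b where "b = v \<bullet> (B *v v)"
  have b: "b > 0" using assms False by (simp add: b_def spd_def)
  have "2 * (w \<bullet> ((w \<bullet> v / b) *\<^sub>R v)) - ((w \<bullet> v / b) *\<^sub>R v) \<bullet> (B *v ((w \<bullet> v / b) *\<^sub>R v)) = (w \<bullet> v)\<^sup>2 / b"
    using b by (simp add: matrix_vector_mult_scaleR b_def[symmetric] power2_eq_square)
  then have "(w \<bullet> v)\<^sup>2 / b \<le> w \<bullet> (matrix_inv B *v w)"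
    using spd_dual_bound[OF assms, of w "(w \<bullet> v / b) *\<^sub>R v"] by simp
  then have "(w \<bullet> v)\<^sup>2 \<le> w \<bullet> (matrix_inv B *v w) * b"
    using b by (simp add: pos_divide_le_eq)
  then show ?thesis
    unfolding b_def[symmetric] real_sqrt_mult[symmetric] by (metis real_sqrt_abs real_sqrt_le_mono)
qed simp

locale closed_manifold =
  fixes X :: "'a topology" and A :: "('a, 'n::finite) chart set" and g :: "('a, 'n) metric_tensor"
  assumes closed: "closed_riemannian_manifold X A g"
begin

section \<open>Coordinates, their inverses, and the passage from local to global\<close>

definition range_of :: "('a, 'n) chart \<Rightarrow> (real ^ 'n) set" where
  "range_of c = coord c ` dom_of c"

definition local_g :: "('a, 'n) chart \<Rightarrow> real ^ 'n \<Rightarrow> real ^ 'n ^ 'n" where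
  "local_g c x = g c (param c x)"

lemma atlas: "smooth_atlas X A" and metric: "riemannian_metric A g" and compact: "compact_space X"
  using closed by (simp_all add: closed_riemannian_manifold_def)

lemma is_chart: "c \<in> A \<Longrightarrow> is_chart X c"
  using atlas by (simp add: smooth_atlas_def)

lemma openin_dom: "c \<in> A \<Longrightarrow> openin X (dom_of c)"
  using is_chart by (auto simp: is_chart_def)

lemma dom_subset: "c \<in> A \<Longrightarrow> dom_of c \<subseteq> topspace X"
  using openin_dom openin_subset by blast

lemma chart_at: "p \<in> topspace X \<Longrightarrow> \<exists>c\<in>A. p \<in> dom_of c"
  using atlas by (auto simp: smooth_atlas_def)

lemma open_range: "c \<in> A \<Longrightarrow> open (range_of c)"
  using is_chart by (auto simp: is_chart_def range_of_def)

lemma homeo: "c \<in> A \<Longrightarrow> homeomorphic_map (subtopology X (dom_of c)) (top_of_set (range_of c)) (coord c)"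
  using is_chart by (auto simp: is_chart_def range_of_def)

lemma inj_coord: "c \<in> A \<Longrightarrow> inj_on (coord c) (dom_of c)"
  using homeomorphic_imp_injective_map[OF homeo] dom_subset by (metis topspace_subtopology_subset)

lemma param_coord: "c \<in> A \<Longrightarrow> p \<in> dom_of c \<Longrightarrow> param c (coord c p) = p"
  unfolding param_def using inj_coord inv_into_f_f by metis

lemma coord_param: "x \<in> range_of c \<Longrightarrow> coord c (param c x) = x"
  unfolding param_def range_of_def by (rule f_inv_into_f)

lemma param_in_dom: "x \<in> range_of c \<Longrightarrow> param c x \<in> dom_of c"
  unfolding param_def range_of_def by (rule inv_into_into)

lemma coord_in_range: "p \<in> dom_of c \<Longrightarrow> coord c p \<in> range_of c"
  by (simp add: range_of_def)

lemma continuous_coord: "c \<in> A \<Longrightarrow> continuous_map (subtopology X (dom_of c)) euclidean (coord c)"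
  using homeomorphic_imp_continuous_map[OF homeo] continuous_map_into_fulltopology by blast

lemma continuous_param:
  assumes "c \<in> A"
  shows "continuous_map (top_of_set (range_of c)) X (param c)"
proof -
  obtain h where h: "homeomorphic_maps (subtopology X (dom_of c)) (top_of_set (range_of c)) (coord c) h"
    using homeo[OF assms] homeomorphic_map_maps by blast
  then have "continuous_map (top_of_set (range_of c)) X h"
    by (simp add: homeomorphic_maps_def continuous_map_in_subtopology)
  moreover have "h x = param c x" if "x \<in> topspace (top_of_set (range_of c))" for x
  proof -
    have x: "x \<in> range_of c" using that by simp
    then have "h (coord c (param c x)) = param c x"
      using h param_in_dom[OF x] dom_subset[OF assms] by (auto simp: homeomorphic_maps_def)
    then show ?thesis using coord_param[OF x] by simp
  qed
  ultimately show ?thesis by (rule continuous_map_eq)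
qed

lemma openin_chart_preimage:
  assumes "c \<in> A" "open W"
  shows "openin X {p \<in> dom_of c. coord c p \<in> W}"
proof -
  have "openin (subtopology X (dom_of c)) {p \<in> topspace (subtopology X (dom_of c)). coord c p \<in> W}"
    using openin_continuous_map_preimage[OF continuous_coord[OF assms(1)]] assms(2) by simp
  then have "openin X {p \<in> topspace (subtopology X (dom_of c)). coord c p \<in> W}"
    using openin_trans_full openin_dom[OF assms(1)] by blast
  moreover have "{p \<in> topspace (subtopology X (dom_of c)). coord c p \<in> W} = {p \<in> dom_of c. coord c p \<in> W}"
    using dom_subset[OF assms(1)] by auto
  ultimately show ?thesis by simp
qed

lemma continuous_map_real_if_local:
  fixes h :: "'a \<Rightarrow> real"
  assumes "\<And>c. c \<in> A \<Longrightarrow> continuous_on (range_of c) (h \<circ> param c)"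
  shows "continuous_map X euclideanreal h"
  unfolding continuous_map_def
proof (intro conjI allI impI)
  fix V :: "real set" assume "openin euclideanreal V"
  then have V: "open V" by simp
  show "openin X {p \<in> topspace X. h p \<in> V}"
  proof (subst openin_subopen, intro ballI)
    fix p assume p: "p \<in> {p \<in> topspace X. h p \<in> V}"
    then obtain c where c: "c \<in> A" "p \<in> dom_of c" using chart_at by blast
    define W where "W = range_of c \<inter> (h \<circ> param c) -` V"
    have W: "open W"
      unfolding W_def by (rule continuous_open_preimage[OF assms[OF c(1)] open_range[OF c(1)] V])
    show "\<exists>T. openin X T \<and> p \<in> T \<and> T \<subseteq> {p \<in> topspace X. h p \<in> V}"
    proof (intro exI conjI)
      show "openin X {q \<in> dom_of c. coord c q \<in> W}" by (rule openin_chart_preimage[OF c(1) W])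
      show "p \<in> {q \<in> dom_of c. coord c q \<in> W}"
        using p c by (simp add: W_def param_coord coord_in_range)
      show "{q \<in> dom_of c. coord c q \<in> W} \<subseteq> {p \<in> topspace X. h p \<in> V}"
        using c(1) dom_subset[OF c(1)] by (auto simp: W_def param_coord)
    qed
  qed
qed auto

text \<open>Finite subcover and a maximum of constants. The predicate \<open>P C x\<close> may
  quantify over all frequencies and functions; the uniformity of every constant in the theorem comes
  from here.\<close>

lemma local_to_global:
  assumes local: "\<And>p. p \<in> topspace X \<Longrightarrow> \<exists>U C. openin X U \<and> p \<in> U \<and> (\<forall>x\<in>U. P C x)"
    and mono: "\<And>C D x. P C x \<Longrightarrow> C \<le> D \<Longrightarrow> P D x"
  shows "\<exists>C::real. \<forall>x\<in>topspace X. P C x"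
proof -
  obtain U C where UC: "\<And>p. p \<in> topspace X \<Longrightarrow> openin X (U p) \<and> p \<in> U p \<and> (\<forall>x\<in>U p. P (C p) x)"
    using local by metis
  have "compactin X (topspace X)" using compact by (simp add: compact_space_def)
  moreover have cover: "Ball (U ` topspace X) (openin X)" "topspace X \<subseteq> \<Union>(U ` topspace X)"
    using UC by auto
  ultimately obtain F where F: "finite F" "F \<subseteq> U ` topspace X" "topspace X \<subseteq> \<Union>F"
    using cover unfolding compactin_def by meson
  then obtain Q where Q: "finite Q" "Q \<subseteq> topspace X" "F = U ` Q"
    by (meson finite_subset_image)
  \<comment> \<open>Inserting 0 keeps \<open>Max\<close> meaningful when the cover is empty.\<close>
  have "P (Max (insert 0 (C ` Q))) x" if "x \<in> topspace X" for x
  proof -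
    obtain q where q: "q \<in> Q" "x \<in> U q" using F(3) \<open>x \<in> topspace X\<close> unfolding Q(3) by blast
    then have "P (C q) x" using UC Q(2) by blast
    moreover have "C q \<le> Max (insert 0 (C ` Q))" using q Q(1) by (intro Max_ge) auto
    ultimately show ?thesis by (rule mono)
  qed
  then show ?thesis by (intro exI ballI)
qed

lemma spd_g: "c \<in> A \<Longrightarrow> p \<in> dom_of c \<Longrightarrow> spd (g c p)"
  using metric by (auto simp: riemannian_metric_def spd_def)

lemma local_metric: "c \<in> A \<Longrightarrow> local_metric (range_of c) (local_g c)"
  using metric open_range spd_g param_in_dom
  by (unfold_locales) (auto simp: riemannian_metric_def range_of_def local_g_def[abs_def])

section \<open>Changes of charts and invariance of the squared gradient\<close>

definition transition :: "('a, 'n) chart \<Rightarrow> ('a, 'n) chart \<Rightarrow> real ^ 'n \<Rightarrow> real ^ 'n" where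
  "transition c d = coord d \<circ> param c"

definition transition_deriv :: "('a, 'n) chart \<Rightarrow> ('a, 'n) chart \<Rightarrow> 'a \<Rightarrow> real ^ 'n \<Rightarrow> real ^ 'n" where
  "transition_deriv c d p = frechet_derivative (transition c d) (at (coord c p))"

lemma smooth_transition:
  "c \<in> A \<Longrightarrow> d \<in> A \<Longrightarrow> smooth_on (coord c ` (dom_of c \<inter> dom_of d)) (transition c d)"
  using atlas by (simp add: smooth_atlas_def transition_def)

lemma transition_has_derivative:
  assumes "c \<in> A" "d \<in> A" "p \<in> dom_of c" "p \<in> dom_of d"
  shows "(transition c d has_derivative transition_deriv c d p) (at (coord c p))"
  using smooth_on_differentiable[OF smooth_transition[OF assms(1,2)], of "coord c p"] assms(3,4)
  by (auto simp: transition_deriv_def frechet_derivative_works)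

lemma metric_transition:
  assumes "c \<in> A" "d \<in> A" "p \<in> dom_of c" "p \<in> dom_of d"
  shows "v \<bullet> (g c p *v v) = transition_deriv c d p v \<bullet> (g d p *v transition_deriv c d p v)"
proof -
  define J where "J = matrix (transition_deriv c d p)"
  have "\<forall>c\<in>A. \<forall>d\<in>A. \<forall>p\<in>dom_of c \<inter> dom_of d.
      let J = matrix (frechet_derivative (coord d \<circ> param c) (at (coord c p)))
      in g c p = transpose J ** g d p ** J"
    using metric unfolding riemannian_metric_def by (elim conjE)
  then have "g c p = transpose J ** g d p ** J"
    unfolding J_def transition_deriv_def transition_def Let_def using assms by blast
  moreover have "J *v v = transition_deriv c d p v" for v
    unfolding J_def using has_derivative_linear[OF transition_has_derivative[OF assms]]
    by (simp add: matrix_works)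
  moreover have "v \<bullet> (transpose J *v w) = (J *v v) \<bullet> w" for w
    by (metis dot_lmul_matrix inner_commute transpose_matrix_vector)
  ultimately show ?thesis
    by (simp only: matrix_vector_mul_assoc[symmetric])
qed

lemma smooth_function_local: "smooth_function A e \<Longrightarrow> c \<in> A \<Longrightarrow> smooth_on (range_of c) (e \<circ> param c)"
  by (simp add: smooth_function_def range_of_def)

text \<open>These are the components of the differential, a covector rather than the gradient
  vector; hence \<open>grad_sq\<close> contracts it with the inverse of the metric.\<close>

definition gradient :: "('a \<Rightarrow> real) \<Rightarrow> ('a, 'n) chart \<Rightarrow> 'a \<Rightarrow> real ^ 'n" where
  "gradient e c p = (\<chi> i. partial_deriv i (e \<circ> param c) (coord c p))"

definition grad_sq :: "('a \<Rightarrow> real) \<Rightarrow> ('a, 'n) chart \<Rightarrow> 'a \<Rightarrow> real" where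
  "grad_sq e c p = gradient e c p \<bullet> (matrix_inv (g c p) *v gradient e c p)"

lemma function_has_derivative:
  assumes "smooth_function A e" "c \<in> A" "p \<in> dom_of c"
  shows "(e \<circ> param c has_derivative (\<lambda>v. gradient e c p \<bullet> v)) (at (coord c p))"
proof -
  have "(e \<circ> param c has_derivative (\<lambda>v. \<Sum>i\<in>UNIV. v $ i * partial_deriv i (e \<circ> param c) (coord c p))) (at (coord c p))"
    by (intro has_derivative_partial_deriv smooth_on_differentiable[OF smooth_function_local[OF assms(1,2)]]
        coord_in_range assms)
  then show ?thesis by (simp add: gradient_def inner_vec_def mult.commute)
qed

lemma open_overlap: "c \<in> A \<Longrightarrow> d \<in> A \<Longrightarrow> open (coord c ` (dom_of c \<inter> dom_of d))"
proof -
  assume cd: "c \<in> A" "d \<in> A"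
  have "openin (subtopology X (dom_of c)) (dom_of c \<inter> dom_of d)"
    unfolding openin_subtopology using openin_dom[OF cd(2)] by (intro exI[of _ "dom_of d"]) auto
  then have "openin (top_of_set (range_of c)) (coord c ` (dom_of c \<inter> dom_of d))"
    using homeomorphic_imp_open_map[OF homeo[OF cd(1)]] by (simp add: open_map_def)
  then show ?thesis using open_range[OF cd(1)] openin_open_trans by blast
qed

lemma gradient_transition:
  assumes "smooth_function A e" "c \<in> A" "d \<in> A" "p \<in> dom_of c" "p \<in> dom_of d"
  shows "gradient e c p \<bullet> v = gradient e d p \<bullet> transition_deriv c d p v"
proof -
  have tp: "transition c d (coord c p) = coord d p"
    using assms by (simp add: transition_def param_coord)
  have "((e \<circ> param d) \<circ> transition c d has_derivative (\<lambda>v. gradient e d p \<bullet> v) \<circ> transition_deriv c d p) (at (coord c p))"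
    by (rule diff_chain_at[OF transition_has_derivative[OF assms(2-5)]])
      (simp add: tp function_has_derivative[OF assms(1,3,5)])
  then have "(e \<circ> param c has_derivative (\<lambda>v. gradient e d p \<bullet> v) \<circ> transition_deriv c d p) (at (coord c p))"
  proof (rule has_derivative_transform_within_open)
    show "open (coord c ` (dom_of c \<inter> dom_of d))" by (rule open_overlap[OF assms(2,3)])
    show "coord c p \<in> coord c ` (dom_of c \<inter> dom_of d)" using assms by simp
    show "((e \<circ> param d) \<circ> transition c d) x = (e \<circ> param c) x"
      if "x \<in> coord c ` (dom_of c \<inter> dom_of d)" for x
      using that assms by (auto simp: transition_def param_coord)
  qed
  from has_derivative_unique[OF function_has_derivative[OF assms(1,2,4)] this]
  show ?thesis by (simp add: fun_eq_iff)
qed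

text \<open>The variational formula \<open>w \<bullet> B\<^sup>-\<^sup>1 w = max\<^sub>v (2 w \<bullet> v - v \<bullet> B v)\<close> avoids inverting the Jacobian.\<close>

lemma grad_sq_le_chart:
  assumes "smooth_function A e" "c \<in> A" "d \<in> A" "p \<in> dom_of c" "p \<in> dom_of d"
  shows "grad_sq e c p \<le> grad_sq e d p"
proof -
  define v where "v = matrix_inv (g c p) *v gradient e c p"
  have "grad_sq e c p = 2 * (gradient e c p \<bullet> v) - v \<bullet> (g c p *v v)"
    unfolding v_def grad_sq_def using spd_dual_attained[OF spd_g[OF assms(2,4)]] by simp
  also have "\<dots> \<le> grad_sq e d p"
    unfolding gradient_transition[OF assms] metric_transition[OF assms(2-5)] grad_sq_def
    by (rule spd_dual_bound[OF spd_g[OF assms(3,5)]])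
  finally show ?thesis .
qed

lemma grad_sq_chart_independent:
  assumes "smooth_function A e" "c \<in> A" "d \<in> A" "p \<in> dom_of c" "p \<in> dom_of d"
  shows "grad_sq e c p = grad_sq e d p"
  using grad_sq_le_chart assms by (intro antisym) blast+

lemma grad_sq_param:
  assumes "x \<in> range_of c"
  shows "grad_sq e c (param c x) = (\<Sum>i\<in>UNIV. \<Sum>j\<in>UNIV. dual_metric (local_g c) i j x *
    partial_deriv i (e \<circ> param c) x * partial_deriv j (e \<circ> param c) x)"
  by (simp add: grad_sq_def inner_matrix_vector_sum gradient_def dual_metric_def local_g_def coord_param[OF assms])

lemma laplacian_local:
  assumes "smooth_function A e" "has_laplacian A g e h" "c \<in> A" "x \<in> range_of c"
  shows "second_order (dual_metric (local_g c)) (e \<circ> param c) x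
      + first_order (drift (local_g c)) (e \<circ> param c) x = - h (param c x)"
proof -
  interpret local_metric "range_of c" "local_g c" by (rule local_metric[OF assms(3)])
  have "laplacian_in_chart g c e (param c x) = h (param c x)"
    using assms(2,3) param_in_dom[OF assms(4)] by (simp add: has_laplacian_def)
  then show ?thesis
    unfolding laplacian_in_chart_def Let_def coord_param[OF assms(4)]
    using divergence_form_expand[OF smooth_function_local[OF assms(1,3)] assms(4)]
    by (simp add: local_g_def dual_metric_def minus_divide_left[symmetric])
qed


section \<open>The Bernstein estimate on the whole manifold\<close>

lemma attains_max:
  fixes h :: "'a \<Rightarrow> real"
  assumes "continuous_map X euclideanreal h" "topspace X \<noteq> {}"
  shows "\<exists>p\<in>topspace X. \<forall>q\<in>topspace X. h q \<le> h p"
proof -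
  have "compactin X (topspace X)" using compact by (simp add: compact_space_def)
  then have "compact (h ` topspace X)"
    using image_compactin[OF _ assms(1)] by simp
  then show ?thesis using compact_attains_sup[of "h ` topspace X"] assms(2) by auto
qed

lemma continuous_smooth_function: "smooth_function A e \<Longrightarrow> continuous_map X euclideanreal e"
  by (intro continuous_map_real_if_local smooth_on_continuous_on smooth_function_local)

lemma chart_ball:
  assumes p: "p \<in> topspace X"
  obtains c r \<alpha> N where "c \<in> A" "p \<in> dom_of c" "0 < r" "r \<le> 1" "cball (coord c p) r \<subseteq> range_of c"
    "\<alpha> > 0" "N \<ge> 1" "\<And>y. y \<in> cball (coord c p) r \<Longrightarrow> coeff_bound (local_g c) \<alpha> N y"
proof -
  obtain c where c: "c \<in> A" "p \<in> dom_of c" using chart_at[OF p] by blast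
  interpret L: local_metric "range_of c" "local_g c" by (rule local_metric[OF c(1)])
  obtain s where s: "s > 0" "cball (coord c p) s \<subseteq> range_of c"
    using open_contains_cball L.open_U coord_in_range[OF c(2)] by blast
  define r where "r = min s 1"
  have r: "0 < r" "r \<le> 1" "cball (coord c p) r \<subseteq> range_of c" using s by (auto simp: r_def subset_iff)
  show thesis
    using L.compact_coeff_bound[OF compact_cball r(3)] that[OF c r] by blast
qed

text \<open>The last clause amounts to \<open>e \<ge> - k / 2\<close>. It holds for
  \<open>k = - 2 * min e\<close> when the minimum is negative, and for every \<open>k > 0\<close>
  when \<open>e\<close> is nonnegative; both uses occur.\<close>

definition admissible_shift :: "real \<Rightarrow> ('a \<Rightarrow> real) \<Rightarrow> real \<Rightarrow> bool" where
  "admissible_shift M e k \<longleftrightarrow> M \<ge> 0 \<and> smooth_function A e \<and> has_laplacian A g e (\<lambda>q. M * e q) \<and>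
    k > 0 \<and> (\<forall>q\<in>topspace X. k \<le> 2 * (e q + k))"

text \<open>\<open>log_grad_sq e k c x\<close> is \<open>\<bar>\<nabla> ln (e + k)\<bar>\<^sup>2\<close> at \<open>x\<close>.\<close>

definition log_grad_sq :: "('a \<Rightarrow> real) \<Rightarrow> real \<Rightarrow> ('a, 'n) chart \<Rightarrow> 'a \<Rightarrow> real" where
  "log_grad_sq e k c x = grad_sq e c x / (e x + k)\<^sup>2"

text \<open>Maximality ranges over all charts, so that by chart independence it can be read in
  whichever chart carries the coefficient bounds.\<close>

definition log_grad_max :: "('a \<Rightarrow> real) \<Rightarrow> real \<Rightarrow> ('a, 'n) chart \<Rightarrow> 'a \<Rightarrow> bool" where
  "log_grad_max e k c x \<longleftrightarrow> c \<in> A \<and> x \<in> dom_of c \<and>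
    (\<forall>d\<in>A. \<forall>q\<in>dom_of d. log_grad_sq e k d q \<le> log_grad_sq e k c x)"

text \<open>Constants come from a coordinate ball around \<open>p\<close>, before \<open>M\<close>,
  \<open>e\<close> and \<open>k\<close> are given; the estimate is claimed only at those
  \<open>x\<close> near \<open>p\<close> that happen to be global maximum points.\<close>

lemma gradient_estimate_local:
  assumes p: "p \<in> topspace X"
  shows "\<exists>U C. openin X U \<and> p \<in> U \<and> (\<forall>x\<in>U. \<forall>M e k c. admissible_shift M e k \<longrightarrow>
    log_grad_max e k c x \<longrightarrow> log_grad_sq e k c x \<le> C * (1 + M))"
proof -
  obtain c0 r \<alpha> N where c0: "c0 \<in> A" "p \<in> dom_of c0" and r: "r > 0" "cball (coord c0 p) r \<subseteq> range_of c0"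
    and \<alpha>: "\<alpha> > 0" and N: "N \<ge> 1" and cb: "\<And>y. y \<in> cball (coord c0 p) r \<Longrightarrow> coeff_bound (local_g c0) \<alpha> N y"
    by (rule chart_ball[OF p]) (rule that)
  interpret L: local_metric "range_of c0" "local_g c0" by (rule local_metric[OF c0(1)])
  let ?K = "cball (coord c0 p) r"
  define n where "n = real CARD('n)"
  \<comment> \<open>The factor \<open>n\<^sup>2 * N\<close> converts the Euclidean bound on the
    partial derivatives of \<open>ln u\<close> into one for the inverse metric.\<close>
  define C where "C = n\<^sup>2 * (N * bernstein_const CARD('n) \<alpha> N)"
  show ?thesis
  proof (intro exI[of _ "{q \<in> dom_of c0. coord c0 q \<in> ball (coord c0 p) r}"] exI[of _ C] conjI ballI allI impI)
    show "openin X {q \<in> dom_of c0. coord c0 q \<in> ball (coord c0 p) r}"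
      by (rule openin_chart_preimage[OF c0(1) open_ball])
    show "p \<in> {q \<in> dom_of c0. coord c0 q \<in> ball (coord c0 p) r}" using c0 r by simp
    fix x M e k c
    assume x: "x \<in> {q \<in> dom_of c0. coord c0 q \<in> ball (coord c0 p) r}"
      and adm: "admissible_shift M e k" and lm: "log_grad_max e k c x"
    from adm have M: "0 \<le> M" and e: "smooth_function A e" "has_laplacian A g e (\<lambda>q. M * e q)" and k: "0 < k"
      and ek: "\<forall>q\<in>topspace X. k \<le> 2 * (e q + k)" by (simp_all add: admissible_shift_def)
    from lm have c: "c \<in> A" "x \<in> dom_of c"
      and max: "\<forall>d\<in>A. \<forall>q\<in>dom_of d. grad_sq e d q / (e q + k)\<^sup>2 \<le> grad_sq e c x / (e x + k)\<^sup>2"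
      unfolding log_grad_max_def log_grad_sq_def by blast+
    define y where "y = coord c0 x"
    define w where "w = e \<circ> param c0"
    define u where "u z = w z + k" for z
    have y: "y \<in> ?K" "y \<in> range_of c0" "param c0 y = x"
      using x r c0 by (auto simp: y_def param_coord coord_in_range)
    note B = coeff_boundD[OF cb[OF y(1)]]
    have sw: "smooth_on (range_of c0) w" unfolding w_def by (rule smooth_function_local[OF e(1) c0(1)])
    have su: "smooth_on (range_of c0) u"
      unfolding u_def by (intro smooth_on_add L.open_U sw smooth_on_const)
    have Du: "partial_deriv i u z = partial_deriv i w z" if "z \<in> range_of c0" for i z
      unfolding u_def using smooth_on_differentiable[OF sw that] by (simp add: partial_deriv_add)
    have DDu: "partial_deriv j (partial_deriv i u) z = partial_deriv j (partial_deriv i w) z"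
      if "z \<in> range_of c0" for i j z
      by (rule partial_deriv_cong[OF L.open_U that Du])
    have Fz: "(\<Sum>i\<in>UNIV. \<Sum>j\<in>UNIV. dual_metric (local_g c0) i j z * (partial_deriv i u z / u z) * (partial_deriv j u z / u z))
        = grad_sq e c0 (param c0 z) / (e (param c0 z) + k)\<^sup>2" if "z \<in> range_of c0" for z
      using that by (simp add: grad_sq_param Du w_def[symmetric] u_def sum_divide_distrib power2_eq_square)
        (simp add: w_def)
    have xx: "grad_sq e c x = grad_sq e c0 x"
      using x c c0 by (intro grad_sq_chart_independent[OF e(1)]) auto
    have main: "(\<Sum>i\<in>UNIV. (partial_deriv i u y / u y)\<^sup>2) \<le> bernstein_const CARD('n) \<alpha> N * (1 + M)"
    proof (rule gradient_estimate_at_max[OF L.open_U L.smooth_dual_metric L.smooth_drift su y(2) L.dual_metric_sym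
          \<alpha> B(1) N B(2-6) M k])
      show "k \<le> 2 * u z" if "z \<in> range_of c0" for z
        using ek param_in_dom[OF that] dom_subset[OF c0(1)] by (auto simp: u_def w_def)
      show "second_order (dual_metric (local_g c0)) u z
        + first_order (drift (local_g c0)) u z = - M * (u z - k)" if "z \<in> range_of c0" for z
        using laplacian_local[OF e c0(1) that] that by (simp add: Du DDu w_def[symmetric] u_def) (simp add: w_def)
      show "(\<Sum>i\<in>UNIV. \<Sum>j\<in>UNIV. dual_metric (local_g c0) i j z * (partial_deriv i u z / u z) * (partial_deriv j u z / u z))
        \<le> (\<Sum>i\<in>UNIV. \<Sum>j\<in>UNIV. dual_metric (local_g c0) i j y * (partial_deriv i u y / u y) * (partial_deriv j u y / u y))"
        if "z \<in> range_of c0" for z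
        unfolding Fz[OF that] Fz[OF y(2)] y(3) xx[symmetric]
        using max c0(1) param_in_dom[OF that] by blast
    qed
    define P where "P = sqrt (\<Sum>i\<in>UNIV. (partial_deriv i u y / u y)\<^sup>2)"
    have P: "\<bar>partial_deriv i u y / u y\<bar> \<le> P" for i
    proof -
      have "(partial_deriv i u y / u y)\<^sup>2 \<le> (\<Sum>i\<in>UNIV. (partial_deriv i u y / u y)\<^sup>2)"
        by (rule member_le_sum) auto
      then show ?thesis unfolding P_def by (intro real_le_rsqrt) (simp only: power2_abs)
    qed
    have P2: "P * P = (\<Sum>i\<in>UNIV. (partial_deriv i u y / u y)\<^sup>2)"
      unfolding P_def by (simp add: sum_nonneg)
    have "\<bar>\<Sum>i\<in>UNIV. \<Sum>j\<in>UNIV. dual_metric (local_g c0) i j y * (partial_deriv i u y / u y) * (partial_deriv j u y / u y)\<bar>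
        \<le> n\<^sup>2 * (N * P * P)"
      unfolding n_def using P B(2) by (intro abs_double_sum_le_card abs_mult_le)
    then have "grad_sq e c0 x / (e x + k)\<^sup>2 \<le> n\<^sup>2 * (N * P * P)"
      unfolding Fz[OF y(2)] y(3) by (rule abs_le_D1)
    then have "grad_sq e c0 x / (e x + k)\<^sup>2 \<le> n\<^sup>2 * (N * (P * P))"
      by (simp only: mult.assoc)
    also have "\<dots> \<le> n\<^sup>2 * (N * (bernstein_const CARD('n) \<alpha> N * (1 + M)))"
      using main N unfolding P2 by (intro mult_left_mono) auto
    finally show "log_grad_sq e k c x \<le> C * (1 + M)"
      unfolding log_grad_sq_def xx by (simp add: C_def mult.assoc)
  qed
qed

text \<open>The squared gradient of \<open>ln (e + k)\<close> attains its maximum by compactness;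
  the local estimate applies at that point and bounds the value everywhere.\<close>

lemma gradient_estimate:
  "\<exists>C>0. \<forall>M e k. admissible_shift M e k \<longrightarrow>
    (\<forall>c\<in>A. \<forall>x\<in>dom_of c. grad_sq e c x \<le> C * (1 + M) * (e x + k)\<^sup>2)"
proof -
  let ?P = "\<lambda>C x. \<forall>M e k c. admissible_shift M e k \<longrightarrow> log_grad_max e k c x \<longrightarrow>
    log_grad_sq e k c x \<le> C * (1 + M)"
  have mono: "?P D x" if P: "?P C x" and "C \<le> D" for C D x
  proof (intro allI impI)
    fix M e k c
    assume a: "admissible_shift M e k" "log_grad_max e k c x"
    have "C * (1 + M) \<le> D * (1 + M)"
      using a(1) \<open>C \<le> D\<close> by (intro mult_right_mono) (auto simp: admissible_shift_def)
    with P[rule_format, OF a] show "log_grad_sq e k c x \<le> D * (1 + M)" by linarith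
  qed
  have "\<exists>C. \<forall>x\<in>topspace X. ?P C x"
    by (rule local_to_global[of ?P, OF gradient_estimate_local mono])
  then obtain C where C: "\<And>x. x \<in> topspace X \<Longrightarrow> ?P C x" by blast
  show ?thesis
  proof (intro exI[of _ "max C 1"] conjI allI impI ballI)
    fix M e k c x
    assume adm: "admissible_shift M e k" and c: "c \<in> A" "x \<in> dom_of c"
    from adm have M: "0 \<le> M" and e: "smooth_function A e" "has_laplacian A g e (\<lambda>q. M * e q)" and k: "0 < k"
      and ek: "\<forall>q\<in>topspace X. k \<le> 2 * (e q + k)" by (simp_all add: admissible_shift_def)
    \<comment> \<open>Choosing a chart at each point turns the chart-dependent expression into one
      function \<open>F\<close> on the manifold, continuous because the choice does not affect its
      value.\<close>
    define ch where "ch q = (SOME c. c \<in> A \<and> q \<in> dom_of c)" for q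
    have ch: "ch q \<in> A" "q \<in> dom_of (ch q)" if "q \<in> topspace X" for q
      using chart_at[OF that] someI_ex[of "\<lambda>c. c \<in> A \<and> q \<in> dom_of c"] by (auto simp: ch_def)
    define F where "F q = grad_sq e (ch q) q / (e q + k)\<^sup>2" for q
    have F: "F q = grad_sq e d q / (e q + k)\<^sup>2" if "d \<in> A" "q \<in> dom_of d" for d q
      using grad_sq_chart_independent[OF e(1) that(1) ch(1) that(2) ch(2)] dom_subset that
      unfolding F_def by (metis subset_iff)
    have pos: "e q + k > 0" if "q \<in> topspace X" for q using ek k that by fastforce
    have xX: "x \<in> topspace X" using c dom_subset[OF c(1)] by blast
    have contF: "continuous_map X euclideanreal F"
    proof (rule continuous_map_real_if_local)
      fix d assume d: "d \<in> A"
      interpret L: local_metric "range_of d" "local_g d" by (rule local_metric[OF d])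
      note se = smooth_function_local[OF e(1) d]
      have ne: "e (param d z) + k \<noteq> 0" if "z \<in> range_of d" for z
        using pos[of "param d z"] param_in_dom[OF that] dom_subset[OF d] by (metis less_irrefl subsetD)
      have "continuous_on (range_of d) (\<lambda>z. (\<Sum>i\<in>UNIV. \<Sum>j\<in>UNIV. dual_metric (local_g d) i j z *
          partial_deriv i (e \<circ> param d) z * partial_deriv j (e \<circ> param d) z) / ((e \<circ> param d) z + k)\<^sup>2)"
        using smooth_on_continuous_on[OF L.smooth_dual_metric] smooth_on_continuous_on[OF se]
          smooth_on_continuous_on[OF smooth_on_partial_deriv[OF se]] ne
        by (intro continuous_intros) auto
      then show "continuous_on (range_of d) (F \<circ> param d)"
        by (rule continuous_on_eq) (simp add: F[OF d param_in_dom] grad_sq_param)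
    qed
    have "topspace X \<noteq> {}" using xX by blast
    from attains_max[OF contF this]
    obtain p where p: "p \<in> topspace X" "\<And>q. q \<in> topspace X \<Longrightarrow> F q \<le> F p"
      by blast
    have "log_grad_sq e k d q \<le> log_grad_sq e k (ch p) p" if "d \<in> A" "q \<in> dom_of d" for d q
      using p(2)[of q] that dom_subset[OF that(1)] F[OF that] by (auto simp: F_def log_grad_sq_def)
    then have "log_grad_max e k (ch p) p"
      unfolding log_grad_max_def using ch[OF p(1)] by blast
    from C[OF p(1), rule_format, OF adm this] have "F p \<le> C * (1 + M)"
      by (simp add: F_def log_grad_sq_def)
    then have "F x \<le> C * (1 + M)"
      using p(2)[OF xX] by linarith
    also have "\<dots> \<le> max C 1 * (1 + M)" using M by (intro mult_right_mono) auto
    finally show "grad_sq e c x \<le> max C 1 * (1 + M) * (e x + k)\<^sup>2"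
      unfolding F[OF c] using pos[OF xX] by (simp add: pos_divide_le_eq)
  qed simp
qed

section \<open>Curves seen through charts\<close>

lemma path_in_topspace: "pathin X \<gamma> \<Longrightarrow> t \<in> {0..1} \<Longrightarrow> \<gamma> t \<in> topspace X"
  by (auto simp: pathin_def continuous_map_def)

lemma openin_path_preimage:
  assumes "pathin X \<gamma>" "c \<in> A"
  shows "openin (top_of_set {0..1}) {t \<in> {0..1}. \<gamma> t \<in> dom_of c}"
  using openin_continuous_map_preimage[OF assms(1)[unfolded pathin_def] openin_dom[OF assms(2)]] by simp

lemma eventually_in_chart:
  assumes "pathin X \<gamma>" "c \<in> A" "T \<subseteq> {0..1}" "t \<in> T" "\<gamma> t \<in> dom_of c"
  shows "eventually (\<lambda>s. \<gamma> s \<in> dom_of c) (at t within T)"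
proof -
  obtain W where W: "open W" "{t \<in> {0..1}. \<gamma> t \<in> dom_of c} = {0..1} \<inter> W"
    using openin_path_preimage[OF assms(1,2)] unfolding openin_open by blast
  have "t \<in> W" using W(2) assms(3-5) by blast
  then have "eventually (\<lambda>s. s \<in> W \<and> s \<in> T) (at t within T)"
    using W(1) by (auto simp: eventually_at_topological)
  then show ?thesis using W(2) assms(3) by (auto elim!: eventually_mono)
qed

lemma vector_derivative_transition:
  assumes "pathin X \<gamma>" "c \<in> A" "d \<in> A" "T \<subseteq> {0..1}" "t \<in> T" "\<gamma> t \<in> dom_of c" "\<gamma> t \<in> dom_of d"
    and v: "((coord c \<circ> \<gamma>) has_vector_derivative v) (at t within T)"
  shows "((coord d \<circ> \<gamma>) has_vector_derivative transition_deriv c d (\<gamma> t) v) (at t within T)"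
proof -
  let ?J = "transition_deriv c d (\<gamma> t)"
  have tr: "(transition c d has_derivative ?J) (at ((coord c \<circ> \<gamma>) t))"
    using transition_has_derivative[OF assms(2,3,6,7)] by simp
  have "(transition c d \<circ> (coord c \<circ> \<gamma>) has_derivative ?J \<circ> (\<lambda>s. s *\<^sub>R v)) (at t within T)"
    by (rule diff_chain_within[OF v[unfolded has_vector_derivative_def] has_derivative_at_withinI[OF tr]])
  moreover have "?J \<circ> (\<lambda>s. s *\<^sub>R v) = (\<lambda>s. s *\<^sub>R ?J v)"
    using has_derivative_linear[OF tr] by (simp add: fun_eq_iff linear_scale)
  ultimately have "(transition c d \<circ> (coord c \<circ> \<gamma>) has_vector_derivative ?J v) (at t within T)"
    by (simp add: has_vector_derivative_def)
  then show ?thesis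
    unfolding has_vector_derivative_def
  proof (rule has_derivative_transform_eventually)
    show "eventually (\<lambda>s. (transition c d \<circ> (coord c \<circ> \<gamma>)) s = (coord d \<circ> \<gamma>) s) (at t within T)"
      using eventually_in_chart[OF assms(1,2,4,5,6)]
      by eventually_elim (simp add: transition_def param_coord[OF assms(2)])
  qed (use assms in \<open>simp_all add: transition_def param_coord\<close>)
qed

section \<open>Lengths of curves\<close>


lemma some_chart:
  assumes "p \<in> topspace X"
  defines "c \<equiv> SOME c. c \<in> A \<and> p \<in> dom_of c"
  shows "c \<in> A" "p \<in> dom_of c"
  using chart_at[OF assms(1)] someI_ex[of "\<lambda>c. c \<in> A \<and> p \<in> dom_of c"] by (auto simp: c_def)

text \<open>\<open>speed\<close> uses a chosen chart and the derivative within the unit interval. At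
  an interior point of a piece the latter equals the derivative within the piece, and
  \<open>metric_transition\<close> absorbs the choice of chart.\<close>

lemma speed_eq:
  assumes \<gamma>: "pathin X \<gamma>" and ab: "0 \<le> a" "b \<le> 1" "a < t" "t < b" and c: "c \<in> A" "\<gamma> t \<in> dom_of c"
    and v: "((coord c \<circ> \<gamma>) has_vector_derivative v) (at t within {a..b})"
  shows "speed A g \<gamma> t = sqrt (v \<bullet> (g c (\<gamma> t) *v v))"
proof -
  define d where "d = (SOME c. c \<in> A \<and> \<gamma> t \<in> dom_of c)"
  have t: "t \<in> {0..1}" "0 < t" "t < 1" using ab by auto
  have d: "d \<in> A" "\<gamma> t \<in> dom_of d"
    using some_chart[OF path_in_topspace[OF \<gamma> t(1)]] by (simp_all add: d_def)
  have "((coord c \<circ> \<gamma>) has_vector_derivative v) (at t)"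
    using v at_within_Icc_at[OF ab(3,4)] by simp
  then have "((coord c \<circ> \<gamma>) has_vector_derivative v) (at t within {0..1})"
    by (rule has_vector_derivative_at_within)
  from vector_derivative_transition[OF \<gamma> c(1) d(1) _ t(1) c(2) d(2) this]
  have "((coord d \<circ> \<gamma>) has_vector_derivative transition_deriv c d (\<gamma> t) v) (at t within {0..1})" by simp
  then have "vector_derivative (coord d \<circ> \<gamma>) (at t within {0..1}) = transition_deriv c d (\<gamma> t) v"
    using t by (intro vector_derivative_within_closed_interval) auto
  then show ?thesis
    unfolding speed_def Let_def d_def[symmetric] metric_transition[OF c(1) d(1) c(2) d(2)] by simp
qed

lemma speed_nonneg: "pathin X \<gamma> \<Longrightarrow> t \<in> {0..1} \<Longrightarrow> 0 \<le> speed A g \<gamma> t"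
  unfolding speed_def Let_def using some_chart[OF path_in_topspace]
  by (intro real_sqrt_ge_zero spd_form_nonneg spd_g)

lemma C1_curve_onD:
  assumes "C1_curve_on A T \<gamma>" "c \<in> A"
  obtains D where "continuous_on {t \<in> T. \<gamma> t \<in> dom_of c} D"
    "\<And>t. t \<in> T \<Longrightarrow> \<gamma> t \<in> dom_of c \<Longrightarrow> ((coord c \<circ> \<gamma>) has_vector_derivative D t) (at t within T)"
  using bspec[OF assms(1)[unfolded C1_curve_on_def] assms(2)] by blast

text \<open>At a break point the derivative within the unit interval may not exist. The comparison
  function \<open>s\<close> uses derivatives within \<open>{a..b}\<close>, is continuous up to the
  ends, and differs from \<open>speed\<close> at most there.\<close>

lemma speed_integrable_on_piece:
  assumes \<gamma>: "pathin X \<gamma>" and ab: "0 \<le> a" "a < b" "b \<le> 1" and C1: "C1_curve_on A {a..b} \<gamma>"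
  shows "speed A g \<gamma> integrable_on {a..b}"
proof -
  have sub: "{a..b} \<subseteq> {0..1}" using ab by auto
  define ch where "ch t = (SOME c. c \<in> A \<and> \<gamma> t \<in> dom_of c)" for t
  have ch: "ch t \<in> A" "\<gamma> t \<in> dom_of (ch t)" if "t \<in> {a..b}" for t
    using some_chart[OF path_in_topspace[OF \<gamma>]] that sub by (auto simp: ch_def)
  define w where "w t = vector_derivative (coord (ch t) \<circ> \<gamma>) (at t within {a..b})" for t
  define s where "s t = sqrt (w t \<bullet> (g (ch t) (\<gamma> t) *v w t))" for t
  have s: "s t = sqrt (v \<bullet> (g d (\<gamma> t) *v v))"
    if t: "t \<in> {a..b}" and d: "d \<in> A" "\<gamma> t \<in> dom_of d"
      and v: "((coord d \<circ> \<gamma>) has_vector_derivative v) (at t within {a..b})" for t d v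
  proof -
    have "w t = transition_deriv d (ch t) (\<gamma> t) v"
      unfolding w_def
      using vector_derivative_transition[OF \<gamma> d(1) ch(1)[OF t] sub t d(2) ch(2)[OF t] v] t ab
      by (intro vector_derivative_within_closed_interval) auto
    then show ?thesis
      by (simp add: s_def metric_transition[OF d(1) ch(1)[OF t] d(2) ch(2)[OF t]])
  qed
  have "continuous_on {a..b} s"
    unfolding continuous_on_eq_continuous_within
  proof
    fix t0 assume t0: "t0 \<in> {a..b}"
    let ?c = "ch t0"
    note c = ch[OF t0]
    define Tc where "Tc = {t \<in> {a..b}. \<gamma> t \<in> dom_of ?c}"
    obtain D where D: "continuous_on Tc D"
      "\<And>t. t \<in> {a..b} \<Longrightarrow> \<gamma> t \<in> dom_of ?c \<Longrightarrow> ((coord ?c \<circ> \<gamma>) has_vector_derivative D t) (at t within {a..b})"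
      using C1_curve_onD[OF C1 c(1)] unfolding Tc_def by metis
    interpret L: local_metric "range_of ?c" "local_g ?c" by (rule local_metric[OF c(1)])
    have "continuous (at t within Tc) (coord ?c \<circ> \<gamma>)" if "t \<in> Tc" for t
    proof (rule continuous_within_subset)
      show "continuous (at t within {a..b}) (coord ?c \<circ> \<gamma>)"
        using that by (intro has_vector_derivative_continuous[OF D(2)]) (auto simp: Tc_def)
    qed (auto simp: Tc_def)
    then have cc: "continuous_on Tc (coord ?c \<circ> \<gamma>)"
      unfolding continuous_on_eq_continuous_within by blast
    have cg: "continuous_on Tc (\<lambda>t. local_g ?c ((coord ?c \<circ> \<gamma>) t) $ i $ j)" for i j
      using smooth_on_continuous_on[OF L.smooth_entry] cc
      by (rule continuous_on_compose2) (auto simp: Tc_def coord_in_range)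
    have "continuous_on Tc (\<lambda>t. sqrt (\<Sum>i\<in>UNIV. \<Sum>j\<in>UNIV.
        local_g ?c ((coord ?c \<circ> \<gamma>) t) $ i $ j * D t $ i * D t $ j))"
      by (intro continuous_intros cg D(1))
    then have "continuous_on Tc s"
    proof (rule continuous_on_eq)
      fix t assume t: "t \<in> Tc"
      then show "sqrt (\<Sum>i\<in>UNIV. \<Sum>j\<in>UNIV. local_g ?c ((coord ?c \<circ> \<gamma>) t) $ i $ j * D t $ i * D t $ j) = s t"
        using s[OF _ c(1) _ D(2), of t] by (simp add: Tc_def inner_matrix_vector_sum local_g_def param_coord[OF c(1)])
    qed
    moreover have "t0 \<in> Tc" using t0 c by (simp add: Tc_def)
    ultimately have "continuous (at t0 within Tc) s"
      by (simp add: continuous_on_eq_continuous_within)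
    moreover have "at t0 within Tc = at t0 within {a..b}"
    proof -
      obtain W where W: "open W" "{t \<in> {0..1}. \<gamma> t \<in> dom_of ?c} = {0..1} \<inter> W"
        using openin_path_preimage[OF \<gamma> c(1)] unfolding openin_open by blast
      have TW: "Tc = {a..b} \<inter> W"
        unfolding Tc_def using W(2) sub by blast
      show ?thesis
        using \<open>t0 \<in> Tc\<close> W(1) unfolding TW by (intro at_within_nhd[of _ W]) auto
    qed
    ultimately show "continuous (at t0 within {a..b}) s" by simp
  qed
  then have "s integrable_on {a..b}" by (rule integrable_continuous_real)
  then show ?thesis
  proof (rule integrable_spike_finite[of "{a, b}", rotated 2])
    fix t assume "t \<in> {a..b} - {a, b}"
    then have t: "t \<in> {a..b}" "a < t" "t < b" by auto
    obtain v where v: "((coord (ch t) \<circ> \<gamma>) has_vector_derivative v) (at t within {a..b})"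
      using C1_curve_onD[OF C1 ch(1)[OF t(1)]] t(1) ch(2)[OF t(1)] by metis
    show "speed A g \<gamma> t = s t"
      using speed_eq[OF \<gamma> ab(1,3) t(2,3) ch[OF t(1)] v] s[OF t(1) ch[OF t(1)] v] by simp
  qed simp
qed

lemma piecewise_C1_curveE:
  assumes "piecewise_C1_curve X A \<gamma>"
  obtains S where "pathin X \<gamma>" "finite S" "{0, 1} \<subseteq> S" "S \<subseteq> {0..1}"
    "\<And>a b. a \<in> S \<Longrightarrow> b \<in> S \<Longrightarrow> a < b \<Longrightarrow> S \<inter> {a<..<b} = {} \<Longrightarrow> C1_curve_on A {a..b} \<gamma>"
proof -
  obtain S where S: "finite S \<and> {0, 1} \<subseteq> S \<and> S \<subseteq> {0..1} \<and>
      (\<forall>a\<in>S. \<forall>b\<in>S. a < b \<and> S \<inter> {a<..<b} = {} \<longrightarrow> C1_curve_on A {a..b} \<gamma>)"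
    using assms unfolding piecewise_C1_curve_def by (elim conjE) (erule exE, rule that)
  have "pathin X \<gamma>" using assms unfolding piecewise_C1_curve_def by (elim conjE)
  then show thesis
    by (rule that[of S]) (use S in \<open>elim conjE, blast\<close>)+
qed

text \<open>Induction on the number of break points below \<open>b\<close>: the largest of them cuts
  off a single piece.\<close>

lemma speed_integrable:
  assumes "piecewise_C1_curve X A \<gamma>"
  shows "speed A g \<gamma> integrable_on {0..1}"
proof -
  obtain S where \<gamma>: "pathin X \<gamma>" and S: "finite S" "{0, 1} \<subseteq> S" "S \<subseteq> {0..1}"
    "\<And>a b. a \<in> S \<Longrightarrow> b \<in> S \<Longrightarrow> a < b \<Longrightarrow> S \<inter> {a<..<b} = {} \<Longrightarrow> C1_curve_on A {a..b} \<gamma>"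
    using piecewise_C1_curveE[OF assms] by metis
  have "speed A g \<gamma> integrable_on {0..b}" if "b \<in> S" for b
    using that
  proof (induction "card {s \<in> S. s < b}" arbitrary: b rule: less_induct)
    case less
    have b: "0 \<le> b" "b \<le> 1" using less.prems S(3) by auto
    show ?case
    proof (cases "b = 0")
      case False
      then have b0: "0 < b" using b by simp
      let ?L = "{s \<in> S. s < b}"
      define a where "a = Max ?L"
      have fin: "finite ?L" using S(1) by simp
      have "?L \<noteq> {}" using b0 S(2) by auto
      then have a: "a \<in> ?L" unfolding a_def using fin by (rule Max_in[rotated])
      have a_max: "s \<le> a" if "s \<in> ?L" for s unfolding a_def using fin that by (rule Max_ge)
      have a0: "0 \<le> a" using a S(3) by auto
      have "{s \<in> S. s < a} \<subset> ?L" using a by auto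
      then have "card {s \<in> S. s < a} < card ?L" using fin by (rule psubset_card_mono[rotated])
      then have 1: "speed A g \<gamma> integrable_on {0..a}" using less.hyps a by blast
      have "S \<inter> {a<..<b} = {}" using a_max by force
      then have 2: "speed A g \<gamma> integrable_on {a..b}"
        using a less.prems a0 b by (intro speed_integrable_on_piece[OF \<gamma>] S(4)) auto
      show ?thesis
        using a a0 by (intro Henstock_Kurzweil_Integration.integrable_combine[OF _ _ 1 2]) auto
    qed (use integrable_on_refl[of "speed A g \<gamma>" "0::real"] in simp)
  qed
  then show ?thesis using S(2) by blast
qed

lemma piece_around:
  fixes S :: "real set"
  assumes "finite S" "{0, 1} \<subseteq> S" "0 < t" "t < 1" "t \<notin> S"
  obtains a b where "a \<in> S" "b \<in> S" "a < t" "t < b" "S \<inter> {a<..<b} = {}"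
proof
  let ?L = "{s \<in> S. s < t}" and ?R = "{s \<in> S. t < s}"
  have f: "finite ?L" "finite ?R" using assms by auto
  have ne: "?L \<noteq> {}" "?R \<noteq> {}" using assms by auto
  show "Max ?L \<in> S" "Max ?L < t" using Max_in[OF f(1) ne(1)] by auto
  show "Min ?R \<in> S" "t < Min ?R" using Min_in[OF f(2) ne(2)] by auto
  show "S \<inter> {Max ?L<..<Min ?R} = {}"
  proof (rule ccontr)
    assume "S \<inter> {Max ?L<..<Min ?R} \<noteq> {}"
    then obtain s where s: "s \<in> S" "Max ?L < s" "s < Min ?R" by auto
    then have "s \<notin> ?L" "s \<notin> ?R" using Max_ge[OF f(1)] Min_le[OF f(2)] by (auto simp: not_le[symmetric])
    then show False using s(1) assms(5) by (auto simp: not_less)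
  qed
qed

text \<open>Away from break points, Cauchy-Schwarz for the metric bounds the derivative of
  \<open>ln (e + k)\<close> along the curve by \<open>K\<close> times the speed. The fundamental
  theorem of calculus tolerates the finite exceptional set.\<close>

lemma log_variation_le_length:
  assumes \<gamma>: "piecewise_C1_curve X A \<gamma>" and e: "smooth_function A e" and K: "K \<ge> 0"
    and pos: "\<And>q. q \<in> topspace X \<Longrightarrow> e q + k > 0"
    and grad: "\<And>c x. c \<in> A \<Longrightarrow> x \<in> dom_of c \<Longrightarrow> grad_sq e c x \<le> K\<^sup>2 * (e x + k)\<^sup>2"
  shows "\<bar>ln (e (\<gamma> 1) + k) - ln (e (\<gamma> 0) + k)\<bar> \<le> K * curve_length A g \<gamma>"
proof -
  obtain S where p: "pathin X \<gamma>" and S: "finite S" "{0, 1} \<subseteq> S" "S \<subseteq> {0..1}"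
    "\<And>a b. a \<in> S \<Longrightarrow> b \<in> S \<Longrightarrow> a < b \<Longrightarrow> S \<inter> {a<..<b} = {} \<Longrightarrow> C1_curve_on A {a..b} \<gamma>"
    using piecewise_C1_curveE[OF \<gamma>] by metis
  define \<phi> where "\<phi> t = ln (e (\<gamma> t) + k)" for t
  have pos\<gamma>: "e (\<gamma> t) + k > 0" if "t \<in> {0..1}" for t using pos path_in_topspace[OF p that] by blast
  have "\<exists>d. (\<phi> has_vector_derivative d) (at t) \<and> \<bar>d\<bar> \<le> K * speed A g \<gamma> t" if t: "t \<in> {0<..<1} - S" for t
  proof -
    obtain a b where ab: "a \<in> S" "b \<in> S" "a < t" "t < b" "S \<inter> {a<..<b} = {}"
      using piece_around[OF S(1,2), of t] t by auto
    have ab01: "0 \<le> a" "b \<le> 1" using ab S(3) by auto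
    have t01: "t \<in> {0..1}" using t by auto
    obtain c where c: "c \<in> A" "\<gamma> t \<in> dom_of c" using chart_at path_in_topspace[OF p t01] by blast
    have "C1_curve_on A {a..b} \<gamma>" using ab by (intro S(4)) auto
    from C1_curve_onD[OF this c(1)] obtain v where v: "((coord c \<circ> \<gamma>) has_vector_derivative v) (at t within {a..b})"
      using c(2) ab(3,4) by (metis atLeastAtMost_iff less_imp_le)
    have sp: "speed A g \<gamma> t = sqrt (v \<bullet> (g c (\<gamma> t) *v v))"
      by (rule speed_eq[OF p ab01 ab(3,4) c v])
    have atab: "at t within {a..b} = at t" by (rule at_within_Icc_at[OF ab(3,4)])
    have "(e \<circ> param c has_derivative (\<lambda>v. gradient e c (\<gamma> t) \<bullet> v)) (at ((coord c \<circ> \<gamma>) t))"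
      using function_has_derivative[OF e c] by simp
    from diff_chain_at[OF v[unfolded atab has_vector_derivative_def] this]
    have "((e \<circ> param c) \<circ> (coord c \<circ> \<gamma>) has_derivative
        (\<lambda>v. gradient e c (\<gamma> t) \<bullet> v) \<circ> (\<lambda>s. s *\<^sub>R v)) (at t)" .
    then have "(e \<circ> \<gamma> has_derivative (\<lambda>v. gradient e c (\<gamma> t) \<bullet> v) \<circ> (\<lambda>s. s *\<^sub>R v)) (at t)"
    proof (rule has_derivative_transform_eventually)
      have "eventually (\<lambda>s. \<gamma> s \<in> dom_of c) (at t within {a..b})"
        using ab ab01 c by (intro eventually_in_chart[OF p]) auto
      then show "eventually (\<lambda>s. ((e \<circ> param c) \<circ> (coord c \<circ> \<gamma>)) s = (e \<circ> \<gamma>) s) (at t)"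
        unfolding atab by eventually_elim (simp add: param_coord[OF c(1)])
    qed (use c in \<open>simp_all add: param_coord\<close>)
    then have "((\<lambda>t. e (\<gamma> t)) has_real_derivative (gradient e c (\<gamma> t) \<bullet> v)) (at t)"
      unfolding has_real_derivative_iff_has_vector_derivative has_vector_derivative_def by (simp add: o_def)
    from DERIV_add[OF this DERIV_const[of k]]
    have "((\<lambda>t. e (\<gamma> t) + k) has_real_derivative (gradient e c (\<gamma> t) \<bullet> v)) (at t)" by simp
    from DERIV_chain2[OF DERIV_ln_divide[OF pos\<gamma>[OF t01]] this]
    have 1: "(\<phi> has_real_derivative (1 / (e (\<gamma> t) + k) * (gradient e c (\<gamma> t) \<bullet> v))) (at t)"
      by (simp add: \<phi>_def[abs_def])
    have "sqrt (grad_sq e c (\<gamma> t)) \<le> sqrt (K\<^sup>2 * (e (\<gamma> t) + k)\<^sup>2)"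
      using grad[OF c] by simp
    also have "\<dots> = K * (e (\<gamma> t) + k)"
      using K pos\<gamma>[OF t01] by (simp add: real_sqrt_mult)
    finally have gle: "sqrt (grad_sq e c (\<gamma> t)) \<le> K * (e (\<gamma> t) + k)" .
    have "\<bar>gradient e c (\<gamma> t) \<bullet> v\<bar> \<le> sqrt (grad_sq e c (\<gamma> t)) * speed A g \<gamma> t"
      unfolding grad_sq_def sp by (rule spd_cauchy_schwarz[OF spd_g[OF c]])
    also have "\<dots> \<le> K * (e (\<gamma> t) + k) * speed A g \<gamma> t"
      using gle speed_nonneg[OF p t01] by (rule mult_right_mono)
    finally have "\<bar>1 / (e (\<gamma> t) + k) * (gradient e c (\<gamma> t) \<bullet> v)\<bar> \<le> K * speed A g \<gamma> t"
      using pos\<gamma>[OF t01] by (simp add: abs_mult field_simps)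
    then show ?thesis using 1 has_real_derivative_iff_has_vector_derivative by blast
  qed
  then obtain \<phi>' where \<phi>': "\<And>t. t \<in> {0<..<1} - S \<Longrightarrow> (\<phi> has_vector_derivative \<phi>' t) (at t)"
    "\<And>t. t \<in> {0<..<1} - S \<Longrightarrow> \<bar>\<phi>' t\<bar> \<le> K * speed A g \<gamma> t" by metis
  \<comment> \<open>The value 0 at exceptional points leaves the integral unchanged and makes the
    bound by the speed valid at every \<open>t\<close>.\<close>
  define \<psi> where "\<psi> t = (if t \<in> {0<..<1} - S then \<phi>' t else 0)" for t
  have "continuous_map (top_of_set {0..1}) euclideanreal (e \<circ> \<gamma>)"
    by (rule continuous_map_compose[OF p[unfolded pathin_def] continuous_smooth_function[OF e]])
  then have "continuous_on {0..1} \<phi>"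
    unfolding \<phi>_def using pos\<gamma> by (intro continuous_on_ln continuous_intros) (force simp: o_def)+
  then have int: "(\<psi> has_integral (\<phi> 1 - \<phi> 0)) {0..1}"
    using \<phi>'(1) by (intro fundamental_theorem_of_calculus_interior_strong[OF S(1)]) (auto simp: \<psi>_def)
  have "norm (integral {0..1} \<psi>) \<le> integral {0..1} (\<lambda>t. K * speed A g \<gamma> t)"
  proof (rule integral_norm_bound_integral)
    show "\<psi> integrable_on {0..1}" using int by blast
    show "(\<lambda>t. K * speed A g \<gamma> t) integrable_on {0..1}"
      using speed_integrable[OF \<gamma>] by (rule integrable_on_mult_right)
    show "norm (\<psi> t) \<le> K * speed A g \<gamma> t" if "t \<in> {0..1}" for t
      using \<phi>'(2) K speed_nonneg[OF p that] by (simp add: \<psi>_def)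
  qed
  then show ?thesis
    using integral_unique[OF int] by (simp add: curve_length_def \<phi>_def)
qed

text \<open>The image of a straight coordinate segment is a competitor in the infimum. It must be
  shown to be \<open>C^1\<close> in every chart of the atlas, which is where continuity of the
  derivative of the transition maps enters.\<close>

lemma segment_curve:
  assumes c: "c \<in> A" and seg: "closed_segment x y \<subseteq> range_of c" and B: "B \<ge> 0"
    and bound: "\<And>z v. z \<in> closed_segment x y \<Longrightarrow> v \<bullet> (local_g c z *v v) \<le> B\<^sup>2 * (norm v)\<^sup>2"
  shows "riem_dist X A g (param c x) (param c y) \<le> ereal (B * dist x y)"
proof -
  define l where "l t = x + t *\<^sub>R (y - x)" for t :: real
  define \<gamma> where "\<gamma> = param c \<circ> l"
  have lseg: "l t \<in> closed_segment x y" if "t \<in> {0..1}" for t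
    using that by (auto simp: l_def closed_segment_def algebra_simps intro!: exI[of _ t])
  have lr: "l t \<in> range_of c" if "t \<in> {0..1}" for t using lseg[OF that] seg by blast
  have dl: "(l has_vector_derivative (y - x)) (at t within T)" for t T
    unfolding l_def by (auto intro!: derivative_eq_intros)
  have cl: "continuous_on T l" for T unfolding l_def by (intro continuous_intros)
  have "continuous_map (top_of_set {0..1}) (top_of_set (range_of c)) l"
    using cl lr by (auto simp: continuous_map_in_subtopology)
  then have p: "pathin X \<gamma>"
    unfolding pathin_def \<gamma>_def by (rule continuous_map_compose[OF _ continuous_param[OF c]])
  have "C1_curve_on A {0..1} \<gamma>"
    unfolding C1_curve_on_def
  proof
    fix d assume d: "d \<in> A"
    let ?O = "coord c ` (dom_of c \<inter> dom_of d)"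
    let ?T = "{t \<in> {0..1}. \<gamma> t \<in> dom_of d}"
    let ?D = "\<lambda>t. transition_deriv c d (\<gamma> t) (y - x)"
    have O: "l t \<in> ?O" "coord c (\<gamma> t) = l t" "\<gamma> t \<in> dom_of c" if "t \<in> ?T" for t
    proof -
      have l: "l t \<in> range_of c" using that lr by auto
      show "coord c (\<gamma> t) = l t" "\<gamma> t \<in> dom_of c"
        using coord_param[OF l] param_in_dom[OF l] by (simp_all add: \<gamma>_def)
      then show "l t \<in> ?O" using that by (intro image_eqI[of _ _ "\<gamma> t"]) auto
    qed
    have lin: "?D t = (\<Sum>b\<in>Basis. ((y - x) \<bullet> b) *\<^sub>R frechet_derivative (transition c d) (at (l t)) b)"
      if t: "t \<in> ?T" for t
    proof -
      have "linear (transition_deriv c d (\<gamma> t))"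
        using has_derivative_linear[OF transition_has_derivative[OF c d O(3)[OF t]]] t by simp
      then have "?D t = (\<Sum>b\<in>Basis. ((y - x) \<bullet> b) *\<^sub>R transition_deriv c d (\<gamma> t) b)"
        by (subst euclidean_representation[of "y - x", symmetric]) (simp only: linear_sum linear_scale)
      then show ?thesis using O(2)[OF t] by (simp add: transition_deriv_def)
    qed
    have "continuous_on ?T (\<lambda>t. frechet_derivative (transition c d) (at (l t)) b)" if "b \<in> Basis" for b
      using smooth_on_continuous_on[OF smooth_on_frechet_derivative[OF smooth_transition[OF c d] that]] cl
      by (rule continuous_on_compose2) (use O(1) in blast)
    then have "continuous_on ?T (\<lambda>t. \<Sum>b\<in>Basis. ((y - x) \<bullet> b) *\<^sub>R frechet_derivative (transition c d) (at (l t)) b)"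
      by (intro continuous_intros)
    then have "continuous_on ?T ?D" by (rule continuous_on_eq) (simp add: lin)
    moreover have "((coord d \<circ> \<gamma>) has_vector_derivative ?D t) (at t within {0..1})" if "t \<in> {0..1}" "\<gamma> t \<in> dom_of d" for t
    proof -
      have t: "t \<in> ?T" using that by simp
      have "((coord c \<circ> \<gamma>) has_vector_derivative (y - x)) (at t within {0..1})"
        using that(1) coord_param[OF lr] by (intro has_vector_derivative_transform[OF _ _ dl]) (auto simp: \<gamma>_def)
      from vector_derivative_transition[OF p c d _ that(1) O(3)[OF t] that(2) this]
      show ?thesis by simp
    qed
    ultimately show "\<exists>D. continuous_on ?T D \<and> (\<forall>t\<in>{0..1}. \<gamma> t \<in> dom_of d \<longrightarrow>
        ((coord d \<circ> \<gamma>) has_vector_derivative D t) (at t within {0..1}))" by blast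
  qed
  then have pw: "piecewise_C1_curve X A \<gamma>"
    unfolding piecewise_C1_curve_def using p by (intro conjI exI[of _ "{0, 1}"]) auto
  have sp: "speed A g \<gamma> t \<le> B * dist x y" if t: "t \<in> {0<..<1}" for t
  proof -
    have t01: "t \<in> {0..1}" using t by auto
    have "((coord c \<circ> \<gamma>) has_vector_derivative (y - x)) (at t within {0..1})"
      using t01 coord_param[OF lr] by (intro has_vector_derivative_transform[OF _ _ dl]) (auto simp: \<gamma>_def)
    then have "speed A g \<gamma> t = sqrt ((y - x) \<bullet> (g c (\<gamma> t) *v (y - x)))"
      using t param_in_dom[OF lr[OF t01]] by (intro speed_eq[OF p _ _ _ _ c]) (auto simp: \<gamma>_def)
    also have "\<dots> \<le> sqrt (B\<^sup>2 * (norm (y - x))\<^sup>2)"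
      using bound[OF lseg[OF t01], of "y - x"] by (simp add: local_g_def \<gamma>_def)
    also have "\<dots> = B * dist x y"
      using B by (simp add: real_sqrt_mult dist_norm norm_minus_commute)
    finally show ?thesis .
  qed
  \<comment> \<open>The speed was computed only at interior times, so the comparison is made over
    the open interval.\<close>
  have "integral {0<..<1} (speed A g \<gamma>) \<le> integral {0<..<1} (\<lambda>t::real. B * dist x y)"
  proof (rule Henstock_Kurzweil_Integration.integral_le)
    show "speed A g \<gamma> integrable_on {0<..<1}"
      using speed_integrable[OF pw] by (simp add: integrable_on_open_interval_real)
    show "(\<lambda>t. B * dist x y) integrable_on {0<..<1::real}"
      unfolding integrable_on_open_interval_real by (intro integrable_continuous_real continuous_on_const)
  qed (rule sp)
  then have "integral {0..1} (speed A g \<gamma>) \<le> integral {0..1} (\<lambda>t::real. B * dist x y)"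
    by (simp only: integral_open_interval_real)
  then have "curve_length A g \<gamma> \<le> B * dist x y"
    by (simp add: curve_length_def)
  moreover have "\<gamma> 0 = param c x" "\<gamma> 1 = param c y" by (simp_all add: \<gamma>_def l_def)
  then have "riem_dist X A g (param c x) (param c y) \<le> ereal (curve_length A g \<gamma>)"
    unfolding riem_dist_def using pw by (intro INF_lower) simp
  ultimately show ?thesis using order_trans ereal_less_eq(3) by blast
qed

section \<open>Uniform distance bounds and nodal domains\<close>


lemma log_ratio_le_dist:
  assumes e: "smooth_function A e" and K: "K > 0"
    and pos: "\<And>q. q \<in> topspace X \<Longrightarrow> e q + k > 0"
    and grad: "\<And>c x. c \<in> A \<Longrightarrow> x \<in> dom_of c \<Longrightarrow> grad_sq e c x \<le> K\<^sup>2 * (e x + k)\<^sup>2"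
  shows "ereal (\<bar>ln (e y + k) - ln (e x + k)\<bar> / K) \<le> riem_dist X A g x y"
  unfolding riem_dist_def
proof (rule INF_greatest)
  fix \<gamma> assume "\<gamma> \<in> {\<gamma>. piecewise_C1_curve X A \<gamma> \<and> \<gamma> 0 = x \<and> \<gamma> 1 = y}"
  then show "ereal (\<bar>ln (e y + k) - ln (e x + k)\<bar> / K) \<le> ereal (curve_length A g \<gamma>)"
    using log_variation_le_length[OF _ e less_imp_le[OF K] pos grad, of \<gamma>] K
    by (auto simp: pos_divide_le_eq mult.commute)
qed

text \<open>Both orders of the arguments are recorded, the second through the reversed segment,
  because symmetry of \<open>riem_dist\<close> is not established separately.\<close>

lemma ball_dist:
  assumes c: "c \<in> A" and B: "B \<ge> 0" and sub: "cball x R \<subseteq> range_of c"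
    and bound: "\<And>v z. z \<in> cball x R \<Longrightarrow> v \<bullet> (local_g c z *v v) \<le> B\<^sup>2 * (norm v)\<^sup>2"
    and y: "y \<in> cball x R"
  shows "riem_dist X A g (param c x) (param c y) \<le> ereal (B * R)"
    "riem_dist X A g (param c y) (param c x) \<le> ereal (B * R)"
proof -
  have "x \<in> cball x R" using y by (auto intro: order_trans[OF zero_le_dist])
  then have seg: "closed_segment x y \<subseteq> cball x R" "closed_segment y x \<subseteq> cball x R"
    using y by (simp_all add: closed_segment_subset convex_cball)
  have d: "B * dist x y \<le> B * R" "B * dist y x \<le> B * R"
    using y B by (auto intro!: mult_left_mono simp: dist_commute)
  show "riem_dist X A g (param c x) (param c y) \<le> ereal (B * R)"
    using segment_curve[OF c order_trans[OF seg(1) sub] B bound] seg(1) d(1)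
    by (meson ereal_less_eq(3) order_trans subsetD)
  show "riem_dist X A g (param c y) (param c x) \<le> ereal (B * R)"
    using segment_curve[OF c order_trans[OF seg(2) sub] B bound] seg(2) d(2)
    by (meson ereal_less_eq(3) order_trans subsetD)
qed

lemma dist_locally_finite:
  assumes p: "p \<in> topspace X"
  shows "\<exists>U D. openin X U \<and> p \<in> U \<and> (\<forall>y\<in>U. riem_dist X A g p y \<le> ereal D)"
proof -
  obtain c r \<alpha> N where c: "c \<in> A" "p \<in> dom_of c" and r: "0 < r" "r \<le> 1" "cball (coord c p) r \<subseteq> range_of c"
    and N: "\<alpha> > 0" "N \<ge> 1" and cb: "\<And>y. y \<in> cball (coord c p) r \<Longrightarrow> coeff_bound (local_g c) \<alpha> N y"
    by (rule chart_ball[OF p]) (rule that)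
  have "riem_dist X A g p y \<le> ereal (real CARD('n) * N * r)" if "y \<in> dom_of c" "coord c y \<in> ball (coord c p) r" for y
  proof -
    have "riem_dist X A g (param c (coord c p)) (param c (coord c y)) \<le> ereal (real CARD('n) * N * r)"
      by (rule ball_dist(1)[OF c(1) _ r(3) coeff_bound_form[OF cb N(2)]]) (use that N in auto)
    then show ?thesis using that c by (simp add: param_coord)
  qed
  moreover have "openin X {y \<in> dom_of c. coord c y \<in> ball (coord c p) r}"
    by (rule openin_chart_preimage[OF c(1) open_ball])
  ultimately show ?thesis using c r by (intro exI[of _ "{y \<in> dom_of c. coord c y \<in> ball (coord c p) r}"]) auto
qed

text \<open>The connected set \<open>S\<close> is essential for inner radii: containing both
  \<open>x\<close> and a zero, it must cross the frontier of the nodal domain of \<open>x\<close>,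
  and the crossing point is still within \<open>r\<close> of \<open>x\<close>.\<close>

definition zero_within :: "real \<Rightarrow> ('a \<Rightarrow> real) \<Rightarrow> 'a \<Rightarrow> bool" where
  "zero_within r e x \<longleftrightarrow> (\<exists>S. connectedin X S \<and> x \<in> S \<and> (\<exists>z\<in>S. e z = 0) \<and>
    (\<forall>y\<in>S. riem_dist X A g x y \<le> ereal r \<and> riem_dist X A g y x \<le> ereal r))"

lemma zeros_nearby_local:
  assumes p: "p \<in> topspace X"
  shows "\<exists>U C. openin X U \<and> p \<in> U \<and> (\<forall>x\<in>U. \<forall>\<mu> e. C \<le> \<mu> \<longrightarrow> 0 < \<mu> \<longrightarrow> smooth_function A e \<longrightarrow>
    has_laplacian A g e (\<lambda>q. \<mu>\<^sup>2 * e q) \<longrightarrow> zero_within (C / \<mu>) e x)"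
proof -
  obtain c r \<alpha> N where c: "c \<in> A" "p \<in> dom_of c" and r: "0 < r" "r \<le> 1" "cball (coord c p) r \<subseteq> range_of c"
    and N: "\<alpha> > 0" "N \<ge> 1" and cb: "\<And>y. y \<in> cball (coord c p) r \<Longrightarrow> coeff_bound (local_g c) \<alpha> N y"
    by (rule chart_ball[OF p]) (rule that)
  interpret L: local_metric "range_of c" "local_g c" by (rule local_metric[OF c(1)])
  define k where "k = 8 * real CARD('n) * N + 8 * \<alpha>"
  \<comment> \<open>Chosen so that \<open>R = \<rho> / \<mu>\<close> gives
    \<open>32 * \<alpha> * R\<^sup>2 * \<mu>\<^sup>2 = k\<^sup>2 + 1\<close>, just above the
    threshold \<open>k\<^sup>2\<close> of the barrier argument.\<close>
  define \<rho> where "\<rho> = sqrt ((k\<^sup>2 + 1) / (32 * \<alpha>))"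
  have "0 < (k\<^sup>2 + 1) / (32 * \<alpha>)" using N(1) by (intro divide_pos_pos add_nonneg_pos) auto
  then have \<rho>: "\<rho> > 0" "\<rho>\<^sup>2 = (k\<^sup>2 + 1) / (32 * \<alpha>)" by (simp_all add: \<rho>_def)
  define B where "B = real CARD('n) * N"
  have B: "B \<ge> 0" using N(2) by (simp add: B_def)
  \<comment> \<open>The first entry forces \<open>R \<le> r / 2\<close>, so that balls centred in
    the half ball stay in the chart ball; the second converts the coordinate radius into a
    Riemannian one.\<close>
  define C where "C = max (2 * \<rho> / r) (B * \<rho>)"
  show ?thesis
  proof (rule exI[of _ "{x \<in> dom_of c. coord c x \<in> ball (coord c p) (r / 2)}"], rule exI[of _ C],
      intro conjI ballI allI impI)
    show "openin X {x \<in> dom_of c. coord c x \<in> ball (coord c p) (r / 2)}"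
      by (rule openin_chart_preimage[OF c(1) open_ball])
    show "p \<in> {x \<in> dom_of c. coord c x \<in> ball (coord c p) (r / 2)}" using c r by simp
    fix x \<mu> e
    assume x: "x \<in> {x \<in> dom_of c. coord c x \<in> ball (coord c p) (r / 2)}" and \<mu>: "C \<le> \<mu>" "0 < \<mu>"
      and e: "smooth_function A e" "has_laplacian A g e (\<lambda>q. \<mu>\<^sup>2 * e q)"
    define R where "R = \<rho> / \<mu>"
    define x' where "x' = coord c x"
    have "2 * \<rho> / r \<le> \<mu>" using \<mu>(1) by (simp add: C_def)
    then have R: "0 < R" "R \<le> r / 2" using \<rho>(1) \<mu>(2) r(1) by (simp_all add: R_def field_simps)
    have sub: "cball x' R \<subseteq> cball (coord c p) r"
    proof
      fix z assume "z \<in> cball x' R"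
      then have "dist (coord c p) z \<le> dist (coord c p) x' + R"
        using dist_triangle[of "coord c p" z x'] by simp
      then show "z \<in> cball (coord c p) r" using x R(2) by (simp add: x'_def)
    qed
    have cr: "cball x' R \<subseteq> range_of c" using sub r(3) by blast
    have bd: "coeff_bound (local_g c) \<alpha> N y" if "y \<in> cball x' R" for y using that sub by (intro cb) blast
    have "k\<^sup>2 < 32 * \<alpha> * R\<^sup>2 * \<mu>\<^sup>2"
    proof -
      have "32 * \<alpha> * R\<^sup>2 * \<mu>\<^sup>2 = 32 * \<alpha> * \<rho>\<^sup>2" using \<mu>(2) by (simp add: R_def power_divide)
      also have "\<dots> = k\<^sup>2 + 1" using N(1) by (simp add: \<rho>(2))
      finally show ?thesis by simp
    qed
    then have big: "(8 * real CARD('n) * N + 8 * \<alpha>)\<^sup>2 < 32 * \<alpha> * R\<^sup>2 * \<mu>\<^sup>2" by (simp add: k_def)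
    obtain z where z: "z \<in> cball x' R" "(e \<circ> param c) z = 0"
    proof (rule solution_has_zero_in_ball[OF L.open_U R(1) _ cr _ N(1) coeff_boundD(1,2,5)[OF bd] _ big
          smooth_function_local[OF e(1) c(1)]])
      show "R \<le> 1" using R r by simp
      show "dual_metric (local_g c) i j y = dual_metric (local_g c) j i y" if "y \<in> cball x' R" for i j y
        using that cr by (intro L.dual_metric_sym) blast
      show "0 < \<mu>\<^sup>2" using \<mu> by simp
      show "second_order (dual_metric (local_g c)) (e \<circ> param c) y
        + first_order (drift (local_g c)) (e \<circ> param c) y = - \<mu>\<^sup>2 * (e \<circ> param c) y"
        if "y \<in> cball x' R" for y
      proof -
        have "y \<in> range_of c" using that cr by blast
        from laplacian_local[OF e c(1) this] show ?thesis by simp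
      qed
    qed blast
    have BR: "B * R \<le> C / \<mu>" using \<mu>(2) by (simp add: R_def C_def divide_right_mono)
    show "zero_within (C / \<mu>) e x"
      unfolding zero_within_def
    proof (intro exI[of _ "param c ` cball x' R"] conjI ballI)
      have "connectedin (top_of_set (range_of c)) (cball x' R)"
        using cr by (simp add: connectedin_subtopology convex_connected)
      then show "connectedin X (param c ` cball x' R)"
        by (rule connectedin_continuous_map_image[OF continuous_param[OF c(1)]])
      have px: "param c x' = x" using x c by (simp add: x'_def param_coord)
      then show "x \<in> param c ` cball x' R" using R by (intro image_eqI[of _ _ x']) auto
      show "\<exists>z\<in>param c ` cball x' R. e z = 0" using z by auto
      fix y assume "y \<in> param c ` cball x' R"
      then obtain y' where y': "y' \<in> cball x' R" "y = param c y'" by blast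
      note d = ball_dist[OF c(1) B cr coeff_bound_form[OF bd N(2), folded B_def] y'(1), unfolded px, folded y'(2)]
      show "riem_dist X A g x y \<le> ereal (C / \<mu>)" "riem_dist X A g y x \<le> ereal (C / \<mu>)"
        using d BR by (meson ereal_less_eq(3) order_trans)+
    qed
  qed
qed

lemma zeros_nearby:
  "\<exists>C>0. \<forall>x\<in>topspace X. \<forall>\<mu> e. C \<le> \<mu> \<longrightarrow> smooth_function A e \<longrightarrow>
    has_laplacian A g e (\<lambda>q. \<mu>\<^sup>2 * e q) \<longrightarrow> zero_within (C / \<mu>) e x"
proof -
  let ?P = "\<lambda>C x. \<forall>\<mu> e. C \<le> \<mu> \<longrightarrow> 0 < \<mu> \<longrightarrow> smooth_function A e \<longrightarrow>
    has_laplacian A g e (\<lambda>q. \<mu>\<^sup>2 * e q) \<longrightarrow> zero_within (C / \<mu>) e x"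
  have mono: "?P D x" if P: "?P C x" and "C \<le> D" for C D x
  proof (intro allI impI)
    fix \<mu> e assume a: "D \<le> \<mu>" "0 < \<mu>" "smooth_function A e" "has_laplacian A g e (\<lambda>q. \<mu>\<^sup>2 * e q)"
    have "C \<le> \<mu>" using a(1) \<open>C \<le> D\<close> by simp
    from P[rule_format, OF this a(2-4)] have "zero_within (C / \<mu>) e x" .
    moreover have "ereal (C / \<mu>) \<le> ereal (D / \<mu>)" using \<open>C \<le> D\<close> a(2) by (simp add: divide_right_mono)
    ultimately show "zero_within (D / \<mu>) e x"
      unfolding zero_within_def by (meson order_trans)
  qed
  have "\<exists>C. \<forall>x\<in>topspace X. ?P C x"
    by (rule local_to_global[of ?P, OF zeros_nearby_local mono])
  then obtain C where C: "\<And>x. x \<in> topspace X \<Longrightarrow> ?P C x" by blast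
  show ?thesis
  proof (intro exI[of _ "max C 1"] conjI ballI allI impI)
    fix x \<mu> e assume "x \<in> topspace X" and a: "max C 1 \<le> \<mu>" "smooth_function A e" "has_laplacian A g e (\<lambda>q. \<mu>\<^sup>2 * e q)"
    then have "?P (max C 1) x" by (intro mono[OF C]) auto
    moreover have "0 < \<mu>" using a(1) by simp
    ultimately show "zero_within (max C 1 / \<mu>) e x"
      using a by blast
  qed simp
qed

section \<open>Eigenfunctions change sign\<close>

lemma laplacian_in_chart_expand:
  assumes "smooth_function A e" "c \<in> A" "p \<in> dom_of c"
  shows "laplacian_in_chart g c e p = - ((\<Sum>k\<in>UNIV. \<Sum>l\<in>UNIV. dual_metric (local_g c) k l (coord c p) *
        partial_deriv l (partial_deriv k (e \<circ> param c)) (coord c p))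
      + first_order (drift (local_g c)) (e \<circ> param c) (coord c p))"
proof -
  interpret L: local_metric "range_of c" "local_g c" by (rule local_metric[OF assms(2)])
  show ?thesis
    unfolding laplacian_in_chart_def Let_def
    using L.divergence_form_expand[OF smooth_function_local[OF assms(1,2)] coord_in_range[OF assms(3)]]
    by (simp add: local_g_def dual_metric_def minus_divide_left[symmetric])
qed

lemma smooth_function_uminus:
  assumes "smooth_function A e"
  shows "smooth_function A (\<lambda>p. - e p)"
  unfolding smooth_function_def
proof
  fix c assume c: "c \<in> A"
  have "smooth_on (range_of c) (\<lambda>x. - (e \<circ> param c) x)"
    by (rule smooth_on_uminus[OF open_range[OF c] smooth_function_local[OF assms c]])
  then show "smooth_on (coord c ` dom_of c) ((\<lambda>p. - e p) \<circ> param c)"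
    by (simp add: range_of_def o_def)
qed

lemma has_laplacian_uminus:
  assumes e: "smooth_function A e" and h: "has_laplacian A g e h"
  shows "has_laplacian A g (\<lambda>p. - e p) (\<lambda>p. - h p)"
  unfolding has_laplacian_def
proof (intro ballI)
  fix c p assume c: "c \<in> A" "p \<in> dom_of c"
  note se = smooth_function_local[OF e c(1)]
  have eq: "(\<lambda>p. - e p) \<circ> param c = (\<lambda>x. - (e \<circ> param c) x)" by (simp add: o_def)
  have "laplacian_in_chart g c (\<lambda>p. - e p) p = - laplacian_in_chart g c e p"
    unfolding laplacian_in_chart_expand[OF smooth_function_uminus[OF e] c] laplacian_in_chart_expand[OF e c] eq
    by (simp only: partial_deriv_uminus_on[OF open_range[OF c(1)] se coord_in_range[OF c(2)]] mult_minus_right sum_negf)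
  then show "laplacian_in_chart g c (\<lambda>p. - e p) p = - h p"
    using h c by (simp add: has_laplacian_def)
qed

lemma eigenfunction_uminus:
  assumes "nonconstant_eigenfunction X A g \<mu> e"
  shows "nonconstant_eigenfunction X A g \<mu> (\<lambda>p. - e p)"
proof -
  have s: "smooth_function A e" "has_laplacian A g e (\<lambda>p. \<mu>\<^sup>2 * e p)" "\<not> e constant_on topspace X"
    using assms by (simp_all add: nonconstant_eigenfunction_def)
  have "e constant_on topspace X" if "(\<lambda>p. - e p) constant_on topspace X"
    using that unfolding constant_on_def by (metis minus_minus)
  then show ?thesis
    using s smooth_function_uminus[OF s(1)] has_laplacian_uminus[OF s(1,2)]
    by (auto simp: nonconstant_eigenfunction_def)
qed

text \<open>At a local minimum the first-order terms vanish and the second-order part is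
  nonnegative, while together they equal \<open>- M * e p\<close>.\<close>

lemma nonpos_at_local_min:
  assumes e: "smooth_function A e" "has_laplacian A g e (\<lambda>q. M * e q)" and M: "M > 0"
    and W: "openin X W" "p \<in> W" and min: "\<And>q. q \<in> W \<Longrightarrow> e p \<le> e q"
  shows "e p \<le> 0"
proof -
  obtain c where c: "c \<in> A" "p \<in> dom_of c" using chart_at openin_subset[OF W(1)] W(2) by blast
  interpret L: local_metric "range_of c" "local_g c" by (rule local_metric[OF c(1)])
  define V where "V = coord c ` (dom_of c \<inter> W)"
  have "openin (subtopology X (dom_of c)) (dom_of c \<inter> W)"
    unfolding openin_subtopology using W by (intro exI[of _ W]) auto
  then have "openin (top_of_set (range_of c)) V"
    unfolding V_def using homeomorphic_imp_open_map[OF homeo[OF c(1)]] by (simp add: open_map_def)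
  then have V: "open V" using L.open_U openin_open_trans by blast
  have VU: "V \<subseteq> range_of c" by (auto simp: V_def range_of_def)
  have pV: "coord c p \<in> V" using c W by (simp add: V_def)
  have sV: "smooth_on V (e \<circ> param c)" by (rule smooth_on_subset[OF smooth_function_local[OF e(1) c(1)] VU])
  have minV: "(e \<circ> param c) (coord c p) \<le> (e \<circ> param c) y" if "y \<in> V" for y
    using that min c by (auto simp: V_def param_coord)
  have psd: "0 \<le> quad_form (\<lambda>i j. dual_metric (local_g c) i j (coord c p)) v" for v
    using spd_form_nonneg[OF spd_matrix_inv[OF L.spd_G[OF coord_in_range[OF c(2)]]], of "\<chi> i. v i"]
    by (simp add: inner_matrix_vector_sum dual_metric_def)
  have "0 \<le> second_order (dual_metric (local_g c)) (e \<circ> param c) (coord c p)"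
    by (rule trace_product_psd_nonneg[OF L.dual_metric_sym[OF coord_in_range[OF c(2)]] psd
      second_derivative_local_min[OF V sV pV minV]])
  moreover have "partial_deriv l (e \<circ> param c) (coord c p) = 0" for l
    by (rule partial_deriv_local_min[OF V sV pV minV])
  ultimately have "M * e p \<le> 0"
    using laplacian_local[OF e c(1) coord_in_range[OF c(2)]] by (simp add: param_coord[OF c])
  then show ?thesis using M by (simp add: mult_le_0_iff)
qed

text \<open>The strong maximum principle comes from the gradient estimate for \<open>ln (e + \<epsilon>)\<close> as \<open>\<epsilon> \<rightarrow> 0\<close>.\<close>

lemma zero_set_open_if_nonneg:
  assumes e: "smooth_function A e" "has_laplacian A g e (\<lambda>q. M * e q)" and M: "M > 0"
    and nonneg: "\<And>q. q \<in> topspace X \<Longrightarrow> e q \<ge> 0"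
  shows "openin X {q \<in> topspace X. e q = 0}"
proof (subst openin_subopen, intro ballI)
  fix p assume p: "p \<in> {q \<in> topspace X. e q = 0}"
  obtain C where C: "C > 0" "\<And>M e k c x. admissible_shift M e k \<Longrightarrow> c \<in> A \<Longrightarrow> x \<in> dom_of c \<Longrightarrow>
    grad_sq e c x \<le> C * (1 + M) * (e x + k)\<^sup>2"
    using gradient_estimate by blast
  define K where "K = sqrt (C * (1 + M))"
  have K: "K > 0" "K\<^sup>2 = C * (1 + M)" using C(1) M by (simp_all add: K_def)
  obtain U D where U: "openin X U" "p \<in> U" "\<And>y. y \<in> U \<Longrightarrow> riem_dist X A g p y \<le> ereal D"
    using dist_locally_finite[of p] p by auto
  have "e y = 0" if y: "y \<in> U" for y
  proof -
    have yX: "y \<in> topspace X" using y openin_subset[OF U(1)] by blast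
    \<comment> \<open>The constant \<open>K\<close> does not depend on \<epsilon>, so from the zero
      \<open>p\<close> to \<open>y\<close> the logarithm of \<open>e + \<epsilon>\<close> grows by
      at most \<open>K * D\<close>.\<close>
    have "e y \<le> \<epsilon> * (exp (K * D) - 1)" if \<epsilon>: "\<epsilon> > 0" for \<epsilon>
    proof -
      have pos: "e q + \<epsilon> > 0" if "q \<in> topspace X" for q using nonneg[OF that] \<epsilon> by simp
      have "grad_sq e c x \<le> K\<^sup>2 * (e x + \<epsilon>)\<^sup>2" if "c \<in> A" "x \<in> dom_of c" for c x
        unfolding K(2) using nonneg \<epsilon> that e M by (intro C(2)) (auto simp: admissible_shift_def)
      from log_ratio_le_dist[OF e(1) K(1) pos this, of y p]
      have "ereal (\<bar>ln (e y + \<epsilon>) - ln (e p + \<epsilon>)\<bar> / K) \<le> ereal D"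
        using U(3)[OF y] by (rule order_trans)
      then have "ln (e y + \<epsilon>) - ln \<epsilon> \<le> K * D"
        using K(1) p by (simp add: pos_divide_le_eq mult.commute)
      then have "ln (e y + \<epsilon>) \<le> ln (\<epsilon> * exp (K * D))"
        using \<epsilon> by (simp add: ln_mult)
      then have "e y + \<epsilon> \<le> \<epsilon> * exp (K * D)"
        using pos[OF yX] \<epsilon> by simp
      then show ?thesis by (simp add: algebra_simps)
    qed
    moreover have "((\<lambda>\<epsilon>. \<epsilon> * (exp (K * D) - 1)) \<longlongrightarrow> 0 * (exp (K * D) - 1)) (at_right 0)"
      by (intro tendsto_intros)
    ultimately have "e y \<le> 0 * (exp (K * D) - 1)"
      by (intro tendsto_lowerbound[of _ _ "at_right (0::real)"]) (auto simp: eventually_at_right_less eventually_at_filter)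
    then show ?thesis using nonneg[OF yX] by simp
  qed
  then show "\<exists>T. openin X T \<and> p \<in> T \<and> T \<subseteq> {q \<in> topspace X. e q = 0}"
    using U openin_subset[OF U(1)] by (intro exI[of _ U]) auto
qed

text \<open>If \<open>e\<close> were nonnegative, its zero set would be clopen, and so would be the
  nonempty set \<open>W\<close> where it is positive. The minimum over the compact set
  \<open>W\<close> is then a local minimum on the manifold with positive value, contrary to
  \<open>nonpos_at_local_min\<close>.\<close>

lemma eigenfunction_negative_somewhere:
  assumes e: "nonconstant_eigenfunction X A g \<mu> e" and \<mu>: "\<mu> > 0"
  shows "\<exists>q\<in>topspace X. e q < 0"
proof (rule ccontr)
  assume "\<not> ?thesis"
  then have nonneg: "e q \<ge> 0" if "q \<in> topspace X" for q using that by force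
  have s: "smooth_function A e" "has_laplacian A g e (\<lambda>q. \<mu>\<^sup>2 * e q)" and M: "\<mu>\<^sup>2 > 0"
    using e \<mu> by (simp_all add: nonconstant_eigenfunction_def)
  define W where "W = topspace X - {q \<in> topspace X. e q = 0}"
  have clW: "closedin X W"
    unfolding W_def using zero_set_open_if_nonneg[OF s M nonneg] by blast
  have Weq: "W = {q \<in> topspace X. e q \<in> - {0}}" by (auto simp: W_def)
  have opW: "openin X W"
    unfolding Weq by (rule openin_continuous_map_preimage[OF continuous_smooth_function[OF s(1)]]) auto
  have "W \<noteq> {}"
  proof
    assume "W = {}"
    then have "e constant_on topspace X" by (auto simp: W_def constant_on_def)
    then show False using e by (simp add: nonconstant_eigenfunction_def)
  qed
  moreover have "compact (e ` W)"
    using image_compactin[OF closedin_compact_space[OF compact clW] continuous_smooth_function[OF s(1)]] by simp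
  ultimately obtain p where p: "p \<in> W" "\<And>q. q \<in> W \<Longrightarrow> e p \<le> e q"
    using compact_attains_inf[of "e ` W"] by auto
  then have "e p \<le> 0" using nonpos_at_local_min[OF s M opW] by blast
  then show False using p(1) nonneg[of p] by (auto simp: W_def)
qed


lemma eigenfunction_positive_somewhere:
  assumes "nonconstant_eigenfunction X A g \<mu> e" "\<mu> > 0"
  shows "\<exists>q\<in>topspace X. e q > 0"
  using eigenfunction_negative_somewhere[OF eigenfunction_uminus[OF assms(1)] assms(2)] by simp

section \<open>Distance between zeros and extrema\<close>

lemma dist_zero_to_min:
  "\<exists>C>0. \<forall>\<mu>\<ge>1. \<forall>e x z. nonconstant_eigenfunction X A g \<mu> e \<longrightarrow> x \<in> topspace X \<longrightarrow>
    (\<forall>y\<in>topspace X. e x \<le> e y) \<longrightarrow> e z = 0 \<longrightarrow>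
    ereal (C / \<mu>) \<le> riem_dist X A g x z \<and> ereal (C / \<mu>) \<le> riem_dist X A g z x"
proof -
  obtain C where C: "C > 0" "\<And>M e k c x. admissible_shift M e k \<Longrightarrow> c \<in> A \<Longrightarrow> x \<in> dom_of c \<Longrightarrow>
    grad_sq e c x \<le> C * (1 + M) * (e x + k)\<^sup>2"
    using gradient_estimate by blast
  show ?thesis
  \<comment> \<open>The numerator is the growth of the logarithm from \<open>k / 2\<close> at the
    minimum to \<open>k\<close> at a zero; the factor 2 under the root comes from
    \<open>1 + \<mu>\<^sup>2 \<le> 2 * \<mu>\<^sup>2\<close> for
    \<open>\<mu> \<ge> 1\<close>.\<close>
  proof (rule exI[of _ "ln 2 / sqrt (2 * C)"], intro conjI allI impI)
    show "0 < ln 2 / sqrt (2 * C)" using C(1) by simp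
    fix \<mu> :: real and e x z
    assume \<mu>: "1 \<le> \<mu>" and e: "nonconstant_eigenfunction X A g \<mu> e" and x: "x \<in> topspace X"
      "\<forall>y\<in>topspace X. e x \<le> e y" and z: "e z = 0"
    have s: "smooth_function A e" "has_laplacian A g e (\<lambda>q. \<mu>\<^sup>2 * e q)"
      using e by (simp_all add: nonconstant_eigenfunction_def)
    have ex: "e x < 0"
      using eigenfunction_negative_somewhere[OF e] \<mu> x(2) by fastforce
    define k where "k = - 2 * e x"
    define K where "K = sqrt (2 * C) * \<mu>"
    have k: "k > 0" "e x + k = k / 2" using ex by (simp_all add: k_def)
    have lower: "k / 2 \<le> e q + k" if "q \<in> topspace X" for q
      using x(2) that k(2) by fastforce
    then have pos: "e q + k > 0" if "q \<in> topspace X" for q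
      using that k(1) by fastforce
    have K: "K > 0" using C(1) \<mu> by (simp add: K_def)
    have grad: "grad_sq e c y \<le> K\<^sup>2 * (e y + k)\<^sup>2" if "c \<in> A" "y \<in> dom_of c" for c y
    proof -
      have "grad_sq e c y \<le> C * (1 + \<mu>\<^sup>2) * (e y + k)\<^sup>2"
        using lower s k(1) by (intro C(2) that) (auto simp: admissible_shift_def field_simps)
      also have "\<dots> \<le> K\<^sup>2 * (e y + k)\<^sup>2"
      proof (rule mult_right_mono)
        have "1 \<le> \<mu>\<^sup>2" using \<mu> by simp
        then have "C * (1 + \<mu>\<^sup>2) \<le> C * (2 * \<mu>\<^sup>2)" using C(1) by (intro mult_left_mono) auto
        then show "C * (1 + \<mu>\<^sup>2) \<le> K\<^sup>2"
          using C(1) by (simp add: K_def power_mult_distrib mult_ac)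
      qed simp
      finally show ?thesis .
    qed
    have l: "\<bar>ln (e z + k) - ln (e x + k)\<bar> = ln 2"
      unfolding z k(2) using k(1) by (simp add: ln_div)
    have "ereal (ln 2 / K) \<le> riem_dist X A g x z" "ereal (ln 2 / K) \<le> riem_dist X A g z x"
      using log_ratio_le_dist[OF s(1) K pos grad, of z x] log_ratio_le_dist[OF s(1) K pos grad, of x z]
        l abs_minus_commute[of "ln (e x + k)"] by simp_all
    then show "ereal (ln 2 / sqrt (2 * C) / \<mu>) \<le> riem_dist X A g x z" "ereal (ln 2 / sqrt (2 * C) / \<mu>) \<le> riem_dist X A g z x"
      by (simp_all add: K_def)
  qed
qed

lemma dist_zero_to_extremum:
  "\<exists>C>0. \<forall>\<mu>\<ge>1. \<forall>e. \<forall>x\<in>concentrating_set X e. \<forall>z. nonconstant_eigenfunction X A g \<mu> e \<longrightarrow> e z = 0 \<longrightarrow>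
    ereal (C / \<mu>) \<le> riem_dist X A g x z \<and> ereal (C / \<mu>) \<le> riem_dist X A g z x"
proof -
  obtain C where C: "C > 0" "\<And>\<mu> e x z. 1 \<le> \<mu> \<Longrightarrow> nonconstant_eigenfunction X A g \<mu> e \<Longrightarrow> x \<in> topspace X \<Longrightarrow>
    \<forall>y\<in>topspace X. e x \<le> e y \<Longrightarrow> e z = 0 \<Longrightarrow>
    ereal (C / \<mu>) \<le> riem_dist X A g x z \<and> ereal (C / \<mu>) \<le> riem_dist X A g z x"
    using dist_zero_to_min by blast
  show ?thesis
  proof (rule exI[of _ C], intro conjI allI impI ballI C(1))
    fix \<mu> :: real and e x z
    assume \<mu>: "1 \<le> \<mu>" and x: "x \<in> concentrating_set X e" and e: "nonconstant_eigenfunction X A g \<mu> e" and z: "e z = 0"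
    have xX: "x \<in> topspace X" using x by (simp add: concentrating_set_def)
    have both: "ereal (C / \<mu>) \<le> riem_dist X A g x z \<and> ereal (C / \<mu>) \<le> riem_dist X A g z x"
    proof (cases "\<forall>y\<in>topspace X. e x \<le> e y")
      case True
      then show ?thesis by (intro C(2)[OF \<mu> e xX _ z])
    next
      case False
      then have "\<forall>y\<in>topspace X. - e x \<le> - e y" using x by (auto simp: concentrating_set_def)
      then show ?thesis by (intro C(2)[OF \<mu> eigenfunction_uminus[OF e] xX]) (simp_all add: z)
    qed
    then show "ereal (C / \<mu>) \<le> riem_dist X A g x z" "ereal (C / \<mu>) \<le> riem_dist X A g z x" by simp_all
  qed
qed

section \<open>Nodal domains: sign and frontier\<close>

lemma nodal_domain_sign:
  assumes e: "smooth_function A e" and \<Omega>: "\<Omega> \<in> nodal_domains X e" and p: "p \<in> \<Omega>" "q \<in> \<Omega>"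
  shows "e p > 0 \<longleftrightarrow> e q > 0"
proof -
  have "connectedin (subtopology X (topspace X - nodal_set X e)) \<Omega>"
    using \<Omega> unfolding nodal_domains_def by (rule connectedin_connected_components_of)
  then have c: "connectedin X \<Omega>" and sub: "\<Omega> \<subseteq> topspace X - nodal_set X e"
    by (simp_all add: connectedin_subtopology)
  have conn: "connected (e ` \<Omega>)"
    using connectedin_continuous_map_image[OF continuous_smooth_function[OF e] c] by simp
  have nz: "0 \<notin> e ` \<Omega>" using sub by (auto simp: nodal_set_def)
  show ?thesis
  proof (rule ccontr)
    assume "\<not> ?thesis"
    then have "(e p \<le> 0 \<and> 0 \<le> e q) \<or> (e q \<le> 0 \<and> 0 \<le> e p)" by auto
    then show False using connectedD_interval[OF conn] nz p by blast
  qed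
qed

text \<open>Around a point with \<open>e y \<noteq> 0\<close> a small coordinate ball is connected
  and free of zeros. If it meets the domain it lies inside by maximality of components, so
  \<open>y\<close> would be interior.\<close>

lemma nodal_domain_frontier:
  assumes e: "smooth_function A e" and \<Omega>: "\<Omega> \<in> nodal_domains X e" and y: "y \<in> X frontier_of \<Omega>"
  shows "e y = 0"
proof (rule ccontr)
  assume nz: "e y \<noteq> 0"
  let ?U = "topspace X - nodal_set X e"
  have yX: "y \<in> topspace X" using y frontier_of_subset_topspace[of X \<Omega>] by (rule subsetD[rotated])
  obtain c where c: "c \<in> A" "y \<in> dom_of c" using chart_at[OF yX] by blast
  have ce: "continuous_on (range_of c) (e \<circ> param c)"
    by (rule smooth_on_continuous_on[OF smooth_function_local[OF e c(1)]])
  have "open (range_of c \<inter> (e \<circ> param c) -` (- {0}))"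
    by (rule continuous_open_preimage[OF ce open_range[OF c(1)]]) auto
  moreover have "coord c y \<in> range_of c \<inter> (e \<circ> param c) -` (- {0})"
    using c nz by (simp add: coord_in_range param_coord)
  ultimately obtain r where r: "r > 0" "ball (coord c y) r \<subseteq> range_of c \<inter> (e \<circ> param c) -` (- {0})"
    using openE by blast
  let ?B = "ball (coord c y) r"
  define W where "W = {q \<in> dom_of c. coord c q \<in> ?B}"
  have opW: "openin X W" unfolding W_def by (rule openin_chart_preimage[OF c(1) open_ball])
  have yW: "y \<in> W" using c r(1) by (simp add: W_def)
  have Weq: "W = param c ` ?B"
  proof
    show "W \<subseteq> param c ` ?B"
    proof
      fix q assume "q \<in> W"
      then show "q \<in> param c ` ?B"
        using param_coord[OF c(1), of q] by (intro image_eqI[of _ _ "coord c q"]) (auto simp: W_def)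
    qed
    show "param c ` ?B \<subseteq> W"
    proof
      fix q assume "q \<in> param c ` ?B"
      then obtain z where z: "z \<in> ?B" "q = param c z" by blast
      then have "z \<in> range_of c" using r(2) by blast
      then show "q \<in> W" using z coord_param param_in_dom by (simp add: W_def)
    qed
  qed
  have "connectedin (top_of_set (range_of c)) ?B"
    using r(2) by (simp add: connectedin_subtopology convex_connected)
  then have cW: "connectedin X W"
    unfolding Weq by (rule connectedin_continuous_map_image[OF continuous_param[OF c(1)]])
  have "W \<subseteq> ?U"
  proof
    fix q assume q: "q \<in> W"
    have "q \<in> topspace X" using q openin_subset[OF opW] by blast
    moreover have "e q \<noteq> 0" using q r(2) unfolding Weq by auto
    ultimately show "q \<in> ?U" by (simp add: nodal_set_def)
  qed
  then have cWU: "connectedin (subtopology X ?U) W" using cW by (simp add: connectedin_subtopology)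
  have "y \<in> X closure_of \<Omega>" using y by (simp add: frontier_of_def)
  then have "\<exists>q. q \<in> \<Omega> \<and> q \<in> W" using opW yW unfolding in_closure_of by blast
  then have "\<not> disjnt \<Omega> W" by (auto simp: disjnt_def)
  then have "W \<subseteq> \<Omega>"
    using connected_components_of_maximal[OF _ cWU] \<Omega> unfolding nodal_domains_def by blast
  then have "y \<in> X interior_of \<Omega>"
    using interior_of_maximal[OF _ opW] yW by blast
  then show False using y by (simp add: frontier_of_def)
qed

definition nodal_domain_of :: "('a \<Rightarrow> real) \<Rightarrow> 'a \<Rightarrow> 'a set" where
  "nodal_domain_of e p = connected_component_of_set (subtopology X (topspace X - nodal_set X e)) p"

lemma nodal_domain_of:
  assumes "p \<in> topspace X" "e p \<noteq> 0"
  shows "nodal_domain_of e p \<in> nodal_domains X e" "p \<in> nodal_domain_of e p"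
proof -
  have p: "p \<in> topspace (subtopology X (topspace X - nodal_set X e))"
    using assms by (simp add: nodal_set_def)
  show "nodal_domain_of e p \<in> nodal_domains X e"
    unfolding nodal_domains_def connected_components_of_def nodal_domain_of_def using p by (rule imageI)
  show "p \<in> nodal_domain_of e p"
    using p by (simp add: nodal_domain_of_def connected_component_of_refl)
qed

section \<open>Assembly of the comparability statements\<close>

lemma comparable_at_infinityI:
  assumes "C1 > 0" "C2 > 0"
    and "\<And>\<mu> e. 1 \<le> \<mu> \<Longrightarrow> C2 \<le> \<mu> \<Longrightarrow> E \<mu> e \<Longrightarrow> ereal (C1 / \<mu>) \<le> Q \<mu> e \<and> Q \<mu> e \<le> ereal (C2 / \<mu>)"
  shows "comparable_at_infinity E Q (\<lambda>\<mu>. 1 / \<mu>)"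
proof -
  have "eventually (\<lambda>\<mu>. \<forall>e. E \<mu> e \<longrightarrow> ereal (C1 * (1 / \<mu>)) \<le> Q \<mu> e \<and> Q \<mu> e \<le> ereal (C2 * (1 / \<mu>))) at_top"
    using eventually_ge_at_top[of 1] eventually_ge_at_top[of C2]
    by eventually_elim (simp add: assms(3))
  then show ?thesis
    unfolding comparable_at_infinity_def using assms(1,2) by blast
qed

text \<open>\<open>P\<close> is any selection of an extremal point where \<open>e\<close> is
  nonzero, so that one proof serves the maximum and the minimum. The lower bound evaluates the
  supremum at that point; the upper bound holds at every point of the domain.\<close>

lemma inner_radius_comparable:
  assumes P: "\<And>\<mu> e. \<mu> > 0 \<Longrightarrow> nonconstant_eigenfunction X A g \<mu> e \<Longrightarrow> P \<mu> e \<in> concentrating_set X e \<and> e (P \<mu> e) \<noteq> 0"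
  shows "comparable_at_infinity (nonconstant_eigenfunction X A g)
    (\<lambda>\<mu> e. inner_radius X A g (nodal_domain_of e (P \<mu> e))) (\<lambda>\<mu>. 1 / \<mu>)"
proof -
  obtain C1 where C1: "C1 > 0" "\<And>\<mu> e x z. 1 \<le> \<mu> \<Longrightarrow> x \<in> concentrating_set X e \<Longrightarrow>
    nonconstant_eigenfunction X A g \<mu> e \<Longrightarrow> e z = 0 \<Longrightarrow> ereal (C1 / \<mu>) \<le> riem_dist X A g x z"
    using dist_zero_to_extremum by blast
  obtain C2 where C2: "C2 > 0" "\<And>x \<mu> e. x \<in> topspace X \<Longrightarrow> C2 \<le> \<mu> \<Longrightarrow> smooth_function A e \<Longrightarrow>
    has_laplacian A g e (\<lambda>q. \<mu>\<^sup>2 * e q) \<Longrightarrow> zero_within (C2 / \<mu>) e x"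
    using zeros_nearby by blast
  show ?thesis
  proof (rule comparable_at_infinityI[OF C1(1) C2(1)], rule conjI)
    fix \<mu> e assume \<mu>: "1 \<le> \<mu>" "C2 \<le> \<mu>" and e: "nonconstant_eigenfunction X A g \<mu> e"
    have s: "smooth_function A e" "has_laplacian A g e (\<lambda>q. \<mu>\<^sup>2 * e q)"
      using e by (simp_all add: nonconstant_eigenfunction_def)
    let ?p = "P \<mu> e" and ?O = "nodal_domain_of e (P \<mu> e)"
    have p: "?p \<in> concentrating_set X e" "e ?p \<noteq> 0" using P[OF _ e] \<mu>(1) by simp_all
    have pX: "?p \<in> topspace X" using p(1) by (simp add: concentrating_set_def)
    note O = nodal_domain_of[of ?p e, OF pX p(2)]
    have subO: "?O \<subseteq> topspace X - nodal_set X e"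
      using connectedin_connected_components_of[OF O(1)[unfolded nodal_domains_def]]
      by (simp add: connectedin_subtopology)
    show "ereal (C1 / \<mu>) \<le> inner_radius X A g ?O"
      unfolding inner_radius_def
    proof (rule SUP_upper2[OF O(2)], rule INF_greatest)
      fix y assume "y \<in> X frontier_of ?O"
      then have "e y = 0" by (rule nodal_domain_frontier[OF s(1) O(1)])
      then show "ereal (C1 / \<mu>) \<le> riem_dist X A g ?p y" by (rule C1(2)[OF \<mu>(1) p(1) e])
    qed
    show "inner_radius X A g ?O \<le> ereal (C2 / \<mu>)"
      unfolding inner_radius_def
    proof (rule SUP_least)
      fix x assume x: "x \<in> ?O"
      then have "x \<in> topspace X" using subO by blast
      from C2(2)[OF this \<mu>(2) s]
      obtain S z where S: "connectedin X S" "x \<in> S" "z \<in> S" "e z = 0"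
        "\<forall>y\<in>S. riem_dist X A g x y \<le> ereal (C2 / \<mu>) \<and> riem_dist X A g y x \<le> ereal (C2 / \<mu>)"
        unfolding zero_within_def by (elim exE conjE bexE) (rule that)
      \<comment> \<open>The connected set \<open>S\<close> has \<open>x\<close> inside the domain
        and \<open>z\<close> outside, hence meets its frontier.\<close>
      have "z \<notin> ?O" using subO S(4) by (auto simp: nodal_set_def)
      then have "S \<inter> X frontier_of ?O \<noteq> {}"
        using x S(2,3) by (intro connectedin_Int_frontier_of[OF S(1)]) auto
      then obtain y where y: "y \<in> S" "y \<in> X frontier_of ?O" by blast
      have "riem_dist X A g x y \<le> ereal (C2 / \<mu>)" using S(5) y(1) by simp
      then show "(INF y\<in>X frontier_of ?O. riem_dist X A g x y) \<le> ereal (C2 / \<mu>)"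
        by (rule INF_lower2[OF y(2)])
    qed
  qed
qed

lemma nodal_concentrating_dist_comparable:
  "comparable_at_infinity (nonconstant_eigenfunction X A g)
    (\<lambda>\<mu> e. riem_set_dist X A g (nodal_set X e) (concentrating_set X e)) (\<lambda>\<mu>. 1 / \<mu>)"
proof -
  obtain C1 where C1: "C1 > 0" "\<And>\<mu> e x z. 1 \<le> \<mu> \<Longrightarrow> x \<in> concentrating_set X e \<Longrightarrow>
    nonconstant_eigenfunction X A g \<mu> e \<Longrightarrow> e z = 0 \<Longrightarrow> ereal (C1 / \<mu>) \<le> riem_dist X A g z x"
    using dist_zero_to_extremum by blast
  obtain C2 where C2: "C2 > 0" "\<And>x \<mu> e. x \<in> topspace X \<Longrightarrow> C2 \<le> \<mu> \<Longrightarrow> smooth_function A e \<Longrightarrow>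
    has_laplacian A g e (\<lambda>q. \<mu>\<^sup>2 * e q) \<Longrightarrow> zero_within (C2 / \<mu>) e x"
    using zeros_nearby by blast
  show ?thesis
  proof (rule comparable_at_infinityI[OF C1(1) C2(1)], rule conjI)
    fix \<mu> e assume \<mu>: "1 \<le> \<mu>" "C2 \<le> \<mu>" and e: "nonconstant_eigenfunction X A g \<mu> e"
    have s: "smooth_function A e" "has_laplacian A g e (\<lambda>q. \<mu>\<^sup>2 * e q)"
      using e by (simp_all add: nonconstant_eigenfunction_def)
    show "ereal (C1 / \<mu>) \<le> riem_set_dist X A g (nodal_set X e) (concentrating_set X e)"
      unfolding riem_set_dist_def
      using C1(2)[OF \<mu>(1) _ e] by (intro INF_greatest) (simp add: nodal_set_def)
    have "topspace X \<noteq> {}" using eigenfunction_negative_somewhere[OF e] \<mu>(1) by force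
    from attains_max[OF continuous_smooth_function[OF s(1)] this]
    obtain p where p: "p \<in> topspace X" "\<forall>q\<in>topspace X. e q \<le> e p" by blast
    then have pc: "p \<in> concentrating_set X e" by (simp add: concentrating_set_def)
    from C2(2)[OF p(1) \<mu>(2) s]
    obtain S z where S: "connectedin X S" "z \<in> S" "e z = 0"
      "\<forall>y\<in>S. riem_dist X A g p y \<le> ereal (C2 / \<mu>) \<and> riem_dist X A g y p \<le> ereal (C2 / \<mu>)"
      unfolding zero_within_def by (elim exE conjE bexE) (rule that)
    have "z \<in> topspace X" using S(1,2) connectedin_subset_topspace by blast
    then have zn: "z \<in> nodal_set X e" using S(3) by (simp add: nodal_set_def)
    have "riem_dist X A g z p \<le> ereal (C2 / \<mu>)" using S(2,4) by simp
    then show "riem_set_dist X A g (nodal_set X e) (concentrating_set X e) \<le> ereal (C2 / \<mu>)"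
      unfolding riem_set_dist_def by (intro INF_lower2[OF zn] INF_lower2[OF pc])
  qed
qed

lemma extremal_points:
  assumes e: "nonconstant_eigenfunction X A g \<mu> e" and \<mu>: "\<mu> > 0"
  shows "\<exists>p\<in>concentrating_set X e. e p > 0" "\<exists>p\<in>concentrating_set X e. e p < 0"
proof -
  have s: "smooth_function A e" using e by (simp add: nonconstant_eigenfunction_def)
  obtain p q where p: "p \<in> topspace X" "e p > 0" and q: "q \<in> topspace X" "e q < 0"
    using eigenfunction_positive_somewhere[OF e \<mu>] eigenfunction_negative_somewhere[OF e \<mu>] by blast
  have ne: "topspace X \<noteq> {}" using p by blast
  obtain x where x: "x \<in> topspace X" "\<forall>y\<in>topspace X. e y \<le> e x"
    using attains_max[OF continuous_smooth_function[OF s] ne] by blast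
  then show "\<exists>p\<in>concentrating_set X e. e p > 0"
    using p by (intro bexI[of _ x]) (auto simp: concentrating_set_def intro: less_le_trans)
  obtain x where x: "x \<in> topspace X" "\<forall>y\<in>topspace X. - e y \<le> - e x"
    using attains_max[OF continuous_smooth_function[OF smooth_function_uminus[OF s]] ne] by blast
  then show "\<exists>p\<in>concentrating_set X e. e p < 0"
    using q by (intro bexI[of _ x]) (auto simp: concentrating_set_def intro: le_less_trans)
qed

text \<open>The domains are those of a positive maximum and of a negative minimum; they differ
  because \<open>e\<close> has constant sign on a nodal domain.\<close>

lemma two_nodal_domains_comparable:
  "\<exists>\<Omega>\<^sub>1 \<Omega>\<^sub>2 :: real \<Rightarrow> ('a \<Rightarrow> real) \<Rightarrow> 'a set.
    (\<forall>\<mu>>0. \<forall>e. nonconstant_eigenfunction X A g \<mu> e \<longrightarrow>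
       \<Omega>\<^sub>1 \<mu> e \<in> nodal_domains X e \<and> \<Omega>\<^sub>2 \<mu> e \<in> nodal_domains X e \<and> \<Omega>\<^sub>1 \<mu> e \<noteq> \<Omega>\<^sub>2 \<mu> e) \<and>
    comparable_at_infinity (nonconstant_eigenfunction X A g) (\<lambda>\<mu> e. inner_radius X A g (\<Omega>\<^sub>1 \<mu> e)) (\<lambda>\<mu>. 1 / \<mu>) \<and>
    comparable_at_infinity (nonconstant_eigenfunction X A g) (\<lambda>\<mu> e. inner_radius X A g (\<Omega>\<^sub>2 \<mu> e)) (\<lambda>\<mu>. 1 / \<mu>)"
proof -
  define P where "P \<mu> e = (SOME p. p \<in> concentrating_set X e \<and> e p > 0)" for \<mu> :: real and e
  define Q where "Q \<mu> e = (SOME p. p \<in> concentrating_set X e \<and> e p < 0)" for \<mu> :: real and e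
  have P: "P \<mu> e \<in> concentrating_set X e" "e (P \<mu> e) > 0" and Q: "Q \<mu> e \<in> concentrating_set X e" "e (Q \<mu> e) < 0"
    if "nonconstant_eigenfunction X A g \<mu> e" "\<mu> > 0" for \<mu> e
    using extremal_points[OF that] someI_ex[of "\<lambda>p. p \<in> concentrating_set X e \<and> e p > 0"]
      someI_ex[of "\<lambda>p. p \<in> concentrating_set X e \<and> e p < 0"] by (auto simp: P_def Q_def)
  show ?thesis
  proof (rule exI[of _ "\<lambda>\<mu> e. nodal_domain_of e (P \<mu> e)"],
      rule exI[of _ "\<lambda>\<mu> e. nodal_domain_of e (Q \<mu> e)"], intro conjI allI impI)
    fix \<mu> :: real and e assume \<mu>: "0 < \<mu>" and e: "nonconstant_eigenfunction X A g \<mu> e"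
    have s: "smooth_function A e" using e by (simp add: nonconstant_eigenfunction_def)
    have "P \<mu> e \<in> topspace X" "Q \<mu> e \<in> topspace X" using P(1)[OF e \<mu>] Q(1)[OF e \<mu>] by (simp_all add: concentrating_set_def)
    then have O: "nodal_domain_of e (P \<mu> e) \<in> nodal_domains X e" "P \<mu> e \<in> nodal_domain_of e (P \<mu> e)"
      "nodal_domain_of e (Q \<mu> e) \<in> nodal_domains X e" "Q \<mu> e \<in> nodal_domain_of e (Q \<mu> e)"
      using P(2)[OF e \<mu>] Q(2)[OF e \<mu>] by (auto intro!: nodal_domain_of)
    show "nodal_domain_of e (P \<mu> e) \<in> nodal_domains X e" "nodal_domain_of e (Q \<mu> e) \<in> nodal_domains X e"
      by (rule O(1), rule O(3))
    show "nodal_domain_of e (P \<mu> e) \<noteq> nodal_domain_of e (Q \<mu> e)"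
    proof
      assume "nodal_domain_of e (P \<mu> e) = nodal_domain_of e (Q \<mu> e)"
      then have "P \<mu> e \<in> nodal_domain_of e (Q \<mu> e)" using O(2) by simp
      then show False
        using nodal_domain_sign[OF s O(3) _ O(4)] P(2)[OF e \<mu>] Q(2)[OF e \<mu>] by fastforce
    qed
  next
    show "comparable_at_infinity (nonconstant_eigenfunction X A g)
      (\<lambda>\<mu> e. inner_radius X A g (nodal_domain_of e (P \<mu> e))) (\<lambda>\<mu>. 1 / \<mu>)"
      using P by (intro inner_radius_comparable) (auto dest: P(2))
    show "comparable_at_infinity (nonconstant_eigenfunction X A g)
      (\<lambda>\<mu> e. inner_radius X A g (nodal_domain_of e (Q \<mu> e))) (\<lambda>\<mu>. 1 / \<mu>)"
      using Q by (intro inner_radius_comparable) (auto dest: Q(2))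
  qed
qed

end

theorem theorem5p2:
  fixes X :: "'a topology"
    and A :: "('a, 'n::finite) chart set"
    and g :: "('a, 'n) metric_tensor"
  assumes "closed_riemannian_manifold X A g"
    and "CARD('n) \<ge> 2"
  shows "comparable_at_infinity (nonconstant_eigenfunction X A g)
           (\<lambda>\<mu> e. riem_set_dist X A g (nodal_set X e) (concentrating_set X e)) (\<lambda>\<mu>. 1 / \<mu>)
       \<and> (\<exists>\<Omega>\<^sub>1 \<Omega>\<^sub>2 :: real \<Rightarrow> ('a \<Rightarrow> real) \<Rightarrow> 'a set.
            (\<forall>\<mu>>0. \<forall>e. nonconstant_eigenfunction X A g \<mu> e \<longrightarrow>
               \<Omega>\<^sub>1 \<mu> e \<in> nodal_domains X e \<and> \<Omega>\<^sub>2 \<mu> e \<in> nodal_domains X e \<and> \<Omega>\<^sub>1 \<mu> e \<noteq> \<Omega>\<^sub>2 \<mu> e) \<and>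
            comparable_at_infinity (nonconstant_eigenfunction X A g)
              (\<lambda>\<mu> e. inner_radius X A g (\<Omega>\<^sub>1 \<mu> e)) (\<lambda>\<mu>. 1 / \<mu>) \<and>
            comparable_at_infinity (nonconstant_eigenfunction X A g)
              (\<lambda>\<mu> e. inner_radius X A g (\<Omega>\<^sub>2 \<mu> e)) (\<lambda>\<mu>. 1 / \<mu>))"
proof -
  interpret closed_manifold X A g by unfold_locales (rule assms(1))
  show ?thesis
    by (rule conjI[OF nodal_concentrating_dist_comparable two_nodal_domains_comparable])
qed

end
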